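(* Let $\pi/3<\alpha<2\pi/3$. On a regular tetrahedron in spherical space $\mathbb{S}^3$ with face angle $\alpha$ there exist only finitely many simple closed geodesics.
   Context: $\mathbb{S}^3$ is the three-dimensional spherical space of constant curvature $1$ (the unit sphere in $\mathbb{R}^4$). A regular tetrahedron in $\mathbb{S}^3$ is a closed convex polyhedron with four faces, all of whose faces are congruent regular spherical triangles (on a unit two-sphere) and all of whose vertices are regular trihedral angles; its face angle is the interior angle $\alpha$ of a face triangle. For each $\alpha\in(\pi/3,2\pi/3)$ such a tetrahedron exists and is unique up to rigid motion. "On the tetrahedron" refers to its surface (the union of the faces) with the intrinsic metric. A geodesic on it is a locally shortest curve on the surface; it consists of geodesic segments in the faces, forms equal angles with the common edge when passing from one face to the adjacent one, and does not pass through vertices. A closed geodesic is simple if it has no self-intersections and does not repeat itself; closed geodesics are regarded as unparametrized curves (point sets). *)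

theory Defs
  imports "HOL-Analysis.Analysis"
begin

section \<open>Spherical geometry\<close>

text \<open>
  The unit sphere \<open>sphere 0 1\<close> of a Euclidean space carries its angular metric; \<open>\<S>\<^sup>3\<close> is the
  case of \<open>real ^ 4\<close>.
\<close>

definition sdist :: "'a::euclidean_space \<Rightarrow> 'a \<Rightarrow> real" where
  "sdist x y = arccos (x \<bullet> y)"

definition vec_angle :: "'a::euclidean_space \<Rightarrow> 'a \<Rightarrow> real" where
  "vec_angle x y = arccos ((x \<bullet> y) / (norm x * norm y))"

text \<open>
  For \<open>p\<close> on the sphere and \<open>q \<noteq> \<plusminus>p\<close>, the vector \<open>orth_part p q\<close> is tangent to the sphere at \<open>p\<close>
  and points along the great-circle arc from \<open>p\<close> to \<open>q\<close>.
\<close>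

definition orth_part :: "'a::euclidean_space \<Rightarrow> 'a \<Rightarrow> 'a" where
  "orth_part u x = x - ((x \<bullet> u) / (u \<bullet> u)) *\<^sub>R u"

definition sph_angle :: "'a::euclidean_space \<Rightarrow> 'a \<Rightarrow> 'a \<Rightarrow> real" where
  "sph_angle p q r = vec_angle (orth_part p q) (orth_part p r)"

text \<open>
  The dihedral angle along the edge \<open>pq\<close> between the faces \<open>pqr\<close> and \<open>pqs\<close>, measured in the tangent
  space at \<open>p\<close>: the angle between the edge directions towards \<open>r\<close> and \<open>s\<close> after removing their
  components along the edge direction towards \<open>q\<close>.
\<close>

definition dihedral_angle :: "'a::euclidean_space \<Rightarrow> 'a \<Rightarrow> 'a \<Rightarrow> 'a \<Rightarrow> real" where
  "dihedral_angle p q r s =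
     sph_angle (orth_part p q) (orth_part p r) (orth_part p s)"

definition sph_hull :: "'a::euclidean_space set \<Rightarrow> 'a set" where
  "sph_hull A = sphere 0 1 \<inter> convex_cone hull A"

section \<open>Regular tetrahedra in the three-sphere\<close>

text \<open>
  A polyhedron is given by its set of vertices.  Linear independence of the vertices says that the
  spherical hull is a nondegenerate simplex.
\<close>

definition regular_sph_triangle :: "'a::euclidean_space set \<Rightarrow> real \<Rightarrow> real \<Rightarrow> bool" where
  "regular_sph_triangle A a \<alpha> \<longleftrightarrow>
     A \<subseteq> sphere 0 1 \<and> card A = 3 \<and> independent A \<and>
     (\<forall>p\<in>A. \<forall>q\<in>A - {p}. sdist p q = a) \<and>
     (\<forall>p\<in>A. \<forall>q\<in>A - {p}. \<forall>r\<in>A - {p, q}. sph_angle p q r = \<alpha>)"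

text \<open>The polyhedral angle at \<open>p\<close> spanned by the edges towards the points of \<open>B\<close>.\<close>

definition regular_trihedral_angle :: "'a::euclidean_space \<Rightarrow> 'a set \<Rightarrow> bool" where
  "regular_trihedral_angle p B \<longleftrightarrow> card B = 3 \<and>
     (\<exists>\<beta>. \<forall>q\<in>B. \<forall>r\<in>B - {q}. sph_angle p q r = \<beta>) \<and>
     (\<exists>\<delta>. \<forall>q\<in>B. \<forall>r\<in>B - {q}. \<forall>s\<in>B - {q, r}. dihedral_angle p q r s = \<delta>)"

definition regular_sph_tetrahedron :: "(real ^ 4) set \<Rightarrow> real \<Rightarrow> bool" where
  "regular_sph_tetrahedron V \<alpha> \<longleftrightarrow>
     V \<subseteq> sphere 0 1 \<and> card V = 4 \<and> independent V \<and>
     (\<exists>a. \<forall>p\<in>V. regular_sph_triangle (V - {p}) a \<alpha>) \<and>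
     (\<forall>p\<in>V. regular_trihedral_angle p (V - {p}))"

definition tetrahedron_surface :: "(real ^ 4) set \<Rightarrow> (real ^ 4) set" where
  "tetrahedron_surface V = (\<Union>p\<in>V. sph_hull (V - {p}))"

section \<open>Intrinsic metric and geodesics\<close>

text \<open>
  The length of \<open>c\<close> on \<open>{a..b}\<close> with respect to the angular metric: the supremum over the finite
  partitions \<open>xs\<close> of the lengths of the inscribed geodesic polygons.
\<close>

definition curve_length :: "(real \<Rightarrow> 'a::euclidean_space) \<Rightarrow> real \<Rightarrow> real \<Rightarrow> ennreal" where
  "curve_length c a b =
     (SUP xs\<in>{xs. sorted xs \<and> set xs \<subseteq> {a..b}}.
        ennreal (\<Sum>i<length xs - 1. sdist (c (xs ! i)) (c (xs ! Suc i))))"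

definition intrinsic_dist :: "'a::euclidean_space set \<Rightarrow> 'a \<Rightarrow> 'a \<Rightarrow> ennreal" where
  "intrinsic_dist S x y =
     (INF g\<in>{g. path g \<and> path_image g \<subseteq> S \<and> pathstart g = x \<and> pathfinish g = y}.
        curve_length g 0 1)"

definition shortest_on :: "'a::euclidean_space set \<Rightarrow> (real \<Rightarrow> 'a) \<Rightarrow> real \<Rightarrow> real \<Rightarrow> bool" where
  "shortest_on S c a b \<longleftrightarrow>
     curve_length c a b < \<infinity> \<and> curve_length c a b = intrinsic_dist S (c a) (c b)"

text \<open>
  A closed geodesic is a loop that is locally shortest at every parameter, including the base
  point; composing with \<open>frac\<close> turns the loop into a curve on \<open>\<real>\<close> of period one.
\<close>

definition closed_geodesic :: "'a::euclidean_space set \<Rightarrow> (real \<Rightarrow> 'a) \<Rightarrow> bool" where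
  "closed_geodesic S g \<longleftrightarrow>
     path g \<and> path_image g \<subseteq> S \<and> pathfinish g = pathstart g \<and>
     (\<forall>t. \<exists>e>0. shortest_on S (\<lambda>s. g (frac s)) (t - e) (t + e))"

text \<open>
  Simple closed geodesics as point sets.  \<open>simple_path\<close> excludes self-intersections, repeated
  traversals and constant loops.
\<close>

definition simple_closed_geodesics :: "'a::euclidean_space set \<Rightarrow> 'a set set" where
  "simple_closed_geodesics S = {path_image g |g. closed_geodesic S g \<and> simple_path g}"

end

theory Submission
  imports Defs
begin

text \<open>
  Across an edge \<open>pq\<close> a geodesic is continued in the developed adjacent face: the linear form \<open>h\<close> that
  vanishes on its plane satisfies \<open>h r + h s = k * (h p + h q)\<close>.  A closed geodesic is therefore
  determined by one crossing of an edge, with the values of \<open>h\<close> there up to scale.  It misses the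
  vertices, because the total angle at a vertex is \<open>3 * \<alpha> < 2 * pi\<close>.

  If the curve cuts off the same corner in all three faces that meet there, the form at the innermost
  crossing is invariant under the rotation about that vertex; if it misses an edge, its values are
  \<open>1, -1, 1, -1\<close>.  Otherwise, start with two arcs that cut off a corner next to a vertex \<open>v\<close> and follow
  the strip between the two strands that leave them, until these close up around another vertex.  The
  strands lie in a common half plane of directions, so their length is at most \<open>pi\<close>, while three steps
  have length at least a constant.  So there are only finitely many sequences of steps.

  The sequence determines the curve.  Given two curves with the same sequence, scale their forms so
  that a suitable difference of the two is the same for both strands.  By the conditions at the two
  ends, that difference is then symmetric about two developed vertices that are not collinear, hence
  zero.
\<close>

section \<open>Angular distance\<close>

text \<open>After the local analysis the curve is only a point set: a closed connected subset of the
  surface that near each of its points is cut out by one plane of the developed faces. Simplicity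
  survives as the uniqueness of that plane, which forbids two arcs of the curve in one face to
  cross; every comparison of strands then comes down to signs of 2 by 2 determinants of values of
  forms at vertices. The sign of a form at the vertex ahead decides which edge comes next. Distances
  return only once, to bound the number of steps. Forms are known only up to scale, and the
  quadratic form \<open>dev_form\<close> controls the scale: the development preserves it, so the
  factor gained around the second end vertex of a strip must be 1. Hence the forms of the two
  strands agree at both end vertices. Their difference vanishes at both, so the sequence of steps
  fixes it up to a factor; this is what makes the common scaling of two curves possible.\<close>

lemma inner_unit_bounds:
  fixes x y :: "'a::euclidean_space"
  assumes "norm x = 1" "norm y = 1"
  shows "- 1 \<le> x \<bullet> y" "x \<bullet> y \<le> 1" "\<bar>x \<bullet> y\<bar> \<le> 1"
  using Cauchy_Schwarz_ineq2[of x y] assms by auto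

lemma cos_sdist:
  fixes x y :: "'a::euclidean_space"
  assumes "norm x = 1" "norm y = 1"
  shows "cos (sdist x y) = x \<bullet> y" "0 \<le> sdist x y" "sdist x y \<le> pi"
  using inner_unit_bounds[OF assms] by (auto simp: sdist_def arccos_lbound arccos_ubound)

lemma sdist_commute: "sdist x y = sdist y x"
  by (simp add: sdist_def inner_commute)

lemma sdist_refl [simp]: "norm x = 1 \<Longrightarrow> sdist x x = 0"
  by (simp add: sdist_def dot_square_norm)

lemma unit_inner_eq_1:
  fixes x y :: "'a::euclidean_space"
  assumes "norm x = 1" "norm y = 1" "x \<bullet> y = 1"
  shows "x = y"
proof -
  have "x \<bullet> x = 1" "y \<bullet> y = 1" using assms by (auto simp: norm_eq_1)
  then have "(x - y) \<bullet> (x - y) = 0"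
    unfolding inner_diff_left inner_diff_right inner_commute[of y x] using assms by linarith
  then show ?thesis by simp
qed

lemma unit_inner_eq_m1:
  fixes x y :: "'a::euclidean_space"
  assumes "norm x = 1" "norm y = 1" "x \<bullet> y = - 1"
  shows "y = - x"
  using unit_inner_eq_1[of x "- y"] assms by simp

lemma norm_circle:
  fixes x e :: "'a::euclidean_space"
  assumes "norm x = 1" "norm e = 1" "x \<bullet> e = 0"
  shows "norm (cos \<phi> *\<^sub>R x + sin \<phi> *\<^sub>R e) = 1"
proof -
  have "x \<bullet> x = 1" "e \<bullet> e = 1" using assms by (auto simp: norm_eq_1)
  then have "(cos \<phi> *\<^sub>R x + sin \<phi> *\<^sub>R e) \<bullet> (cos \<phi> *\<^sub>R x + sin \<phi> *\<^sub>R e) = cos \<phi> ^ 2 + sin \<phi> ^ 2"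
    unfolding inner_add_left inner_add_right inner_scaleR_left inner_scaleR_right inner_commute[of e x]
    using assms by (simp add: power2_eq_square)
  then show ?thesis by (simp add: norm_eq_1)
qed

lemma sdist_circle:
  fixes x e :: "'a::euclidean_space"
  assumes "norm x = 1" "norm e = 1" "x \<bullet> e = 0" "\<bar>\<phi> - \<psi>\<bar> \<le> pi"
  shows "sdist (cos \<phi> *\<^sub>R x + sin \<phi> *\<^sub>R e) (cos \<psi> *\<^sub>R x + sin \<psi> *\<^sub>R e) = \<bar>\<phi> - \<psi>\<bar>"
proof -
  have "(cos \<phi> *\<^sub>R x + sin \<phi> *\<^sub>R e) \<bullet> (cos \<psi> *\<^sub>R x + sin \<psi> *\<^sub>R e) = cos (\<phi> - \<psi>)"
    using assms by (simp add: inner_simps inner_commute[of e x] dot_square_norm cos_diff)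
  also have "\<dots> = cos \<bar>\<phi> - \<psi>\<bar>" by (simp add: abs_if) (metis cos_minus minus_diff_eq)
  finally show ?thesis using assms(4) arccos_cos[of "\<bar>\<phi> - \<psi>\<bar>"] by (simp only: sdist_def)
qed

lemma unit_polar:
  fixes x z :: "'a::euclidean_space"
  assumes "norm x = 1" "norm z = 1" "x \<noteq> z" "x \<noteq> - z"
  obtains e where "norm e = 1" "x \<bullet> e = 0" "0 < sdist x z" "sdist x z < pi"
    "z = cos (sdist x z) *\<^sub>R x + sin (sdist x z) *\<^sub>R e"
proof -
  define g where "g = sdist x z"
  have c: "cos g = x \<bullet> z" and g: "0 \<le> g" "g \<le> pi" using cos_sdist assms g_def by auto
  have "g \<noteq> 0" using c unit_inner_eq_1[OF assms(1,2)] assms(3) by (metis cos_zero)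
  moreover have "g \<noteq> pi" using c unit_inner_eq_m1[OF assms(1,2)] assms(4) by (metis cos_pi minus_minus)
  ultimately have g': "0 < g" "g < pi" using g by auto
  then have s: "sin g > 0" by (simp add: sin_gt_zero)
  define e where "e = (1 / sin g) *\<^sub>R (z - cos g *\<^sub>R x)"
  have xe: "x \<bullet> e = 0" using c assms by (simp add: e_def inner_simps dot_square_norm)
  have xx: "x \<bullet> x = 1" "z \<bullet> z = 1" using assms by (auto simp: norm_eq_1)
  have "(z - cos g *\<^sub>R x) \<bullet> (z - cos g *\<^sub>R x) = (sin g)\<^sup>2"
    unfolding inner_diff_left inner_diff_right inner_scaleR_left inner_scaleR_right inner_commute[of z x]
      sin_squared_eq c[symmetric] xx by (simp add: power2_eq_square)
  then have "e \<bullet> e = 1" using s by (simp add: e_def power2_eq_square)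
  then have "norm e = 1" by (simp add: norm_eq_1)
  moreover have "z = cos g *\<^sub>R x + sin g *\<^sub>R e" using s by (simp add: e_def)
  ultimately show ?thesis using that xe g' g_def by auto
qed

text \<open>In the plane of x and z the point y sits at some angle t from x. The sine of
  \<open>g - t\<close> is \<alpha> times the sine of g, hence nonnegative, so y does not overshoot z
  and the distances add.\<close>

lemma sdist_cone_add:
  fixes x z :: "'a::euclidean_space"
  assumes u: "norm x = 1" "norm z = 1" "norm y = 1" and ne: "x \<noteq> - z"
    and y: "y = \<alpha> *\<^sub>R x + \<beta> *\<^sub>R z" "\<alpha> \<ge> 0" "\<beta> \<ge> 0"
  shows "sdist x y + sdist y z = sdist x z"
proof (cases "x = z")
  case True
  then have "y = (\<alpha> + \<beta>) *\<^sub>R x" using y by (simp add: scaleR_left_distrib)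
  then have "\<alpha> + \<beta> = 1" using u y by simp
  then show ?thesis using True u \<open>y = (\<alpha> + \<beta>) *\<^sub>R x\<close> by simp
next
  case False
  obtain e where e: "norm e = 1" "x \<bullet> e = 0" "0 < sdist x z" "sdist x z < pi"
    and z: "z = cos (sdist x z) *\<^sub>R x + sin (sdist x z) *\<^sub>R e"
    using unit_polar[OF u(1,2) False ne] by blast
  define g where "g = sdist x z"
  have sg: "sin g > 0" using e g_def by (simp add: sin_gt_zero)
  have y2: "y = (\<alpha> + \<beta> * cos g) *\<^sub>R x + (\<beta> * sin g) *\<^sub>R e"
    unfolding y(1) by (subst z) (simp add: algebra_simps g_def)
  have "x \<bullet> x = 1" "e \<bullet> e = 1" using u e by (auto simp: norm_eq_1)
  then have "y \<bullet> y = (\<alpha> + \<beta> * cos g)\<^sup>2 + (\<beta> * sin g)\<^sup>2"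
    unfolding y2 inner_add_left inner_add_right inner_scaleR_left inner_scaleR_right inner_commute[of e x]
    using e by (simp add: power2_eq_square)
  then have "(\<alpha> + \<beta> * cos g)\<^sup>2 + (\<beta> * sin g)\<^sup>2 = 1" using u by (simp add: dot_square_norm)
  then obtain t where t: "0 \<le> t" "t \<le> pi" "cos t = \<alpha> + \<beta> * cos g" "sin t = \<beta> * sin g"
    using sincos_total_pi[of "\<beta> * sin g" "\<alpha> + \<beta> * cos g"] y sg by auto
  have "sin (g - t) = \<alpha> * sin g" by (simp add: sin_diff t algebra_simps)
  then have "sin (g - t) \<ge> 0" using y sg by simp
  have "t \<le> g"
  proof (rule ccontr)
    assume "\<not> t \<le> g"
    then have "0 < t - g" "t - g < pi" using t e g_def by auto
    then have "sin (t - g) > 0" by (rule sin_gt_zero)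
    then show False using \<open>sin (g - t) \<ge> 0\<close> by (metis minus_diff_eq sin_minus neg_0_le_iff_le not_less)
  qed
  have y3: "y = cos t *\<^sub>R x + sin t *\<^sub>R e" using y2 t by simp
  have "sdist x y = t" unfolding y3
    using sdist_circle[OF u(1) e(1,2), of 0 t] t by simp
  moreover have "sdist y z = g - t"
    using sdist_circle[OF u(1) e(1,2), of t g] t \<open>t \<le> g\<close> e g_def y3 z by auto
  ultimately show ?thesis using g_def by simp
qed

text \<open>The parts \<open>a\<close>, \<open>b\<close> of x and z orthogonal to y have norms
  \<open>sin A\<close>, \<open>sin B\<close>; Cauchy-Schwarz for them is the cosine addition
  formula. In the equality case \<open>sin B *\<^sub>R a + sin A *\<^sub>R b\<close> has norm zero,
  which puts y on the great circle of x and z.\<close>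

lemma sdist_triangle_aux:
  fixes x y z :: "'a::euclidean_space"
  assumes u: "norm x = 1" "norm y = 1" "norm z = 1"
  shows "x \<bullet> z \<ge> cos (sdist x y + sdist y z)"
    and "x \<bullet> z = cos (sdist x y + sdist y z) \<Longrightarrow>
      sin (sdist y z) *\<^sub>R x + sin (sdist x y) *\<^sub>R z = sin (sdist x y + sdist y z) *\<^sub>R y"
proof -
  define A B where "A = sdist x y" and "B = sdist y z"
  have AB: "cos A = x \<bullet> y" "cos B = y \<bullet> z" "0 \<le> A" "A \<le> pi" "0 \<le> B" "B \<le> pi"
    using cos_sdist u A_def B_def by auto
  have sA: "sin A \<ge> 0" and sB: "sin B \<ge> 0" using AB by (auto intro: sin_ge_zero)
  define a b where "a = x - cos A *\<^sub>R y" and "b = z - cos B *\<^sub>R y"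
  have uu: "x \<bullet> x = 1" "y \<bullet> y = 1" "z \<bullet> z = 1" using u by (auto simp: norm_eq_1)
  have aa: "a \<bullet> a = (sin A)\<^sup>2"
    unfolding a_def inner_diff_left inner_diff_right inner_scaleR_left inner_scaleR_right inner_commute[of y x]
      sin_squared_eq AB(1)[symmetric] uu by (simp add: power2_eq_square)
  have bb: "b \<bullet> b = (sin B)\<^sup>2"
    unfolding b_def inner_diff_left inner_diff_right inner_scaleR_left inner_scaleR_right inner_commute[of z y]
      sin_squared_eq AB(2)[symmetric] uu by (simp add: power2_eq_square)
  then have na: "norm a = sin A" and nb: "norm b = sin B"
    using sA sB unfolding norm_eq_sqrt_inner aa bb by simp_all
  have ab: "a \<bullet> b = x \<bullet> z - cos A * cos B"
    unfolding a_def b_def inner_diff_left inner_diff_right inner_scaleR_left inner_scaleR_right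
      AB(1)[symmetric] AB(2)[symmetric] uu by simp
  have "a \<bullet> b \<ge> - (sin A * sin B)" using Cauchy_Schwarz_ineq2[of a b] na nb by auto
  then show "x \<bullet> z \<ge> cos (sdist x y + sdist y z)" using ab by (simp add: cos_add A_def B_def)
  show "sin (sdist y z) *\<^sub>R x + sin (sdist x y) *\<^sub>R z = sin (sdist x y + sdist y z) *\<^sub>R y"
    if "x \<bullet> z = cos (sdist x y + sdist y z)"
  proof -
    have eq: "a \<bullet> b = - (sin A * sin B)" using that ab by (simp add: cos_add A_def B_def)
    have "(sin B *\<^sub>R a + sin A *\<^sub>R b) \<bullet> (sin B *\<^sub>R a + sin A *\<^sub>R b) =
        (sin B)\<^sup>2 * (a \<bullet> a) + 2 * (sin A * sin B) * (a \<bullet> b) + (sin A)\<^sup>2 * (b \<bullet> b)"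
      by (simp add: inner_simps inner_commute[of b a] power2_eq_square algebra_simps)
    also have "\<dots> = 0" unfolding aa bb eq by (simp add: power2_eq_square)
    finally have "sin B *\<^sub>R a + sin A *\<^sub>R b = 0" by simp
    then have "sin B *\<^sub>R x + sin A *\<^sub>R z = (sin B * cos A + sin A * cos B) *\<^sub>R y"
      by (simp add: a_def b_def algebra_simps)
    then show ?thesis by (simp add: A_def B_def sin_add algebra_simps)
  qed
qed

lemma sdist_triangle:
  fixes x y z :: "'a::euclidean_space"
  assumes u: "norm x = 1" "norm y = 1" "norm z = 1"
  shows "sdist x z \<le> sdist x y + sdist y z"
proof (cases "sdist x y + sdist y z \<le> pi")
  case True
  have "sdist x y + sdist y z = arccos (cos (sdist x y + sdist y z))"
    using True cos_sdist(2)[OF u(1,2)] cos_sdist(2)[OF u(2,3)] by (intro arccos_cos[symmetric]) auto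
  moreover have "sdist x z \<le> arccos (cos (sdist x y + sdist y z))"
    unfolding sdist_def[of x z] using sdist_triangle_aux(1)[OF u] inner_unit_bounds u
    by (intro arccos_le_arccos) auto
  ultimately show ?thesis by simp
next
  case False
  then show ?thesis using cos_sdist(3)[OF u(1,3)] by simp
qed

lemma sdist_triangle_eq:
  fixes x y z :: "'a::euclidean_space"
  assumes u: "norm x = 1" "norm y = 1" "norm z = 1" and ne: "x \<noteq> - z"
    and le: "sdist x y + sdist y z \<le> sdist x z"
  obtains \<alpha> \<beta> where "\<alpha> \<ge> 0" "\<beta> \<ge> 0" "y = \<alpha> *\<^sub>R x + \<beta> *\<^sub>R z"
proof -
  define s where "s = sdist x y + sdist y z"
  have eq: "sdist x z = s" using le sdist_triangle[OF u] s_def by simp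
  have s: "0 \<le> s" "s \<le> pi" using cos_sdist(2,3)[OF u(1,3)] eq by auto
  have "s \<noteq> pi"
  proof
    assume "s = pi"
    then have "x \<bullet> z = - 1" using cos_sdist(1)[OF u(1,3)] eq by simp
    then show False using unit_inner_eq_m1[OF u(1,3)] ne by simp
  qed
  show ?thesis
  proof (cases "s = 0")
    case True
    then have "sdist x y = 0" using cos_sdist(2)[OF u(1,2)] cos_sdist(2)[OF u(2,3)] s_def by linarith
    then have "x = y" using unit_inner_eq_1[OF u(1,2)] cos_sdist(1)[OF u(1,2)] by simp
    then show ?thesis using that[of 1 0] by simp
  next
    case False
    then have ss: "sin s > 0" using s \<open>s \<noteq> pi\<close> by (intro sin_gt_zero) auto
    have "x \<bullet> z = cos s" using cos_sdist(1)[OF u(1,3)] eq by simp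
    then have "sin (sdist y z) *\<^sub>R x + sin (sdist x y) *\<^sub>R z = sin s *\<^sub>R y"
      using sdist_triangle_aux(2)[OF u] s_def by simp
    then have "y = (1 / sin s) *\<^sub>R (sin (sdist y z) *\<^sub>R x + sin (sdist x y) *\<^sub>R z)"
      using ss by simp
    then have "y = (sin (sdist y z) / sin s) *\<^sub>R x + (sin (sdist x y) / sin s) *\<^sub>R z"
      by (simp add: scaleR_right_distrib)
    moreover have "sin (sdist y z) \<ge> 0" "sin (sdist x y) \<ge> 0"
      using cos_sdist(2,3)[OF u(1,2)] cos_sdist(2,3)[OF u(2,3)] by (auto intro: sin_ge_zero)
    ultimately show ?thesis using that[of "sin (sdist y z) / sin s" "sin (sdist x y) / sin s"] ss by simp
  qed
qed

lemma norm_diff_sdist: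
  fixes x y :: "'a::euclidean_space"
  assumes u: "norm x = 1" "norm y = 1"
  shows "(norm (x - y))\<^sup>2 = 2 - 2 * cos (sdist x y)"
proof -
  have "x \<bullet> x = 1" "y \<bullet> y = 1" using u by (auto simp: norm_eq_1)
  then show ?thesis
    unfolding power2_norm_eq_inner inner_diff_left inner_diff_right inner_commute[of y x] cos_sdist(1)[OF u] by simp
qed

lemma sdist_ge_norm:
  fixes x y :: "'a::euclidean_space"
  assumes u: "norm x = 1" "norm y = 1"
  shows "norm (x - y) \<le> sdist x y"
proof -
  define g where "g = sdist x y"
  have g: "cos g = x \<bullet> y" "0 \<le> g" "g \<le> pi" using cos_sdist[OF u] g_def by auto
  have "(norm (x - y))\<^sup>2 = 2 - 2 * cos g" using norm_diff_sdist[OF u] by (simp add: g_def)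
  also have "\<dots> = (2 * sin (g/2))\<^sup>2"
    using cos_double_sin[of "g/2"] by (simp add: power2_eq_square)
  finally have "(norm (x - y))\<^sup>2 = (2 * sin (g/2))\<^sup>2" .
  moreover have "0 \<le> 2 * sin (g / 2)" using g by (simp add: sin_ge_zero)
  ultimately have "norm (x - y) = 2 * sin (g / 2)"
    using norm_ge_zero power2_eq_imp_eq by blast
  also have "\<dots> \<le> g" using sin_x_le_x[of "g/2"] g by simp
  finally show ?thesis by (simp add: g_def)
qed

lemma sdist_less:
  fixes x y :: "'a::euclidean_space"
  assumes u: "norm x = 1" "norm y = 1" and "0 \<le> \<eta>" "\<eta> \<le> pi"
    and n: "(norm (x - y))\<^sup>2 < 2 - 2 * cos \<eta>"
  shows "sdist x y < \<eta>"
proof -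
  have "cos \<eta> < cos (sdist x y)" using n norm_diff_sdist[OF u] by simp
  then show ?thesis using cos_sdist[OF u] assms cos_mono_less_eq by blast
qed

section \<open>Length and intrinsic distance\<close>

definition poly_len :: "(real \<Rightarrow> 'a::euclidean_space) \<Rightarrow> real list \<Rightarrow> real" where
  "poly_len c xs = (\<Sum>i<length xs - 1. sdist (c (xs ! i)) (c (xs ! Suc i)))"

lemma poly_len_simps [simp]:
  "poly_len c [] = 0" "poly_len c [x] = 0"
  "poly_len c (x # y # xs) = sdist (c x) (c y) + poly_len c (y # xs)"
proof -
  show "poly_len c [] = 0" "poly_len c [x] = 0" by (auto simp: poly_len_def)
  have "poly_len c (x # y # xs) = (\<Sum>i<Suc (length xs). sdist (c ((x # y # xs) ! i)) (c ((y # xs) ! i)))"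
    by (simp add: poly_len_def)
  also have "\<dots> = sdist (c x) (c y) + poly_len c (y # xs)"
    by (subst sum.lessThan_Suc_shift) (simp add: poly_len_def)
  finally show "poly_len c (x # y # xs) = sdist (c x) (c y) + poly_len c (y # xs)" .
qed

lemma poly_len_nonneg:
  assumes "\<And>t. t \<in> set xs \<Longrightarrow> norm (c t) = 1"
  shows "0 \<le> poly_len c xs"
  using assms
proof (induction xs rule: induct_list012)
  case (3 x y zs)
  then show ?case using cos_sdist(2)[of "c x" "c y"] by auto
qed auto

lemma poly_len_append:
  "xs \<noteq> [] \<Longrightarrow> ys \<noteq> [] \<Longrightarrow>
     poly_len c (xs @ ys) = poly_len c xs + sdist (c (last xs)) (c (hd ys)) + poly_len c ys"
proof (induction xs rule: induct_list012)
  case (2 x)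
  then show ?case by (cases ys) auto
qed auto

lemma poly_len_append_ge:
  assumes "\<And>t. t \<in> set (xs @ ys) \<Longrightarrow> norm (c t) = 1"
  shows "poly_len c xs + poly_len c ys \<le> poly_len c (xs @ ys)"
proof (cases "xs = [] \<or> ys = []")
  case False
  then show ?thesis using poly_len_append[of xs ys c] cos_sdist(2)[of "c (last xs)" "c (hd ys)"] assms
    by auto
qed auto

lemma poly_len_append_le:
  assumes "\<And>t. t \<in> set (xs @ ys) \<Longrightarrow> norm (c t) = 1" "norm (c m) = 1"
  shows "poly_len c (xs @ ys) \<le> poly_len c (xs @ [m]) + poly_len c (m # ys)"
proof (cases "xs = [] \<or> ys = []")
  case True
  have "poly_len c ys \<le> poly_len c (m # ys)" "poly_len c xs \<le> poly_len c (xs @ [m])"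
    using poly_len_append_ge[of "[m]" ys c] poly_len_append_ge[of xs "[m]" c] assms by force+
  then show ?thesis using True by auto
next
  case False
  then have "poly_len c (m # ys) = sdist (c m) (c (hd ys)) + poly_len c ys"
    using poly_len_append[of "[m]" ys c] by simp
  moreover have "poly_len c (xs @ [m]) = poly_len c xs + sdist (c (last xs)) (c m)"
    using poly_len_append[of xs "[m]" c] False by simp
  ultimately show ?thesis
    using False poly_len_append[of xs ys c] sdist_triangle[of "c (last xs)" "c m" "c (hd ys)"] assms
    by auto
qed

lemma poly_len_cong:
  assumes "\<And>t. t \<in> set xs \<Longrightarrow> c t = c' (\<phi> t)"
  shows "poly_len c xs = poly_len c' (map \<phi> xs)"
  using assms by (induction xs rule: induct_list012) auto

lemma curve_length_poly:
  "curve_length c a b = (SUP xs\<in>{xs. sorted xs \<and> set xs \<subseteq> {a..b}}. ennreal (poly_len c xs))"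
  by (simp add: curve_length_def poly_len_def)

lemma curve_length_upper:
  "sorted xs \<Longrightarrow> set xs \<subseteq> {a..b} \<Longrightarrow> ennreal (poly_len c xs) \<le> curve_length c a b"
  unfolding curve_length_poly by (rule SUP_upper) auto

lemma curve_length_least:
  "(\<And>xs. sorted xs \<Longrightarrow> set xs \<subseteq> {a..b} \<Longrightarrow> ennreal (poly_len c xs) \<le> L) \<Longrightarrow> curve_length c a b \<le> L"
  unfolding curve_length_poly by (rule SUP_least) auto

lemma curve_length_reparam:
  assumes "mono_on {a..b} \<phi>" "\<phi> ` {a..b} \<subseteq> {a'..b'}" "\<And>t. t \<in> {a..b} \<Longrightarrow> c t = c' (\<phi> t)"
  shows "curve_length c a b \<le> curve_length c' a' b'"
proof (rule curve_length_least)
  fix xs assume xs: "sorted xs" "set xs \<subseteq> {a..b}"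
  have "poly_len c xs = poly_len c' (map \<phi> xs)" using xs assms(3) by (intro poly_len_cong) auto
  moreover have "sorted (map \<phi> xs)" unfolding sorted_map
    using xs(1) by (rule sorted_wrt_mono_rel[rotated]) (use assms(1) xs(2) in \<open>auto simp: mono_on_def subset_iff\<close>)
  moreover have "set (map \<phi> xs) \<subseteq> {a'..b'}" using xs assms(2) by auto
  ultimately show "ennreal (poly_len c xs) \<le> curve_length c' a' b'"
    using curve_length_upper by metis
qed

lemma curve_length_superadd:
  assumes "a \<le> m" "m \<le> b" and u: "\<And>t. t \<in> {a..b} \<Longrightarrow> norm (c t) = 1"
  shows "curve_length c a m + curve_length c m b \<le> curve_length c a b"
proof -
  let ?A = "{xs. sorted xs \<and> set xs \<subseteq> {a..m}}" and ?B = "{xs. sorted xs \<and> set xs \<subseteq> {m..b}}"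
  have ne: "?A \<noteq> {}" "?B \<noteq> {}" by (auto intro: exI[of _ "[]"])
  have *: "ennreal (poly_len c xs) + ennreal (poly_len c ys) \<le> curve_length c a b"
    if "xs \<in> ?A" "ys \<in> ?B" for xs ys
  proof -
    have s: "sorted (xs @ ys)" using that by (fastforce simp: sorted_append)
    have r: "set (xs @ ys) \<subseteq> {a..b}" using that assms by (fastforce)
    have "ennreal (poly_len c xs) + ennreal (poly_len c ys) = ennreal (poly_len c xs + poly_len c ys)"
      using that u assms by (intro ennreal_plus[symmetric] poly_len_nonneg) fastforce+
    also have "\<dots> \<le> ennreal (poly_len c (xs @ ys))"
      using poly_len_append_ge[of xs ys c] r u by (intro ennreal_leI) fastforce
    also have "\<dots> \<le> curve_length c a b" using s r by (rule curve_length_upper)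
    finally show ?thesis .
  qed
  have "(SUP xs\<in>?A. ennreal (poly_len c xs)) + (SUP ys\<in>?B. ennreal (poly_len c ys))
     = (SUP xs\<in>?A. ennreal (poly_len c xs) + (SUP ys\<in>?B. ennreal (poly_len c ys)))"
    by (rule ennreal_SUP_add_left[OF ne(1), symmetric])
  also have "\<dots> = (SUP xs\<in>?A. SUP ys\<in>?B. ennreal (poly_len c xs) + ennreal (poly_len c ys))"
    by (subst ennreal_SUP_add_right[OF ne(2)]) simp
  also have "\<dots> \<le> curve_length c a b" using * by (intro SUP_least) auto
  finally show ?thesis by (simp add: curve_length_poly)
qed

lemma curve_length_subadd:
  assumes "a \<le> m" "m \<le> b" and u: "\<And>t. t \<in> {a..b} \<Longrightarrow> norm (c t) = 1"
  shows "curve_length c a b \<le> curve_length c a m + curve_length c m b"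
proof (rule curve_length_least)
  fix xs assume xs: "sorted xs" "set xs \<subseteq> {a..b}"
  define ys zs where "ys = takeWhile (\<lambda>t. t \<le> m) xs" and "zs = dropWhile (\<lambda>t. t \<le> m) xs"
  have eq: "xs = ys @ zs" by (simp add: ys_def zs_def)
  have ys: "\<forall>t\<in>set ys. t \<le> m" unfolding ys_def using set_takeWhileD by fastforce
  have zs: "\<forall>t\<in>set zs. m \<le> t"
  proof (cases zs)
    case (Cons z zs')
    then have "\<not> z \<le> m" unfolding zs_def using hd_dropWhile[of "\<lambda>t. t \<le> m" xs] by force
    moreover have "\<forall>t\<in>set zs. z \<le> t" using xs(1) eq Cons by (auto simp: sorted_append)
    ultimately show ?thesis by auto
  qed auto
  have sy: "sorted (ys @ [m])" "set (ys @ [m]) \<subseteq> {a..m}"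
    using xs eq ys assms by (auto simp: sorted_append)
  have sz: "sorted (m # zs)" "set (m # zs) \<subseteq> {m..b}"
    using xs eq zs assms by (auto simp: sorted_append)
  have un: "\<And>t. t \<in> set (ys @ [m]) \<Longrightarrow> norm (c t) = 1" "\<And>t. t \<in> set (m # zs) \<Longrightarrow> norm (c t) = 1"
  proof -
    have "{a..m} \<subseteq> {a..b}" "{m..b} \<subseteq> {a..b}" using assms by auto
    then show "\<And>t. t \<in> set (ys @ [m]) \<Longrightarrow> norm (c t) = 1" "\<And>t. t \<in> set (m # zs) \<Longrightarrow> norm (c t) = 1"
      using sy(2) sz(2) u by blast+
  qed
  have "poly_len c xs \<le> poly_len c (ys @ [m]) + poly_len c (m # zs)"
    unfolding eq using un by (intro poly_len_append_le) auto
  then have "ennreal (poly_len c xs) \<le> ennreal (poly_len c (ys @ [m]) + poly_len c (m # zs))"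
    by (rule ennreal_leI)
  also have "\<dots> = ennreal (poly_len c (ys @ [m])) + ennreal (poly_len c (m # zs))"
    by (intro ennreal_plus poly_len_nonneg un)
  also have "\<dots> \<le> curve_length c a m + curve_length c m b"
    using sy sz by (intro add_mono curve_length_upper)
  finally show "ennreal (poly_len c xs) \<le> curve_length c a m + curve_length c m b" .
qed

lemma curve_length_joinpaths:
  assumes "pathfinish g1 = pathstart g2" and u1: "\<And>t. t \<in> {0..1} \<Longrightarrow> norm (g1 t) = 1"
    and u2: "\<And>t. t \<in> {0..1} \<Longrightarrow> norm (g2 t) = 1"
  shows "curve_length (g1 +++ g2) 0 1 \<le> curve_length g1 0 1 + curve_length g2 0 1"
proof -
  have "curve_length (g1 +++ g2) 0 1
      \<le> curve_length (g1 +++ g2) 0 (1/2) + curve_length (g1 +++ g2) (1/2) 1"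
    by (rule curve_length_subadd) (auto simp: joinpaths_def u1 u2)
  also have "curve_length (g1 +++ g2) 0 (1/2) \<le> curve_length g1 0 1"
    by (rule curve_length_reparam[of _ _ "\<lambda>t. 2 * t"]) (auto simp: joinpaths_def mono_on_def)
  also have "curve_length (g1 +++ g2) (1/2) 1 \<le> curve_length g2 0 1"
  proof (rule curve_length_reparam[of _ _ "\<lambda>t. 2 * t - 1"])
    fix t :: real assume "t \<in> {1/2..1}"
    show "(g1 +++ g2) t = g2 (2 * t - 1)"
    proof (cases "t = 1/2")
      case True
      show ?thesis unfolding True using assms(1) by (simp add: joinpaths_def pathfinish_def pathstart_def)
    next
      case False
      then show ?thesis using \<open>t \<in> {1/2..1}\<close> by (simp add: joinpaths_def)
    qed
  qed (auto simp: mono_on_def)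
  finally show ?thesis by (simp add: add_mono)
qed

lemma intrinsic_dist_le:
  "path g \<Longrightarrow> path_image g \<subseteq> S \<Longrightarrow> pathstart g = x \<Longrightarrow> pathfinish g = y \<Longrightarrow>
     intrinsic_dist S x y \<le> curve_length g 0 1"
  unfolding intrinsic_dist_def by (rule INF_lower) auto

lemma intrinsic_dist_greatest:
  "(\<And>g. path g \<Longrightarrow> path_image g \<subseteq> S \<Longrightarrow> pathstart g = x \<Longrightarrow> pathfinish g = y \<Longrightarrow>
     L \<le> curve_length g 0 1) \<Longrightarrow> L \<le> intrinsic_dist S x y"
  unfolding intrinsic_dist_def by (rule INF_greatest) auto

lemma intrinsic_dist_obtain:
  assumes "intrinsic_dist S x y < L"
  obtains g where "path g" "path_image g \<subseteq> S" "pathstart g = x" "pathfinish g = y" "curve_length g 0 1 < L"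
  using assms unfolding intrinsic_dist_def INF_less_iff by auto

lemma intrinsic_dist_triangle:
  assumes "S \<subseteq> sphere 0 1"
  shows "intrinsic_dist S x z \<le> intrinsic_dist S x y + intrinsic_dist S y z"
proof (rule ennreal_le_epsilon)
  fix e :: real assume fin: "intrinsic_dist S x y + intrinsic_dist S y z < top" and e: "0 < e"
  have f: "intrinsic_dist S x y < top" "intrinsic_dist S y z < top"
    using fin by (auto simp: less_top[symmetric])
  have "intrinsic_dist S x y < intrinsic_dist S x y + ennreal (e/2)"
    using f e ennreal_add_left_cancel_less[of _ 0 "ennreal (e/2)"] by (auto simp: less_top[symmetric])
  then obtain g1 where g1: "path g1" "path_image g1 \<subseteq> S" "pathstart g1 = x" "pathfinish g1 = y"
    "curve_length g1 0 1 < intrinsic_dist S x y + ennreal (e/2)"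
    by (rule intrinsic_dist_obtain)
  have "intrinsic_dist S y z < intrinsic_dist S y z + ennreal (e/2)"
    using f e ennreal_add_left_cancel_less[of _ 0 "ennreal (e/2)"] by (auto simp: less_top[symmetric])
  then obtain g2 where g2: "path g2" "path_image g2 \<subseteq> S" "pathstart g2 = y" "pathfinish g2 = z"
    "curve_length g2 0 1 < intrinsic_dist S y z + ennreal (e/2)"
    by (rule intrinsic_dist_obtain)
  have u: "norm (g1 t) = 1" "norm (g2 t) = 1" if "t \<in> {0..1}" for t
    using g1(2) g2(2) assms that by (auto simp: path_image_def subset_iff)
  have "intrinsic_dist S x z \<le> curve_length (g1 +++ g2) 0 1"
    using g1 g2 by (intro intrinsic_dist_le) (auto simp: path_image_join)
  also have "\<dots> \<le> curve_length g1 0 1 + curve_length g2 0 1"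
    using g1 g2 u by (intro curve_length_joinpaths) auto
  also have "\<dots> \<le> (intrinsic_dist S x y + ennreal (e/2)) + (intrinsic_dist S y z + ennreal (e/2))"
    using g1 g2 by (intro add_mono) auto
  also have "\<dots> = intrinsic_dist S x y + intrinsic_dist S y z + (ennreal (e/2) + ennreal (e/2))"
    by (simp add: ac_simps)
  also have "ennreal (e/2) + ennreal (e/2) = ennreal e"
    using e by (subst ennreal_plus[symmetric]) auto
  finally show "intrinsic_dist S x z \<le> intrinsic_dist S x y + intrinsic_dist S y z + ennreal e" .
qed

lemma curve_length_ge_through:
  assumes "0 \<le> t" "t \<le> 1" and u: "\<And>t. t \<in> {0..1} \<Longrightarrow> norm (g t) = 1"
  shows "ennreal (sdist (g 0) (g t) + sdist (g t) (g 1)) \<le> curve_length g 0 1"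
  using curve_length_upper[of "[0, t, 1]" 0 1 g] assms by simp

lemma intrinsic_dist_ge:
  assumes "S \<subseteq> sphere 0 1"
  shows "ennreal (sdist x y) \<le> intrinsic_dist S x y"
proof (rule intrinsic_dist_greatest)
  fix g assume "path g" "path_image g \<subseteq> S" "pathstart g = x" "pathfinish g = y"
  then show "ennreal (sdist x y) \<le> curve_length g 0 1"
    using curve_length_upper[of "[0, 1]" 0 1 g] by (simp add: pathstart_def pathfinish_def)
qed

lemma intrinsic_dist_le_curve:
  assumes "u \<le> v" "continuous_on {u..v} c" "c ` {u..v} \<subseteq> S"
  shows "intrinsic_dist S (c u) (c v) \<le> curve_length c u v"
proof -
  define \<phi> where "\<phi> t = u + t * (v - u)" for t :: real
  have \<phi>: "\<phi> ` {0..1} \<subseteq> {u..v}"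
  proof
    fix x assume "x \<in> \<phi> ` {0..1}"
    then obtain t where t: "0 \<le> t" "t \<le> 1" "x = u + t * (v - u)" by (auto simp: \<phi>_def)
    have "t * (v - u) \<le> 1 * (v - u)" using t assms by (intro mult_right_mono) auto
    then show "x \<in> {u..v}" using t assms by auto
  qed
  have "intrinsic_dist S (c u) (c v) \<le> curve_length (c \<circ> \<phi>) 0 1"
  proof (rule intrinsic_dist_le)
    have "continuous_on {0..1} \<phi>" unfolding \<phi>_def by (intro continuous_intros)
    then show "path (c \<circ> \<phi>)" unfolding path_def
      using assms(2) \<phi> continuous_on_compose continuous_on_subset by blast
    show "path_image (c \<circ> \<phi>) \<subseteq> S" using assms(3) \<phi> by (auto simp: path_image_def)
  qed (auto simp: pathstart_def pathfinish_def \<phi>_def)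
  also have "\<dots> \<le> curve_length c u v"
    using \<phi> assms(1) by (intro curve_length_reparam[of _ _ \<phi>]) (auto simp: mono_on_def \<phi>_def mult_right_mono)
  finally show ?thesis .
qed

text \<open>The one consequence of being shortest that the later sections use. The total length is
  the distance of the end points, which the triangle inequality through u and v bounds; the outer
  pieces then cancel.\<close>

lemma shortest_on_between:
  assumes sh: "shortest_on S c a b" and S: "S \<subseteq> sphere 0 1"
    and c: "continuous_on {a..b} c" "c ` {a..b} \<subseteq> S"
    and le: "a \<le> u" "u \<le> w" "w \<le> v" "v \<le> b"
  shows "intrinsic_dist S (c u) (c w) + intrinsic_dist S (c w) (c v) \<le> intrinsic_dist S (c u) (c v)"
proof -
  have un: "norm (c t) = 1" if "t \<in> {a..b}" for t
  proof -
    have "c t \<in> sphere 0 1" using that c(2) S by blast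
    then show ?thesis by simp
  qed
  let ?d = "intrinsic_dist S" and ?l = "curve_length c"
  have fin: "?l a b < \<infinity>" and eq: "?l a b = ?d (c a) (c b)" using sh by (auto simp: shortest_on_def)
  have sub: "?d (c s) (c t) \<le> ?l s t" if "a \<le> s" "s \<le> t" "t \<le> b" for s t
    using that c by (intro intrinsic_dist_le_curve) (auto intro: continuous_on_subset)
  have sup: "?l s t + ?l t r \<le> ?l s r" if "a \<le> s" "s \<le> t" "t \<le> r" "r \<le> b" for s t r
    using that un by (intro curve_length_superadd) auto
  have "?l a u + (?l u w + ?l w v) + ?l v b \<le> ?l a u + ?l u v + ?l v b"
    using le by (intro add_mono sup) auto
  also have "\<dots> \<le> ?l a v + ?l v b" using le by (intro add_mono sup) auto
  also have "\<dots> \<le> ?l a b" using le by (intro sup) auto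
  also have "\<dots> \<le> ?d (c a) (c u) + ?d (c u) (c b)" unfolding eq by (rule intrinsic_dist_triangle[OF S])
  also have "\<dots> \<le> ?d (c a) (c u) + (?d (c u) (c v) + ?d (c v) (c b))"
    by (intro add_mono intrinsic_dist_triangle[OF S] order_refl)
  also have "\<dots> \<le> ?l a u + (?d (c u) (c v) + ?l v b)" using le by (intro add_mono sub) auto
  finally have main: "?l a u + (?l u w + ?l w v) + ?l v b \<le> ?l a u + (?d (c u) (c v) + ?l v b)" .
  have "?l a u + ?l u b \<le> ?l a b" "?l a v + ?l v b \<le> ?l a b" using le by (auto intro: sup)
  \<comment> \<open>Cancellation in \<open>ennreal\<close> needs finite terms; the finiteness clause
    of \<open>shortest_on\<close> supplies them.\<close>
  then have "?l a u \<noteq> top" "?l v b \<noteq> top" using fin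
    by (auto simp: top_unique)
  moreover have "?l a u + (?l v b + (?l u w + ?l w v)) \<le> ?l a u + (?l v b + ?d (c u) (c v))"
    using main by (simp add: ac_simps)
  ultimately have "?l u w + ?l w v \<le> ?d (c u) (c v)"
    unfolding ennreal_add_left_cancel_le by auto
  moreover have "?d (c u) (c w) + ?d (c w) (c v) \<le> ?l u w + ?l w v" using le by (intro add_mono sub) auto
  ultimately show ?thesis by simp
qed

lemma intrinsic_dist_le_sdist:
  assumes u: "norm x = 1" "norm z = 1" and ne: "x \<noteq> - z"
    and S: "\<And>\<alpha> \<beta>. \<alpha> \<ge> 0 \<Longrightarrow> \<beta> \<ge> 0 \<Longrightarrow> norm (\<alpha> *\<^sub>R x + \<beta> *\<^sub>R z) = 1 \<Longrightarrow> \<alpha> *\<^sub>R x + \<beta> *\<^sub>R z \<in> S"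
  shows "intrinsic_dist S x z \<le> ennreal (sdist x z)"
proof (cases "x = z")
  case True
  have "poly_len (\<lambda>t. x) xs = 0" for xs
    by (induction xs rule: induct_list012) (auto simp: u)
  then have "curve_length (\<lambda>t. x) 0 1 \<le> 0" by (intro curve_length_least) auto
  moreover have "x \<in> S" using S[of 1 0] u by simp
  then have "intrinsic_dist S x x \<le> curve_length (\<lambda>t. x) 0 1"
    by (intro intrinsic_dist_le) (auto simp: path_def path_image_def pathstart_def pathfinish_def)
  ultimately show ?thesis using True by (auto simp: u)
next
  case False
  obtain e where e: "norm e = 1" "x \<bullet> e = 0" "0 < sdist x z" "sdist x z < pi"
    and z: "z = cos (sdist x z) *\<^sub>R x + sin (sdist x z) *\<^sub>R e"
    by (rule unit_polar[OF u False ne])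
  define \<gamma> where "\<gamma> = sdist x z"
  have \<gamma>: "0 < \<gamma>" "\<gamma> < pi" "sin \<gamma> > 0" using e by (auto simp: \<gamma>_def sin_gt_zero)
  have z': "z = cos \<gamma> *\<^sub>R x + sin \<gamma> *\<^sub>R e" using z by (simp add: \<gamma>_def)
  define c where "c t = cos (t * \<gamma>) *\<^sub>R x + sin (t * \<gamma>) *\<^sub>R e" for t
  have inS: "c t \<in> S" if "0 \<le> t" "t \<le> 1" for t
  proof -
    have "t * \<gamma> \<le> 1 * \<gamma>" using that \<gamma> by (intro mult_right_mono) auto
    then have t: "0 \<le> t * \<gamma>" "t * \<gamma> \<le> \<gamma>" using that \<gamma> by auto
    have "t * \<gamma> \<le> pi" "\<gamma> - t * \<gamma> \<le> pi" using t \<gamma> by linarith+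
    then have "sin (\<gamma> - t * \<gamma>) \<ge> 0" "sin (t * \<gamma>) \<ge> 0" using t by (auto intro: sin_ge_zero)
    have sc: "sin (t * \<gamma>) = sin (t * \<gamma>) / sin \<gamma> * sin \<gamma>"
      "cos (t * \<gamma>) = sin (\<gamma> - t * \<gamma>) / sin \<gamma> + sin (t * \<gamma>) / sin \<gamma> * cos \<gamma>"
      using \<gamma> by (simp_all add: sin_diff field_simps)
    have eq: "c t = (sin (\<gamma> - t * \<gamma>) / sin \<gamma>) *\<^sub>R x + (sin (t * \<gamma>) / sin \<gamma>) *\<^sub>R z"
      unfolding c_def z' scaleR_add_right scaleR_scaleR sc(1)[symmetric]
      by (subst sc(2)) (simp add: scaleR_left_distrib)
    have "norm (c t) = 1" unfolding c_def by (rule norm_circle[OF u(1) e(1,2)])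
    then show ?thesis unfolding eq
      using \<open>sin (\<gamma> - t * \<gamma>) \<ge> 0\<close> \<open>sin (t * \<gamma>) \<ge> 0\<close> \<gamma>
      by (intro S) auto
  qed
  have d: "sdist (c s) (c t) = (t - s) * \<gamma>" if "0 \<le> s" "s \<le> t" "t \<le> 1" for s t
  proof -
    have "(t - s) * \<gamma> \<le> 1 * \<gamma>" using that \<gamma> by (intro mult_right_mono) auto
    moreover have "0 \<le> (t - s) * \<gamma>" using that \<gamma> by simp
    ultimately have "\<bar>s * \<gamma> - t * \<gamma>\<bar> = (t - s) * \<gamma>" "(t - s) * \<gamma> \<le> pi"
      using \<gamma> by (auto simp: algebra_simps)
    then show ?thesis unfolding c_def using sdist_circle[OF u(1) e(1,2), of "s * \<gamma>" "t * \<gamma>"] by simp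
  qed
  have pl: "poly_len c (s # xs) = (last (s # xs) - s) * \<gamma>"
    if "sorted (s # xs)" "set (s # xs) \<subseteq> {0..1}" for s xs
    using that
  proof (induction xs arbitrary: s)
    case (Cons t xs)
    then have "poly_len c (t # xs) = (last (t # xs) - t) * \<gamma>" by auto
    moreover have "sdist (c s) (c t) = (t - s) * \<gamma>" using Cons.prems by (intro d) auto
    ultimately show ?case by (auto simp: algebra_simps)
  qed auto
  have "intrinsic_dist S x z \<le> curve_length c 0 1"
  proof (rule intrinsic_dist_le)
    show "path c" unfolding path_def c_def by (intro continuous_intros)
    show "path_image c \<subseteq> S" using inS by (auto simp: path_image_def)
    show "pathstart c = x" "pathfinish c = z" using z' by (auto simp: pathstart_def pathfinish_def c_def)
  qed
  also have "\<dots> \<le> ennreal \<gamma>"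
  proof (rule curve_length_least)
    fix xs :: "real list" assume xs: "sorted xs" "set xs \<subseteq> {0..1}"
    have "poly_len c xs \<le> \<gamma>"
    proof (cases xs)
      case Nil
      then show ?thesis using \<gamma> by simp
    next
      case (Cons s ys)
      have "last (s # ys) \<in> {0..1}" using xs(2) Cons last_in_set[of "s # ys"] by blast
      then have "(last (s # ys) - s) * \<gamma> \<le> 1 * \<gamma>" using xs Cons \<gamma> by (intro mult_right_mono) auto
      then show ?thesis using pl[of s ys] xs Cons by simp
    qed
    then show "ennreal (poly_len c xs) \<le> ennreal \<gamma>" by (rule ennreal_leI)
  qed
  finally show ?thesis by (simp add: \<gamma>_def)
qed

section \<open>Regular tetrahedra and the development of two faces\<close>

text \<open>Here \<open>c\<close> is the cosine of the edge length. As the face angle has cosine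
  \<open>c / (1 + c)\<close>, its range from pi/3 to 2*pi/3 corresponds to c between 1 and -1/3. The
  lower bound also makes the Gram matrix of the vertices invertible.\<close>

locale reg_tetra =
  fixes V :: "(real ^ 4) set" and c :: real
  assumes card_V: "card V = 4" and ind_V: "independent V"
    and unit_V: "p \<in> V \<Longrightarrow> p \<bullet> p = 1"
    and inner_V: "p \<in> V \<Longrightarrow> q \<in> V \<Longrightarrow> p \<noteq> q \<Longrightarrow> p \<bullet> q = c"
    and c_less: "c < 1" and c_gr: "- 1 / 3 < c"
begin

text \<open>Within the span of \<open>p\<close>, \<open>q\<close>, \<open>r\<close>, the mirror image of \<open>r\<close> in the plane of the edge \<open>pq\<close> is
  \<open>k *\<^sub>R (p + q) - r\<close>.\<close>

definition k :: real where "k = 2 * c / (1 + c)"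

lemma k_bounds: "- 1 < k" "k < 1" and k_c: "k * (1 + c) = 2 * c" "c * (2 - k) = k"
proof -
  have "0 < 1 + c" using c_gr by simp
  then show "- 1 < k" "k < 1" "k * (1 + c) = 2 * c" "c * (2 - k) = k"
    using c_gr c_less by (auto simp: k_def field_simps)
qed

text \<open>The coordinate at \<open>p\<close> with respect to the basis \<open>V\<close>, read off from the inverse of the Gram matrix.\<close>

definition coord :: "real ^ 4 \<Rightarrow> real ^ 4 \<Rightarrow> real" where
  "coord p x = (x \<bullet> p - (c / (1 + 3 * c)) * (\<Sum>q\<in>V. x \<bullet> q)) / (1 - c)"

definition labelling :: "real ^ 4 \<Rightarrow> real ^ 4 \<Rightarrow> real ^ 4 \<Rightarrow> real ^ 4 \<Rightarrow> bool" where
  "labelling p q r s \<longleftrightarrow> V = {p, q, r, s} \<and> distinct [p, q, r, s]"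

lemma labelling_perm:
  assumes "labelling p q r s"
  shows "labelling q p r s" "labelling p r q s" "labelling p q s r" "labelling r q p s" "labelling s q r p" "labelling p s r q"
    "labelling q r p s" "labelling r p q s" "labelling s q p r" "labelling p s q r" "labelling q p s r" "labelling r s p q" "labelling p r s q"
    "labelling q s p r" "labelling s p q r" "labelling q r s p" "labelling r q s p" "labelling s r q p" "labelling r s q p" "labelling q s r p" "labelling s p r q"
    "labelling r p s q" "labelling s r p q"
  using assms unfolding labelling_def by auto

lemma labelling_in: assumes "labelling p q r s" shows "p \<in> V" "q \<in> V" "r \<in> V" "s \<in> V"
  using assms by (auto simp: labelling_def)

lemma labelling_neq: assumes "labelling p q r s"
  shows "p \<noteq> q" "p \<noteq> r" "p \<noteq> s" "q \<noteq> r" "q \<noteq> s" "r \<noteq> s"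
  using assms by (auto simp: labelling_def)

lemma finite_V: "finite V"
  using card_V card.infinite by fastforce

lemma labelling_ex:
  assumes "p \<in> V" "q \<in> V" "p \<noteq> q"
  obtains r s where "labelling p q r s"
proof -
  have "card (V - {p} - {q}) = 2" using assms card_V finite_V by simp
  then obtain r s where rs: "V - {p} - {q} = {r, s}" "r \<noteq> s" unfolding card_2_iff by blast
  have V: "V = {p, q, r, s}" using assms rs by blast
  have "distinct [p, q, r, s]" using rs assms(3) by auto
  then show ?thesis using V that unfolding labelling_def by blast
qed

lemma labelling_inner:
  assumes "labelling p q r s"
  shows "p \<bullet> p = 1" "q \<bullet> q = 1" "r \<bullet> r = 1" "s \<bullet> s = 1"
    "p \<bullet> q = c" "p \<bullet> r = c" "p \<bullet> s = c" "q \<bullet> r = c" "q \<bullet> s = c" "r \<bullet> s = c"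
    "q \<bullet> p = c" "r \<bullet> p = c" "s \<bullet> p = c" "r \<bullet> q = c" "s \<bullet> q = c" "s \<bullet> r = c"
  using labelling_in[OF assms] labelling_neq[OF assms] unit_V inner_V by metis+

lemma linear_coord: "linear (coord p)"
  unfolding coord_def
  by (rule linearI) (simp_all add: inner_add_left sum.distrib sum_distrib_left[symmetric] add_divide_distrib algebra_simps diff_divide_distrib)

lemma coord_add: "coord p (x + y) = coord p x + coord p y" and coord_scale: "coord p (a *\<^sub>R x) = a * coord p x"
  and coord_diff: "coord p (x - y) = coord p x - coord p y"
  using linear_coord[of p] linear_add linear_cmul linear_diff by (auto simp: linear_cmul)

lemma coord_V: assumes "p \<in> V" "q \<in> V" shows "coord p q = (if p = q then 1 else 0)"
proof -
  have s: "(\<Sum>r\<in>V. q \<bullet> r) = 1 + 3 * c"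
  proof -
    have "(\<Sum>r\<in>V. q \<bullet> r) = q \<bullet> q + (\<Sum>r\<in>V - {q}. q \<bullet> r)"
      using assms finite_V by (intro sum.remove) auto
    also have "(\<Sum>r\<in>V - {q}. q \<bullet> r) = (\<Sum>r\<in>V - {q}. c)"
      using assms inner_V by (intro sum.cong) auto
    also have "\<dots> = 3 * c" using assms card_V finite_V by simp
    finally show ?thesis using unit_V assms by simp
  qed
  have "1 + 3 * c > 0" "1 - c > 0" using c_gr c_less by simp_all
  then show ?thesis using assms unit_V inner_V[of q p] unfolding coord_def s by auto
qed

lemma labelling_coord:
  assumes "labelling p q r s"
  shows "coord p p = 1" "coord p q = 0" "coord p r = 0" "coord p s = 0"
    "coord q p = 0" "coord q q = 1" "coord q r = 0" "coord q s = 0"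
    "coord r p = 0" "coord r q = 0" "coord r r = 1" "coord r s = 0"
    "coord s p = 0" "coord s q = 0" "coord s r = 0" "coord s s = 1"
  using labelling_in[OF assms] labelling_neq[OF assms] coord_V by simp_all

lemma labelling_expand:
  assumes "labelling p q r s"
  shows "x = coord p x *\<^sub>R p + coord q x *\<^sub>R q + coord r x *\<^sub>R r + coord s x *\<^sub>R s"
proof -
  let ?h = "\<lambda>x. coord p x *\<^sub>R p + coord q x *\<^sub>R q + coord r x *\<^sub>R r + coord s x *\<^sub>R s"
  have l: "linear ?h"
    by (rule linearI) (simp_all add: coord_add coord_scale algebra_simps)
  have "span V = UNIV"
  proof -
    have "dim V = 4" using card_V ind_V by (simp add: dim_eq_card_independent)
    then show ?thesis using dim_eq_full[of V] by simp
  qed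
  then have x: "x \<in> span V" by simp
  have "?h x = id x"
  proof (rule linear_eq_on[OF l _ x])
    show "linear id" by (simp add: linear_id)
    fix b assume "b \<in> V"
    then show "?h b = id b" using assms labelling_coord[OF assms] unfolding labelling_def by auto
  qed
  then show ?thesis by simp
qed

lemma coord_eq_imp_eq:
  assumes "labelling p q r s" "coord p x = coord p y" "coord q x = coord q y" "coord r x = coord r y" "coord s x = coord s y"
  shows "x = y"
  using labelling_expand[OF assms(1), of x] labelling_expand[OF assms(1), of y] assms by simp

lemma continuous_on_coord [continuous_intros]: "continuous_on A f \<Longrightarrow> continuous_on A (\<lambda>x. coord p (f x))"
  unfolding coord_def by (intro continuous_intros) (use c_less in auto)

abbreviation S where "S \<equiv> tetrahedron_surface V"

lemma face_iff:
  assumes l: "labelling p q r s"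
  shows "x \<in> sph_hull (V - {s}) \<longleftrightarrow> norm x = 1 \<and> coord p x \<ge> 0 \<and> coord q x \<ge> 0 \<and> coord r x \<ge> 0 \<and> coord s x = 0"
proof -
  let ?C = "{x. coord p x \<ge> 0 \<and> coord q x \<ge> 0 \<and> coord r x \<ge> 0 \<and> coord s x = 0}"
  have V: "V - {s} = {p, q, r}" using l by (auto simp: labelling_def)
  have "convex_cone hull {p, q, r} = ?C"
  proof
    have "convex_cone ?C"
      by (auto simp: convex_cone_def conic_def convex_def coord_add coord_scale linear_0[OF linear_coord] intro!: add_nonneg_nonneg exI[of _ 0])
    moreover have "{p, q, r} \<subseteq> ?C" using labelling_coord[OF l] by auto
    ultimately show "convex_cone hull {p, q, r} \<subseteq> ?C" by (simp add: hull_minimal)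
    show "?C \<subseteq> convex_cone hull {p, q, r}"
    proof
      fix x assume x: "x \<in> ?C"
      have "coord p x *\<^sub>R p + coord q x *\<^sub>R q + coord r x *\<^sub>R r \<in> convex_cone hull {p, q, r}"
        using x by (intro convex_cone_hull_add convex_cone_hull_mul hull_inc) auto
      then show "x \<in> convex_cone hull {p, q, r}" using labelling_expand[OF l, of x] x by simp
    qed
  qed
  then show ?thesis unfolding sph_hull_def V by auto
qed

lemma S_iff:
  "x \<in> S \<longleftrightarrow> norm x = 1 \<and> (\<forall>p\<in>V. coord p x \<ge> 0) \<and> (\<exists>p\<in>V. coord p x = 0)"
proof -
  have "x \<in> sph_hull (V - {p}) \<longleftrightarrow> norm x = 1 \<and> (\<forall>q\<in>V. coord q x \<ge> 0) \<and> coord p x = 0" if pV: "p \<in> V" for p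
  proof -
    have "card (V - {p}) = 3" using pV card_V finite_V by simp
    then obtain q where q: "q \<in> V" "q \<noteq> p" by (metis Diff_iff card.empty ex_in_conv insertI1 numeral_eq_Suc old.nat.distinct(1))
    obtain r s where l: "labelling p q r s" using labelling_ex[OF pV q(1)] q(2) by metis
    show ?thesis using face_iff[OF labelling_perm(16)[OF l], of x] l by (auto simp: labelling_def)
  qed
  then show ?thesis unfolding tetrahedron_surface_def by auto
qed

lemma S_labelling:
  assumes "labelling p q r s"
  shows "x \<in> S \<longleftrightarrow> norm x = 1 \<and> coord p x \<ge> 0 \<and> coord q x \<ge> 0 \<and> coord r x \<ge> 0 \<and> coord s x \<ge> 0 \<and>
    (coord p x = 0 \<or> coord q x = 0 \<or> coord r x = 0 \<or> coord s x = 0)"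
  using assms unfolding S_iff labelling_def by auto

lemma S_sphere: "S \<subseteq> sphere 0 1"
  by (auto simp: S_iff)

text \<open>The development of the face \<open>pqs\<close> into the plane of the adjacent face \<open>pqr\<close>; it is linear on
  the whole space, and it is the identity on the face \<open>pqr\<close>.\<close>

definition dev :: "real ^ 4 \<Rightarrow> real ^ 4 \<Rightarrow> real ^ 4 \<Rightarrow> real ^ 4 \<Rightarrow> real ^ 4 \<Rightarrow> real ^ 4" where
  "dev p q r s x = coord p x *\<^sub>R p + coord q x *\<^sub>R q + coord r x *\<^sub>R r + coord s x *\<^sub>R (k *\<^sub>R (p + q) - r)"

lemma dev_scale: "dev p q r s (a *\<^sub>R x) = a *\<^sub>R dev p q r s x"
  by (simp add: dev_def coord_scale algebra_simps)

lemma continuous_on_dev [continuous_intros]: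
  "continuous_on A f \<Longrightarrow> continuous_on A (\<lambda>x. dev p q r s (f x))"
  unfolding dev_def by (intro continuous_intros)

lemma dev_face: assumes "labelling p q r s" "coord s x = 0" shows "dev p q r s x = x"
  using labelling_expand[OF assms(1), of x] assms(2) by (simp add: dev_def)

lemma labelling_reflect:
  assumes "labelling p q r s"
  defines "t \<equiv> k *\<^sub>R (p + q) - r"
  shows "p \<bullet> t = c" "q \<bullet> t = c" "t \<bullet> p = c" "t \<bullet> q = c" "t \<bullet> t = 1"
proof -
  note i = labelling_inner[OF assms(1)]
  show 1: "p \<bullet> t = c" "q \<bullet> t = c" using i k_c unfolding t_def by (simp_all add: inner_simps algebra_simps)
  then show 2: "t \<bullet> p = c" "t \<bullet> q = c" by (simp_all add: inner_commute)
  have "t \<bullet> t = k * (2 * c) - r \<bullet> t"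
    unfolding t_def[of, THEN meta_eq_to_obj_eq, THEN arg_cong[where f = "\<lambda>z. z \<bullet> t"]]
    using 1 by (simp add: inner_simps)
  also have "r \<bullet> t = k * (2 * c) - 1" using i unfolding t_def by (simp add: inner_simps)
  finally show "t \<bullet> t = 1" by simp
qed

text \<open>The image \<open>k *\<^sub>R (p + q) - r\<close> of s has the same inner products with
  p, q and itself as s. So inner products are kept on each of the two faces, but not between points
  of different faces.\<close>

lemma dev_inner:
  assumes l: "labelling p q r s" and z: "(coord s x = 0 \<and> coord s y = 0) \<or> (coord r x = 0 \<and> coord r y = 0)"
  shows "dev p q r s x \<bullet> dev p q r s y = x \<bullet> y"
proof (cases "coord s x = 0 \<and> coord s y = 0")
  case True
  then show ?thesis using dev_face[OF l] by simp
next
  case False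
  then have r: "coord r x = 0" "coord r y = 0" using z by auto
  define t where "t = k *\<^sub>R (p + q) - r"
  note i = labelling_inner[OF l] and j = labelling_reflect[OF l, folded t_def]
  have e: "x \<bullet> y = (coord p x *\<^sub>R p + coord q x *\<^sub>R q + coord s x *\<^sub>R s) \<bullet> (coord p y *\<^sub>R p + coord q y *\<^sub>R q + coord s y *\<^sub>R s)"
    using labelling_expand[OF l, of x] labelling_expand[OF l, of y] r by simp
  show ?thesis unfolding e
    by (simp add: dev_def r t_def[symmetric] inner_add_left inner_add_right i j)
qed

lemma dev_norm:
  assumes "labelling p q r s" "x \<in> S" "coord s x = 0 \<or> coord r x = 0"
  shows "norm (dev p q r s x) = 1"
  using dev_inner[OF assms(1), of x x] assms by (auto simp: S_iff norm_eq_1)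

lemma dev_sdist:
  assumes "labelling p q r s" "(coord s x = 0 \<and> coord s y = 0) \<or> (coord r x = 0 \<and> coord r y = 0)"
  shows "sdist (dev p q r s x) (dev p q r s y) = sdist x y"
  using dev_inner[OF assms] by (simp add: sdist_def)

lemma face_not_antipodal:
  assumes "x \<in> S" "y \<in> S" shows "x \<noteq> - y"
proof
  assume "x = - y"
  have "card V \<noteq> 0" using card_V by simp
  have "coord p y = 0" if "p \<in> V" for p
    using assms that \<open>x = - y\<close> coord_scale[of p "-1" y] unfolding S_iff by (smt (verit) scaleR_minus1_left)
  then have "x = 0" "y = 0" if "labelling p q r s" for p q r s
    using labelling_expand[OF that, of y] labelling_in[OF that] \<open>x = - y\<close> by auto
  moreover obtain p q where "p \<in> V" "q \<in> V" "p \<noteq> q"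
    using card_V by (metis card_le_Suc0_iff_eq finite_V numeral_le_one_iff One_nat_def semiring_norm(69) semiring_norm(83) order.trans one_le_numeral)
  ultimately show False using labelling_ex assms by (metis S_iff norm_zero zero_neq_one)
qed

lemma intrinsic_dist_face:
  assumes l: "p \<in> V" and x: "x \<in> S" "y \<in> S" "coord p x = 0" "coord p y = 0"
  shows "intrinsic_dist S x y \<le> ennreal (sdist x y)"
proof (rule intrinsic_dist_le_sdist)
  show "norm x = 1" "norm y = 1" "x \<noteq> - y" using x face_not_antipodal by (auto simp: S_iff)
  fix \<alpha> \<beta> :: real assume "\<alpha> \<ge> 0" "\<beta> \<ge> 0" "norm (\<alpha> *\<^sub>R x + \<beta> *\<^sub>R y) = 1"
  then show "\<alpha> *\<^sub>R x + \<beta> *\<^sub>R y \<in> S"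
    using x l unfolding S_iff by (auto simp: coord_add coord_scale intro!: bexI[of _ p])
qed

end

section \<open>Intrinsic distance near an edge\<close>

lemma convex_comb_pos:
  fixes a b t :: real
  assumes "0 \<le> t" "t \<le> 1" "0 < a" "0 < b"
  shows "0 < (1 - t) * a + t * b"
proof (cases "t = 0")
  case False
  then have "0 < t * b" "0 \<le> (1 - t) * a" using assms by auto
  then show ?thesis by linarith
qed (use assms in simp)

context reg_tetra
begin

lemma dev_coord:
  assumes "labelling p q r s"
  shows "coord p (dev p q r s y) = coord p y + k * coord s y" "coord q (dev p q r s y) = coord q y + k * coord s y"
    "coord r (dev p q r s y) = coord r y - coord s y" "coord s (dev p q r s y) = 0"
  using labelling_coord[OF assms] by (simp_all add: dev_def coord_add coord_scale coord_diff algebra_simps)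

text \<open>The arc between the developed points meets the plane of the edge where the coordinates
  at r cancel, which determines the weight t. Positivity of the coordinates at p and q, for both
  developed points, puts this crossing inside the edge.\<close>

lemma dev_crossing:
  assumes l: "labelling p q r s" and x: "x \<in> S" "coord s x = 0" "coord p x > 0" "coord q x > 0"
    and y: "y \<in> S" "coord r y = 0" "coord p y + k * coord s y > 0" "coord q y + k * coord s y > 0"
    and ne: "dev p q r s x \<noteq> - dev p q r s y"
  obtains w where "w \<in> S" "coord r w = 0" "coord s w = 0"
    "sdist x w + sdist w y = sdist (dev p q r s x) (dev p q r s y)"
proof (cases "coord r x + coord s y = 0")
  case True
  have "coord r x \<ge> 0" "coord s y \<ge> 0" using x y S_labelling[OF l] by auto
  then have "coord r x = 0" "coord s y = 0" using True by auto
  then show ?thesis using that[of x] x y dev_sdist[OF l, of x y] by (auto simp: S_iff)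
next
  case False
  let ?D = "dev p q r s"
  have nn: "coord r x \<ge> 0" "coord s y \<ge> 0" using x y S_labelling[OF l] by auto
  define t where "t = coord r x / (coord r x + coord s y)"
  have t: "0 \<le> t" "t \<le> 1" "(1 - t) * coord r x = t * coord s y"
    using nn False by (auto simp: t_def field_simps)
  define w0 where "w0 = (1 - t) *\<^sub>R ?D x + t *\<^sub>R ?D y"
  have pos: "coord p w0 > 0" "coord q w0 > 0"
    unfolding w0_def coord_add coord_scale dev_coord[OF l] x(2) using t x(3,4) y(3,4)
    by (simp_all add: convex_comb_pos)
  have zero: "coord r w0 = 0" "coord s w0 = 0"
    unfolding w0_def coord_add coord_scale dev_coord[OF l] x(2) y(2) using t(3) by simp_all
  define w where "w = (1 / norm w0) *\<^sub>R w0"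
  have "w0 \<noteq> 0" using pos linear_0[OF linear_coord] by force
  then have nw: "norm w0 > 0" by simp
  then have w: "norm w = 1" "coord p w \<ge> 0" "coord q w \<ge> 0" "coord r w = 0" "coord s w = 0"
    using pos zero by (auto simp: w_def coord_scale)
  then have wS: "w \<in> S" using S_labelling[OF l] by auto
  have "sdist (?D x) w + sdist w (?D y) = sdist (?D x) (?D y)"
  proof (rule sdist_cone_add[OF _ _ w(1) ne])
    show "norm (?D x) = 1" "norm (?D y) = 1" using x y dev_norm[OF l] by auto
    show "w = ((1 - t) / norm w0) *\<^sub>R ?D x + (t / norm w0) *\<^sub>R ?D y"
      unfolding w_def by (subst w0_def) (simp add: scaleR_add_right)
  qed (use t nw in auto)
  moreover have "sdist (?D x) w = sdist x w" "sdist w (?D y) = sdist w y"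
    using dev_sdist[OF l, of x w] dev_sdist[OF l, of w y] dev_face[OF l w(5)] w x y by auto
  ultimately show ?thesis using that[OF wS w(4,5)] by simp
qed

lemma intrinsic_dist_le_via:
  assumes "x \<in> S" "y \<in> S" "w \<in> S" "p \<in> V" "q \<in> V" "coord p x = 0" "coord p w = 0" "coord q w = 0" "coord q y = 0"
  shows "intrinsic_dist S x y \<le> ennreal (sdist x w + sdist w y)"
proof -
  have "norm x = 1" "norm y = 1" "norm w = 1" using assms by (auto simp: S_iff)
  have "intrinsic_dist S x y \<le> intrinsic_dist S x w + intrinsic_dist S w y"
    by (rule intrinsic_dist_triangle[OF S_sphere])
  also have "\<dots> \<le> ennreal (sdist x w) + ennreal (sdist w y)"
    using assms by (intro add_mono intrinsic_dist_face[of p] intrinsic_dist_face[of q])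
  also have "\<dots> = ennreal (sdist x w + sdist w y)"
    using \<open>norm x = 1\<close> \<open>norm y = 1\<close> \<open>norm w = 1\<close> by (intro ennreal_plus[symmetric] cos_sdist)
  finally show ?thesis .
qed

lemma intrinsic_dist_le_dev:
  assumes l: "labelling p q r s" and x: "x \<in> S" "coord p x > 0" "coord q x > 0" "coord p x + k * coord s x > 0" "coord q x + k * coord s x > 0"
    and y: "y \<in> S" "coord p y > 0" "coord q y > 0" "coord p y + k * coord s y > 0" "coord q y + k * coord s y > 0"
    and ne: "dev p q r s x \<noteq> - dev p q r s y"
  shows "intrinsic_dist S x y \<le> ennreal (sdist (dev p q r s x) (dev p q r s y))"
proof -
  have zx: "coord r x = 0 \<or> coord s x = 0" and zy: "coord r y = 0 \<or> coord s y = 0"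
    using x y S_labelling[OF l] by auto
  consider "coord s x = 0" "coord s y = 0" | "coord r x = 0" "coord r y = 0" | "coord s x = 0" "coord r y = 0" | "coord r x = 0" "coord s y = 0"
    using zx zy by blast
  then show ?thesis
  proof cases
    case 1
    then show ?thesis using intrinsic_dist_face[of s x y] x y dev_sdist[OF l] labelling_in[OF l] by auto
  next
    case 2
    then show ?thesis using intrinsic_dist_face[of r x y] x y dev_sdist[OF l] labelling_in[OF l] by auto
  next
    case 3
    obtain w where "w \<in> S" "coord r w = 0" "coord s w = 0"
      "sdist x w + sdist w y = sdist (dev p q r s x) (dev p q r s y)"
      by (rule dev_crossing[OF l x(1) 3(1) x(2,3) y(1) 3(2) y(4,5) ne])
    then show ?thesis using intrinsic_dist_le_via[of x y w s r] 3 x y labelling_in[OF l] by auto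
  next
    case 4
    have ne': "dev p q r s y \<noteq> - dev p q r s x" using ne by auto
    obtain w where "w \<in> S" "coord r w = 0" "coord s w = 0"
      "sdist y w + sdist w x = sdist (dev p q r s y) (dev p q r s x)"
      by (rule dev_crossing[OF l y(1) 4(2) y(2,3) x(1) 4(1) x(4,5) ne'])
    then show ?thesis using intrinsic_dist_le_via[of x y w r s] 4 x y labelling_in[OF l]
      by (auto simp: sdist_commute add.commute)
  qed
qed

text \<open>A path that stays in the two faces has a point lying in a common face with x and in a
  common face with y: an end point if x and y share a face, otherwise a point of the edge found by
  the intermediate value theorem. On both parts the development keeps distances.\<close>

lemma dev_le_path_length:
  assumes l: "labelling p q r s" and xy: "x \<in> S" "y \<in> S"
    and x: "coord r x = 0 \<or> coord s x = 0" and y: "coord r y = 0 \<or> coord s y = 0"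
    and g: "path g" "path_image g \<subseteq> S" "pathstart g = x" "pathfinish g = y"
    and z: "\<And>t. t \<in> {0..1} \<Longrightarrow> coord r (g t) = 0 \<or> coord s (g t) = 0"
  shows "ennreal (sdist (dev p q r s x) (dev p q r s y)) \<le> curve_length g 0 1"
proof -
  let ?D = "dev p q r s"
  have gS: "g t \<in> S" if "t \<in> {0..1}" for t using g(2) that by (auto simp: path_image_def)
  have g01: "g 0 = x" "g 1 = y" using g by (auto simp: pathstart_def pathfinish_def)
  have un: "norm (g t) = 1" if "t \<in> {0..1}" for t using gS[OF that] by (auto simp: S_iff)
  obtain t where t: "t \<in> {0..1}" "(coord s x = 0 \<and> coord s (g t) = 0) \<or> (coord r x = 0 \<and> coord r (g t) = 0)"
    "(coord s (g t) = 0 \<and> coord s y = 0) \<or> (coord r (g t) = 0 \<and> coord r y = 0)"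
  proof (cases "(coord s x = 0 \<and> coord s y = 0) \<or> (coord r x = 0 \<and> coord r y = 0)")
    case True
    then show ?thesis using that[of 0] g01 by auto
  next
    case False
    have pos: "coord r (g t) \<ge> 0" "coord s (g t) \<ge> 0" if "t \<in> {0..1}" for t
      using gS[OF that] S_labelling[OF l] by auto
    define f where "f t = coord r (g t) - coord s (g t)" for t
    have cf: "continuous_on {0..1} f" unfolding f_def using g(1) unfolding path_def by (intro continuous_intros)
    have "f 0 * f 1 \<le> 0" unfolding f_def g01 using False x y pos[of 0] pos[of 1] g01
      by (auto simp: mult_nonneg_nonpos mult_nonpos_nonneg)
    then have "(f 0 \<le> 0 \<and> 0 \<le> f 1) \<or> (f 1 \<le> 0 \<and> 0 \<le> f 0)" by (auto simp: mult_le_0_iff)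
    then obtain t where t: "t \<in> {0..1}" "f t = 0"
      using IVT'[of f 0 0 1] IVT2'[of f 1 0 0] cf by (metis atLeastAtMost_iff zero_le_one)
    then have "coord r (g t) = 0" "coord s (g t) = 0" using z[OF t(1)] by (auto simp: f_def)
    then show ?thesis using that[of t] t x y by auto
  qed
  have gt: "g t \<in> S" "coord r (g t) = 0 \<or> coord s (g t) = 0" using gS t(1) z by auto
  have "sdist (?D x) (?D y) \<le> sdist (?D x) (?D (g t)) + sdist (?D (g t)) (?D y)"
    using xy x y gt dev_norm[OF l] by (intro sdist_triangle) auto
  also have "\<dots> = sdist (g 0) (g t) + sdist (g t) (g 1)"
    using dev_sdist[OF l t(2)] dev_sdist[OF l t(3)] g01 by simp
  finally have "ennreal (sdist (?D x) (?D y)) \<le> ennreal (sdist (g 0) (g t) + sdist (g t) (g 1))"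
    by (rule ennreal_leI)
  also have "\<dots> \<le> curve_length g 0 1" using t(1) un by (intro curve_length_ge_through) auto
  finally show ?thesis .
qed

text \<open>The last two inequalities are the coordinates at p and q after development. With them
  the crossing of the edge stays between p and q even when k is negative.\<close>

definition nbhd :: "real ^ 4 \<Rightarrow> real ^ 4 \<Rightarrow> real ^ 4 \<Rightarrow> real ^ 4 \<Rightarrow> (real ^ 4) set" where
  "nbhd p q r s = {x. coord p x > 0 \<and> coord q x > 0 \<and> coord p x + k * coord s x > 0 \<and> coord q x + k * coord s x > 0}"

lemma open_nbhd: "open (nbhd p q r s)"
  unfolding nbhd_def
  by (intro open_Collect_conj open_Collect_less continuous_intros)

lemma nbhd_face:
  assumes "labelling p q r s" "x \<in> S" "x \<in> nbhd p q r s" shows "coord r x = 0 \<or> coord s x = 0"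
  using assms S_labelling[OF assms(1)] by (auto simp: nbhd_def)

text \<open>Two scales are involved: a ball of radius R in which the surface consists of the two
  faces, and a smaller one in which developed distances are below R. A path that leaves the large
  ball is longer than any such distance, and all other paths are handled by the development.\<close>

lemma dev_isometry_near:
  assumes l: "labelling p q r s" and z: "z \<in> S" "coord p z > 0" "coord q z > 0" "coord s z = 0"
  obtains \<delta> where "\<delta> > 0" "ball z \<delta> \<subseteq> nbhd p q r s"
    "\<forall>x y. x \<in> S \<longrightarrow> y \<in> S \<longrightarrow> x \<in> ball z \<delta> \<longrightarrow> y \<in> ball z \<delta> \<longrightarrow>
       intrinsic_dist S x y = ennreal (sdist (dev p q r s x) (dev p q r s y)) \<and>
       dev p q r s x \<noteq> - dev p q r s y"
proof -
  let ?D = "dev p q r s"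
  have "z \<in> nbhd p q r s" using z by (auto simp: nbhd_def)
  then obtain R where R: "R > 0" "ball z R \<subseteq> nbhd p q r s" using open_nbhd openE by blast
  define \<eta> where "\<eta> = min R 1"
  have \<eta>: "0 < \<eta>" "\<eta> \<le> R" "\<eta> \<le> 1" using R by (auto simp: \<eta>_def)
  have "pi > 1" using pi_gt3 by simp
  have ce: "2 - 2 * cos \<eta> > 0" using \<eta> cos_monotone_0_pi[of 0 \<eta>] \<open>pi > 1\<close> by simp
  \<comment> \<open>Half the chord of an arc of length \<eta>, so that developed points are at
    distance below \<eta>; the bound 1/2 excludes antipodal points.\<close>
  define \<epsilon> where "\<epsilon> = min (1/2) (sqrt (2 - 2 * cos \<eta>) / 2)"
  have \<epsilon>: "\<epsilon> > 0" using ce by (auto simp: \<epsilon>_def)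
  have "isCont ?D z" using continuous_on_dev[of UNIV "\<lambda>x. x"] by (simp add: continuous_on_eq_continuous_at)
  then obtain d where d: "d > 0" "\<And>x. dist x z < d \<Longrightarrow> dist (?D x) (?D z) < \<epsilon>"
    using \<epsilon> unfolding continuous_at_eps_delta by blast
  define \<delta> where "\<delta> = min d (R / 2)"
  have \<delta>: "\<delta> > 0" "\<delta> \<le> d" "\<delta> \<le> R / 2" using d R by (auto simp: \<delta>_def)
  have nb: "ball z \<delta> \<subseteq> nbhd p q r s" using R \<delta> by (auto simp: subset_iff)
  have main: "intrinsic_dist S x y = ennreal (sdist (?D x) (?D y)) \<and> ?D x \<noteq> - ?D y"
    if S: "x \<in> S" "y \<in> S" and b: "x \<in> ball z \<delta>" "y \<in> ball z \<delta>" for x y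
  proof -
    have "x \<in> nbhd p q r s" "y \<in> nbhd p q r s" using b nb by auto
    have fx: "coord r x = 0 \<or> coord s x = 0" and fy: "coord r y = 0 \<or> coord s y = 0"
      using nbhd_face[OF l] S \<open>x \<in> nbhd p q r s\<close> \<open>y \<in> nbhd p q r s\<close> by auto
    have un: "norm (?D x) = 1" "norm (?D y) = 1" using dev_norm[OF l] S fx fy by auto
    have "dist (?D x) (?D z) < \<epsilon>" "dist (?D y) (?D z) < \<epsilon>" using b \<delta> by (auto intro!: d simp: dist_commute)
    then have n: "norm (?D x - ?D y) < 2 * \<epsilon>"
      using dist_triangle2[of "?D x" "?D y" "?D z"] by (simp add: dist_norm)
    have ne: "?D x \<noteq> - ?D y"
    proof
      assume a: "?D x = - ?D y"
      have "?D x - ?D y = - (2 *\<^sub>R ?D y)" unfolding a by (simp add: scaleR_2)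
      then have "norm (?D x - ?D y) = 2" using un by simp
      then show False using n by (simp add: \<epsilon>_def)
    qed
    have "norm (?D x - ?D y) < sqrt (2 - 2 * cos \<eta>)" using n by (auto simp: \<epsilon>_def)
    then have "(norm (?D x - ?D y))\<^sup>2 < (sqrt (2 - 2 * cos \<eta>))\<^sup>2"
      by (intro power_strict_mono) auto
    then have "sdist (?D x) (?D y) < \<eta>" using ce \<eta> \<open>pi > 1\<close> by (intro sdist_less un) auto
    have "ennreal (sdist (?D x) (?D y)) \<le> intrinsic_dist S x y"
    proof (rule intrinsic_dist_greatest)
      fix g assume g: "path g" "path_image g \<subseteq> S" "pathstart g = x" "pathfinish g = y"
      show "ennreal (sdist (?D x) (?D y)) \<le> curve_length g 0 1"
      proof (cases "\<forall>t\<in>{0..1}. coord r (g t) = 0 \<or> coord s (g t) = 0")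
        case True
        then show ?thesis using dev_le_path_length[OF l S fx fy g] by auto
      next
        case False
        then obtain t where t: "t \<in> {0..1}" "coord r (g t) \<noteq> 0" "coord s (g t) \<noteq> 0" by auto
        have gS: "g t \<in> S" if "t \<in> {0..1}" for t using g(2) that by (auto simp: path_image_def)
        then have gu: "norm (g t) = 1" if "t \<in> {0..1}" for t using that by (auto simp: S_iff)
        have "g t \<notin> nbhd p q r s" using nbhd_face[OF l gS[OF t(1)]] t by auto
        then have far: "dist z (g t) \<ge> R" using R by (auto simp: subset_iff not_less)
        have "dist x (g t) \<ge> R / 2" "dist y (g t) \<ge> R / 2"
          using far b \<delta> dist_triangle[of z "g t" x] dist_triangle[of z "g t" y] by auto
        then have "R \<le> norm (g 0 - g t) + norm (g t - g 1)"
          using g by (simp add: pathstart_def pathfinish_def dist_norm norm_minus_commute)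
        also have "\<dots> \<le> sdist (g 0) (g t) + sdist (g t) (g 1)"
          using gu t by (intro add_mono sdist_ge_norm) auto
        finally have "ennreal (sdist (?D x) (?D y)) \<le> ennreal (sdist (g 0) (g t) + sdist (g t) (g 1))"
          using \<open>sdist (?D x) (?D y) < \<eta>\<close> \<eta> by (intro ennreal_leI) auto
        also have "\<dots> \<le> curve_length g 0 1" using t gu by (intro curve_length_ge_through) auto
        finally show ?thesis .
      qed
    qed
    moreover have "intrinsic_dist S x y \<le> ennreal (sdist (?D x) (?D y))"
      using \<open>x \<in> nbhd p q r s\<close> \<open>y \<in> nbhd p q r s\<close> S ne
      by (intro intrinsic_dist_le_dev[OF l]) (auto simp: nbhd_def)
    ultimately show ?thesis using ne by auto
  qed
  show ?thesis by (rule that[OF \<delta>(1) nb]) (use main in blast)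
qed

end

section \<open>Geodesics avoid the vertices\<close>

text \<open>Polar coordinates on the unit sphere of \<open>\<real> \<times> \<complex>\<close>, into which the faces at a vertex are unfolded side by
  side; \<open>\<rho>\<close> is the tangent of the distance from the vertex \<open>(1, 0)\<close>.\<close>

definition pol :: "real \<Rightarrow> real \<Rightarrow> real \<times> complex" where
  "pol \<rho> \<theta> = (1 / sqrt (1 + \<rho>\<^sup>2)) *\<^sub>R (1, \<rho> *\<^sub>R cis \<theta>)"

lemma cis_inner: "cis a \<bullet> cis b = cos (a - b)"
  by (simp add: inner_complex_def cos_diff)

lemma pol_inner:
  "pol \<rho> \<theta> \<bullet> pol \<rho>' \<theta>' = (1 + \<rho> * \<rho>' * cos (\<theta> - \<theta>')) / (sqrt (1 + \<rho>\<^sup>2) * sqrt (1 + \<rho>'\<^sup>2))"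
  by (simp add: pol_def inner_prod_def cis_inner add_divide_distrib ac_simps)

lemma one_plus_sq_pos: "0 < 1 + (x::real)\<^sup>2"
  by (simp add: add_pos_nonneg)

lemma norm_pol: "norm (pol \<rho> \<theta>) = 1"
proof -
  have "pol \<rho> \<theta> \<bullet> pol \<rho> \<theta> = 1"
    using one_plus_sq_pos[of \<rho>] unfolding pol_inner by (simp add: power2_eq_square)
  then show ?thesis by (simp add: norm_eq_1)
qed

lemma pol_not_antipodal: "pol \<rho> \<theta> \<noteq> - pol \<rho>' \<theta>'"
proof
  assume "pol \<rho> \<theta> = - pol \<rho>' \<theta>'"
  then have "fst (pol \<rho> \<theta>) = - fst (pol \<rho>' \<theta>')" by simp
  moreover have "fst (pol \<rho> \<theta>) > 0" "fst (pol \<rho>' \<theta>') > 0"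
    using one_plus_sq_pos by (auto simp: pol_def)
  ultimately show False by simp
qed

text \<open>\<open>pol\<close> is the inverse of central projection to a plane, where great circles
  become straight lines and (rho, phi) are polar coordinates. The new point is the intersection of a
  segment with the ray at angle \<open>\<phi>1\<close>, and the bound R is convexity of a
  disc.\<close>

lemma pol_split:
  assumes \<phi>: "\<phi>0 \<le> \<phi>1" "\<phi>1 \<le> \<phi>2" "\<phi>2 - \<phi>0 < pi" and \<rho>: "0 < \<rho>0" "\<rho>0 \<le> R" "0 < \<rho>2" "\<rho>2 \<le> R"
  obtains \<rho>1 where "0 < \<rho>1" "\<rho>1 \<le> R"
    "sdist (pol \<rho>0 \<phi>0) (pol \<rho>1 \<phi>1) + sdist (pol \<rho>1 \<phi>1) (pol \<rho>2 \<phi>2) = sdist (pol \<rho>0 \<phi>0) (pol \<rho>2 \<phi>2)"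
proof (cases "\<phi>0 = \<phi>2")
  case True
  then have "\<phi>1 = \<phi>0" using \<phi> by simp
  then show ?thesis using that[of \<rho>0] \<rho> norm_pol[of \<rho>0 \<phi>0] by simp
next
  case False
  then have s02: "sin (\<phi>2 - \<phi>0) > 0" using \<phi> by (intro sin_gt_zero) auto
  have s01: "sin (\<phi>1 - \<phi>0) \<ge> 0" and s12: "sin (\<phi>2 - \<phi>1) \<ge> 0" using \<phi> by (auto intro!: sin_ge_zero)
  define D where "D = \<rho>0 * sin (\<phi>1 - \<phi>0) + \<rho>2 * sin (\<phi>2 - \<phi>1)"
  have "D \<noteq> 0"
  proof
    assume "D = 0"
    moreover have "\<rho>0 * sin (\<phi>1 - \<phi>0) \<ge> 0" "\<rho>2 * sin (\<phi>2 - \<phi>1) \<ge> 0" using s01 s12 \<rho> by simp_all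
    ultimately have "sin (\<phi>1 - \<phi>0) = 0" "sin (\<phi>2 - \<phi>1) = 0" using \<rho> unfolding D_def
      by (auto simp: add_nonneg_eq_0_iff)
    then have "sin ((\<phi>1 - \<phi>0) + (\<phi>2 - \<phi>1)) = 0" unfolding sin_add by simp
    then show False using s02 by simp
  qed
  moreover have "D \<ge> 0" using s01 s12 \<rho> by (simp add: D_def)
  ultimately have D: "D > 0" by simp
  define t where "t = \<rho>0 * sin (\<phi>1 - \<phi>0) / D"
  have t: "0 \<le> t" "1 - t = \<rho>2 * sin (\<phi>2 - \<phi>1) / D"
    using D s01 \<rho> by (auto simp: t_def D_def field_simps)
  then have t1: "t \<le> 1" using s12 \<rho> D by (metis diff_ge_0_iff_ge divide_nonneg_pos less_imp_le mult_nonneg_nonneg)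
  define \<rho>1 where "\<rho>1 = \<rho>0 * \<rho>2 * sin (\<phi>2 - \<phi>0) / D"
  have r1: "\<rho>1 > 0" using D s02 \<rho> by (simp add: \<rho>1_def)
  have id: "sin (\<phi>2 - \<phi>1) *\<^sub>R cis \<phi>0 + sin (\<phi>1 - \<phi>0) *\<^sub>R cis \<phi>2 = sin (\<phi>2 - \<phi>0) *\<^sub>R cis \<phi>1"
  proof -
    define u v where "u = \<phi>1 - \<phi>0" and "v = \<phi>2 - \<phi>1"
    have e: "\<phi>0 = \<phi>1 - u" "\<phi>2 = \<phi>1 + v" "\<phi>2 - \<phi>0 = u + v" by (auto simp: u_def v_def)
    show ?thesis unfolding u_def[symmetric] v_def[symmetric] e(3) unfolding e(1,2)
      by (simp add: complex_eq_iff cos_diff cos_add sin_diff sin_add algebra_simps)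
  qed
  have key: "\<rho>1 *\<^sub>R cis \<phi>1 = ((1 - t) * \<rho>0) *\<^sub>R cis \<phi>0 + (t * \<rho>2) *\<^sub>R cis \<phi>2"
  proof -
    have "((1 - t) * \<rho>0) *\<^sub>R cis \<phi>0 + (t * \<rho>2) *\<^sub>R cis \<phi>2
      = (\<rho>0 * \<rho>2 / D) *\<^sub>R (sin (\<phi>2 - \<phi>1) *\<^sub>R cis \<phi>0 + sin (\<phi>1 - \<phi>0) *\<^sub>R cis \<phi>2)"
      by (simp only: t(2)) (simp add: t_def algebra_simps)
    then show ?thesis unfolding id by (simp add: \<rho>1_def)
  qed
  have "\<rho>1 = norm (\<rho>1 *\<^sub>R cis \<phi>1)" using r1 by simp
  also have "\<dots> \<le> (1 - t) * \<rho>0 + t * \<rho>2"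
  proof -
    have "0 \<le> (1 - t) * \<rho>0" "0 \<le> t * \<rho>2" using t(1) t1 \<rho> by simp_all
    then have "norm (((1 - t) * \<rho>0) *\<^sub>R cis \<phi>0) = (1 - t) * \<rho>0" "norm ((t * \<rho>2) *\<^sub>R cis \<phi>2) = t * \<rho>2"
      by (simp_all only: norm_scaleR norm_cis abs_of_nonneg mult_1_right)
    then show ?thesis unfolding key using norm_triangle_ineq[of "((1 - t) * \<rho>0) *\<^sub>R cis \<phi>0" "(t * \<rho>2) *\<^sub>R cis \<phi>2"] by linarith
  qed
  also have "\<dots> \<le> (1 - t) * R + t * R" using t t1 \<rho> by (intro add_mono mult_left_mono) auto
  finally have rR: "\<rho>1 \<le> R" by (simp add: algebra_simps)
  let ?n = "\<lambda>\<rho>. sqrt (1 + \<rho>\<^sup>2)"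
  have n: "?n \<rho> > 0" for \<rho> using one_plus_sq_pos by simp
  have E: "pol \<rho>1 \<phi>1 = ((1 - t) * ?n \<rho>0 / ?n \<rho>1) *\<^sub>R pol \<rho>0 \<phi>0 + (t * ?n \<rho>2 / ?n \<rho>1) *\<^sub>R pol \<rho>2 \<phi>2"
  proof -
    have e: "a *\<^sub>R pol \<rho> \<phi> = (a / ?n \<rho>) *\<^sub>R (1, \<rho> *\<^sub>R cis \<phi>)" for a \<rho> \<phi>
      by (simp add: pol_def)
    have f: "((1 - t) * ?n \<rho>0 / ?n \<rho>1) / ?n \<rho>0 = (1 - t) / ?n \<rho>1" "(t * ?n \<rho>2 / ?n \<rho>1) / ?n \<rho>2 = t / ?n \<rho>1"
      using n[of \<rho>0] n[of \<rho>2] by simp_all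
    have "pol \<rho>1 \<phi>1 = (1 / ?n \<rho>1) *\<^sub>R (1, ((1 - t) * \<rho>0) *\<^sub>R cis \<phi>0 + (t * \<rho>2) *\<^sub>R cis \<phi>2)"
      unfolding pol_def key ..
    also have "\<dots> = ((1 - t) / ?n \<rho>1) *\<^sub>R (1, \<rho>0 *\<^sub>R cis \<phi>0) + (t / ?n \<rho>1) *\<^sub>R (1, \<rho>2 *\<^sub>R cis \<phi>2)"
      by (simp add: scaleR_add_right add_divide_distrib[symmetric])
    finally show ?thesis unfolding e f .
  qed
  have "0 \<le> 1 - t" using t1 by simp
  have "sdist (pol \<rho>0 \<phi>0) (pol \<rho>1 \<phi>1) + sdist (pol \<rho>1 \<phi>1) (pol \<rho>2 \<phi>2) = sdist (pol \<rho>0 \<phi>0) (pol \<rho>2 \<phi>2)"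
    by (rule sdist_cone_add[OF norm_pol norm_pol norm_pol pol_not_antipodal E])
      (use \<open>0 \<le> 1 - t\<close> t(1) n[of \<rho>0] n[of \<rho>1] n[of \<rho>2] in \<open>auto simp del: t(2) intro!: divide_nonneg_pos mult_nonneg_nonneg\<close>)
  then show ?thesis using that[OF r1 rR] by simp
qed

text \<open>Equality would put the origin on the segment between the two projected points. They
  would then lie in opposite directions, at an angle of pi.\<close>

lemma pol_shortcut:
  assumes \<rho>: "0 < \<rho>" "0 < \<rho>'" and \<phi>: "\<bar>\<phi>' - \<phi>\<bar> < pi"
  shows "sdist (pol \<rho> \<phi>) (pol \<rho>' \<phi>') < sdist (pol \<rho> \<phi>) (pol 0 \<psi>) + sdist (pol 0 \<psi>) (pol \<rho>' \<phi>')"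
proof (rule ccontr)
  assume "\<not> ?thesis"
  then obtain a b where ab: "a \<ge> 0" "b \<ge> 0" "pol 0 \<psi> = a *\<^sub>R pol \<rho> \<phi> + b *\<^sub>R pol \<rho>' \<phi>'"
    using sdist_triangle_eq[OF norm_pol norm_pol norm_pol pol_not_antipodal, of \<rho> \<phi> 0 \<psi> \<rho>' \<phi>'] by auto
  define A B where "A = a / sqrt (1 + \<rho>\<^sup>2)" and "B = b / sqrt (1 + \<rho>'\<^sup>2)"
  have AB: "A \<ge> 0" "B \<ge> 0" using ab one_plus_sq_pos by (auto simp: A_def B_def)
  have "fst (pol 0 \<psi>) = A + B" "snd (pol 0 \<psi>) = (A * \<rho>) *\<^sub>R cis \<phi> + (B * \<rho>') *\<^sub>R cis \<phi>'"
    unfolding ab(3) by (auto simp: pol_def A_def B_def)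
  then have 1: "A + B = 1" and 2: "(A * \<rho>) *\<^sub>R cis \<phi> + (B * \<rho>') *\<^sub>R cis \<phi>' = 0" by (auto simp: pol_def)
  have 3: "A * \<rho> + B * \<rho>' * cos (\<phi>' - \<phi>) = 0"
    using arg_cong[OF 2, of "\<lambda>z. z \<bullet> cis \<phi>"] by (simp add: inner_add_left cis_inner)
  have 4: "A * \<rho> * cos (\<phi>' - \<phi>) + B * \<rho>' = 0"
    using arg_cong[OF 2, of "\<lambda>z. z \<bullet> cis \<phi>'"] by (simp add: inner_add_left cis_inner) (metis cos_minus minus_diff_eq)
  define C where "C = cos (\<phi>' - \<phi>)"
  have "C \<noteq> - 1"
  proof
    assume "C = - 1"
    then have "cos \<bar>\<phi>' - \<phi>\<bar> = cos pi" by (simp add: C_def)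
    then have "\<bar>\<phi>' - \<phi>\<bar> = pi" using \<phi> cos_inj_pi[of "\<bar>\<phi>' - \<phi>\<bar>" pi] by simp
    then show False using \<phi> by simp
  qed
  then have "C > - 1" using cos_ge_minus_one[of "\<phi>' - \<phi>"] unfolding C_def by linarith
  have "(A * \<rho> + B * \<rho>') * (1 + C) = 0" using 3 4 unfolding C_def[symmetric] by (simp add: algebra_simps)
  then have "A * \<rho> + B * \<rho>' = 0" using \<open>C > -1\<close> by simp
  moreover have "A * \<rho> \<ge> 0" "B * \<rho>' \<ge> 0" using AB \<rho> by simp_all
  ultimately have "A * \<rho> = 0" "B * \<rho>' = 0" by linarith+
  then show False using \<rho> 1 by simp
qed

section \<open>Polar coordinates on the surface around a vertex\<close>

context reg_tetra
begin

text \<open>The face angle, by the spherical law of cosines for an equilateral triangle whose edge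
  length has cosine c.\<close>

definition alpha :: real where "alpha = arccos (c / (1 + c))"

lemma alpha: "cos alpha = c / (1 + c)" "0 < alpha" "alpha < 2 * pi / 3" "0 < sin alpha"
proof -
  have b: "- (1/2) < c / (1 + c)" "c / (1 + c) < 1/2" using c_gr c_less by (auto simp: field_simps)
  show "cos alpha = c / (1 + c)" unfolding alpha_def using b by (intro cos_arccos) linarith+
  show p: "0 < alpha" unfolding alpha_def using b by (intro arccos_lt_bounded[THEN conjunct1]) linarith+
  show q: "alpha < 2 * pi / 3" unfolding alpha_def arccos_minus_one_half[symmetric]
    using b by (intro arccos_less_arccos) linarith+
  show "0 < sin alpha" using p q by (intro sin_gt_zero) auto
qed

text \<open>The sine of the edge length; it normalizes the tangent vectors
  \<open>edge_dir\<close>.\<close>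

definition sg :: real where "sg = sqrt (1 - c\<^sup>2)"

lemma sg: "0 < sg" "sg\<^sup>2 = 1 - c\<^sup>2"
proof -
  have "c\<^sup>2 < 1" using c_gr c_less by (simp add: abs_square_less_1)
  then show "0 < sg" "sg\<^sup>2 = 1 - c\<^sup>2" by (auto simp: sg_def)
qed

definition edge_dir :: "real ^ 4 \<Rightarrow> real ^ 4 \<Rightarrow> real ^ 4" where
  "edge_dir p v = (1 / sg) *\<^sub>R (v - c *\<^sub>R p)"

lemma edge_dir_inner:
  assumes "p \<in> V" "v \<in> V" "w \<in> V" "v \<noteq> p" "w \<noteq> p"
  shows "edge_dir p v \<bullet> p = 0" "p \<bullet> edge_dir p v = 0" "edge_dir p v \<bullet> edge_dir p w = (if v = w then 1 else cos alpha)"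
proof -
  have i: "v \<bullet> p = c" "p \<bullet> v = c" "p \<bullet> w = c" "w \<bullet> p = c" "p \<bullet> p = 1" "v \<bullet> v = 1" "v \<noteq> w \<Longrightarrow> v \<bullet> w = c"
    using assms unit_V inner_V by auto
  show "edge_dir p v \<bullet> p = 0" by (simp add: edge_dir_def inner_simps i)
  then show "p \<bullet> edge_dir p v = 0" by (simp add: inner_commute)
  have "edge_dir p v \<bullet> edge_dir p w = (v \<bullet> w - c\<^sup>2) / sg\<^sup>2"
    by (simp add: edge_dir_def inner_simps i power2_eq_square diff_divide_distrib algebra_simps)
  also have "\<dots> = (if v = w then 1 else cos alpha)"
  proof (cases "v = w")
    case True
    then show ?thesis using i sg by auto
  next
    case False
    have "1 - c\<^sup>2 = (1 - c) * (1 + c)" "c - c\<^sup>2 = (1 - c) * c" by (auto simp: power2_eq_square algebra_simps)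
    then show ?thesis using False i sg(2) c_less c_gr alpha(1) by simp
  qed
  finally show "edge_dir p v \<bullet> edge_dir p w = (if v = w then 1 else cos alpha)" .
qed

text \<open>The unit tangent vector at p in the plane of the face \<open>pvw\<close> that makes the
  angle \<theta> with the edge \<open>pv\<close>, written in the basis of the two edge directions by
  the sine rule.\<close>

definition sec :: "real ^ 4 \<Rightarrow> real ^ 4 \<Rightarrow> real ^ 4 \<Rightarrow> real \<Rightarrow> real ^ 4" where
  "sec p v w \<theta> = (sin (alpha - \<theta>) / sin alpha) *\<^sub>R edge_dir p v + (sin \<theta> / sin alpha) *\<^sub>R edge_dir p w"

lemma sec_ends: "sec p v w 0 = edge_dir p v" "sec p v w alpha = edge_dir p w"
  using alpha(4) by (simp_all add: sec_def)

lemma sec_inner: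
  assumes l: "labelling p v w s"
  shows "sec p v w \<theta> \<bullet> sec p v w \<theta>' = cos (\<theta> - \<theta>')" "p \<bullet> sec p v w \<theta> = 0" "sec p v w \<theta> \<bullet> p = 0"
proof -
  have n: "v \<noteq> p" "w \<noteq> p" "v \<noteq> w" using labelling_neq[OF l] by auto
  note V = labelling_in[OF l]
  have i: "edge_dir p v \<bullet> edge_dir p v = 1" "edge_dir p w \<bullet> edge_dir p w = 1" "edge_dir p v \<bullet> edge_dir p w = cos alpha"
    "edge_dir p w \<bullet> edge_dir p v = cos alpha" "edge_dir p v \<bullet> p = 0" "edge_dir p w \<bullet> p = 0" "p \<bullet> edge_dir p v = 0" "p \<bullet> edge_dir p w = 0"
    using edge_dir_inner V n by auto
  show "p \<bullet> sec p v w \<theta> = 0" "sec p v w \<theta> \<bullet> p = 0" by (simp_all add: sec_def inner_simps i)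
  define a where "a \<theta> = sin (alpha - \<theta>) / sin alpha" for \<theta>
  define b where "b \<theta> = sin \<theta> / sin alpha" for \<theta>
  have se: "sec p v w \<theta> = a \<theta> *\<^sub>R edge_dir p v + b \<theta> *\<^sub>R edge_dir p w" for \<theta>
    by (simp add: sec_def a_def b_def)
  have "sec p v w \<theta> \<bullet> sec p v w \<theta>' =
      a \<theta> * a \<theta>' + b \<theta> * b \<theta>' + cos alpha * (a \<theta> * b \<theta>' + b \<theta> * a \<theta>')"
    unfolding se by (simp add: inner_add_left inner_add_right i algebra_simps)
  also have "\<dots> = cos \<theta> * cos \<theta>' + b \<theta> * b \<theta>' * (1 - (cos alpha)\<^sup>2)"
  proof -
    have a: "a \<theta> = cos \<theta> - cos alpha * b \<theta>" for \<theta> using alpha(4) by (simp add: a_def b_def sin_diff field_simps)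
    show ?thesis unfolding a by (simp add: algebra_simps power2_eq_square)
  qed
  also have "1 - (cos alpha)\<^sup>2 = (sin alpha)\<^sup>2" by (simp add: sin_squared_eq)
  also have "b \<theta> * b \<theta>' * (sin alpha)\<^sup>2 = sin \<theta> * sin \<theta>'" using alpha(4) by (simp add: b_def power2_eq_square)
  finally show "sec p v w \<theta> \<bullet> sec p v w \<theta>' = cos (\<theta> - \<theta>')" by (simp add: cos_diff)
qed

text \<open>The same coordinates in the face \<open>pvw\<close>, with the angle measured at \<open>p\<close> from the edge \<open>pv\<close>.\<close>

definition sector_pt :: "real ^ 4 \<Rightarrow> real ^ 4 \<Rightarrow> real ^ 4 \<Rightarrow> real \<Rightarrow> real \<Rightarrow> real ^ 4" where
  "sector_pt p v w \<rho> \<theta> = (1 / sqrt (1 + \<rho>\<^sup>2)) *\<^sub>R (p + \<rho> *\<^sub>R sec p v w \<theta>)"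

lemma sector_pt_inner:
  assumes l: "labelling p v w s"
  shows "sector_pt p v w \<rho> \<theta> \<bullet> sector_pt p v w \<rho>' \<theta>' = pol \<rho> (\<theta> + h) \<bullet> pol \<rho>' (\<theta>' + h)"
proof -
  have "p \<bullet> p = 1" using labelling_inner[OF l] by simp
  then show ?thesis
    by (simp add: sector_pt_def pol_inner inner_add_left inner_add_right sec_inner[OF l] add_divide_distrib ac_simps)
qed

text \<open>Up to this radius the coefficients of both far vertices are at most 1/2 before
  normalization, which leaves the coordinate at p nonnegative; the whole sector then lies in the
  face.\<close>

definition rho0 :: real where "rho0 = sg * sin alpha / 2"

lemma rho0_pos: "0 < rho0" using sg(1) alpha(4) by (simp add: rho0_def)

lemma sector_pt_S:
  assumes l: "labelling p v w s" and \<theta>: "0 \<le> \<theta>" "\<theta> \<le> alpha" and \<rho>: "0 \<le> \<rho>" "\<rho> \<le> rho0"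
  shows "sector_pt p v w \<rho> \<theta> \<in> S" "coord s (sector_pt p v w \<rho> \<theta>) = 0"
proof -
  have "norm (sector_pt p v w \<rho> \<theta>) = 1"
    using sector_pt_inner[OF l, of \<rho> \<theta> \<rho> \<theta> 0] norm_pol[of \<rho> \<theta>] by (simp add: norm_eq_1)
  define a b where "a = \<rho> * sin (alpha - \<theta>) / (sin alpha * sg)" and "b = \<rho> * sin \<theta> / (sin alpha * sg)"
  have nn: "sin (alpha - \<theta>) \<ge> 0" "sin \<theta> \<ge> 0" using \<theta> alpha(3) pi_gt_zero by (auto intro!: sin_ge_zero)
  then have ab: "a \<ge> 0" "b \<ge> 0" using \<rho> alpha(4) sg(1) by (simp_all add: a_def b_def)
  have h: "\<rho> / (sin alpha * sg) \<le> 1/2" using \<rho> alpha(4) sg(1) by (simp add: rho0_def field_simps)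
  have hh: "\<rho> / (sin alpha * sg) \<ge> 0" using \<rho> alpha(4) sg(1) by simp
  have "a \<le> 1/2 * 1" "b \<le> 1/2 * 1"
    unfolding a_def b_def using mult_mono[OF h, of "sin (alpha - \<theta>)" 1] mult_mono[OF h, of "sin \<theta>" 1] nn hh by simp_all
  then have "a + b \<le> 1" by simp
  then have "c * (a + b) \<le> 1" using c_less c_gr ab
    by (metis add_nonneg_nonneg less_imp_le mult_left_le_one_le mult_le_one mult_nonneg_nonpos2 not_le order_trans zero_le_one mult.commute)
  have eq: "p + \<rho> *\<^sub>R sec p v w \<theta> = (1 - c * (a + b)) *\<^sub>R p + a *\<^sub>R v + b *\<^sub>R w"
    by (simp add: sec_def edge_dir_def a_def b_def algebra_simps)
  have sq: "sqrt (1 + \<rho>\<^sup>2) > 0" using one_plus_sq_pos by simp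
  show "coord s (sector_pt p v w \<rho> \<theta>) = 0"
    unfolding sector_pt_def eq coord_add coord_scale using labelling_coord[OF l] by simp
  then show "sector_pt p v w \<rho> \<theta> \<in> S" using \<open>norm _ = 1\<close> ab sq \<open>c * (a + b) \<le> 1\<close>
    unfolding S_labelling[OF l] by (simp add: sector_pt_def eq coord_add coord_scale labelling_coord[OF l])
qed

lemma sector_pt_dist:
  assumes l: "labelling p v w s" and "0 \<le> \<theta>" "\<theta> \<le> alpha" "0 \<le> \<rho>" "\<rho> \<le> rho0" "0 \<le> \<theta>'" "\<theta>' \<le> alpha" "0 \<le> \<rho>'" "\<rho>' \<le> rho0"
  shows "intrinsic_dist S (sector_pt p v w \<rho> \<theta>) (sector_pt p v w \<rho>' \<theta>') \<le> ennreal (sdist (pol \<rho> (\<theta> + h)) (pol \<rho>' (\<theta>' + h)))"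
  using intrinsic_dist_face[of s "sector_pt p v w \<rho> \<theta>" "sector_pt p v w \<rho>' \<theta>'"] sector_pt_S[OF l] labelling_in[OF l] assms
  unfolding sdist_def sector_pt_inner[OF l, of _ _ _ _ h] by auto

lemma sector_pt_swap: "sector_pt p v w \<rho> \<theta> = sector_pt p w v \<rho> (alpha - \<theta>)"
  by (simp add: sector_pt_def sec_def add.commute)

lemma sector_pt_edge: "sector_pt p u v \<rho> alpha = sector_pt p v w \<rho> 0"
  by (simp add: sector_pt_def sec_ends)

lemma sector_pt_zero: "sector_pt p v w 0 \<theta> = p"
  by (simp add: sector_pt_def)

lemma sector_pt_ex:
  assumes l: "labelling p v w s" and x: "x \<in> S" "coord s x = 0" "x \<noteq> p" and m: "x \<bullet> p > 1 / sqrt (1 + rho0\<^sup>2)"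
  obtains \<rho> \<theta> where "0 < \<rho>" "\<rho> \<le> rho0" "0 \<le> \<theta>" "\<theta> \<le> alpha" "x = sector_pt p v w \<rho> \<theta>"
proof -
  define m where "m = x \<bullet> p"
  have "1 / sqrt (1 + rho0\<^sup>2) > 0" using one_plus_sq_pos by simp
  then have m0: "m > 0" using assms(5) unfolding m_def by linarith
  have ex: "x = coord p x *\<^sub>R p + coord v x *\<^sub>R v + coord w x *\<^sub>R w" using labelling_expand[OF l, of x] x by simp
  have mm: "m = coord p x + c * (coord v x + coord w x)"
    unfolding m_def by (subst ex) (simp add: inner_add_left labelling_inner[OF l] algebra_simps)
  \<comment> \<open>The coefficients of \<open>(1 / m) *\<^sub>R x - p\<close> in the oblique basis
    of the two edge directions. The complex number z below represents the same tangent vector, so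
    its modulus and argument are the polar coordinates.\<close>
  define \<beta> \<gamma> where "\<beta> = sg * coord v x / m" and "\<gamma> = sg * coord w x / m"
  have bg: "\<beta> \<ge> 0" "\<gamma> \<ge> 0" using x m0 sg(1) S_labelling[OF l, of x] by (auto simp: \<beta>_def \<gamma>_def)
  define z where "z = complex_of_real \<beta> + \<gamma> *\<^sub>R cis alpha"
  define \<rho> \<theta> where "\<rho> = cmod z" and "\<theta> = Arg z"
  have z: "Re z = \<beta> + \<gamma> * cos alpha" "Im z = \<gamma> * sin alpha" by (auto simp: z_def)
  have pz: "\<rho> * cos \<theta> = \<beta> + \<gamma> * cos alpha" "\<rho> * sin \<theta> = \<gamma> * sin alpha"
    using z by (metis \<rho>_def \<theta>_def cis.sel(1) rcis_cmod_Arg Re_rcis, metis \<rho>_def \<theta>_def rcis_cmod_Arg Im_rcis z(2))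
  have ps: "\<rho> * sin (alpha - \<theta>) = \<beta> * sin alpha"
  proof -
    have "\<rho> * sin (alpha - \<theta>) = sin alpha * (\<rho> * cos \<theta>) - cos alpha * (\<rho> * sin \<theta>)"
      by (simp add: sin_diff algebra_simps)
    then show ?thesis unfolding pz by (simp add: algebra_simps)
  qed
  have x2: "(1 / m) *\<^sub>R x = p + \<beta> *\<^sub>R edge_dir p v + \<gamma> *\<^sub>R edge_dir p w"
  proof -
    have h1: "coord p x / m = 1 - c * (\<beta> / sg) - c * (\<gamma> / sg)"
    proof -
      have "coord p x = m - c * coord v x - c * coord w x" using mm by (simp add: algebra_simps)
      then show ?thesis using m0 sg(1) by (simp add: \<beta>_def \<gamma>_def diff_divide_distrib)
    qed
    have h2: "coord v x / m = \<beta> / sg" "coord w x / m = \<gamma> / sg" using sg(1) by (auto simp: \<beta>_def \<gamma>_def)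
    have h3: "(1 / m) *\<^sub>R x = (coord p x / m) *\<^sub>R p + (coord v x / m) *\<^sub>R v + (coord w x / m) *\<^sub>R w"
      by (subst ex) (simp add: scaleR_add_right)
    show ?thesis unfolding h3 h1 h2 edge_dir_def by (simp add: algebra_simps)
  qed
  have sec: "\<rho> *\<^sub>R sec p v w \<theta> = \<beta> *\<^sub>R edge_dir p v + \<gamma> *\<^sub>R edge_dir p w"
  proof -
    have "\<rho> * (sin (alpha - \<theta>) / sin alpha) = \<beta>" "\<rho> * (sin \<theta> / sin alpha) = \<gamma>"
      using ps pz(2) alpha(4) by (auto simp: field_simps)
    then show ?thesis by (simp add: sec_def scaleR_add_right)
  qed
  have eq: "x = m *\<^sub>R (p + \<rho> *\<^sub>R sec p v w \<theta>)"
    using arg_cong[OF x2, of "\<lambda>y. m *\<^sub>R y"] m0 unfolding sec by (simp add: add.assoc)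
  have "p + \<rho> *\<^sub>R sec p v w \<theta> = sqrt (1 + \<rho>\<^sup>2) *\<^sub>R sector_pt p v w \<rho> \<theta>"
    using one_plus_sq_pos[of \<rho>] by (simp add: sector_pt_def)
  moreover have "norm (sector_pt p v w \<rho> \<theta>) = 1"
    using sector_pt_inner[OF l, of \<rho> \<theta> \<rho> \<theta> 0] norm_pol[of \<rho> \<theta>] by (simp add: norm_eq_1)
  ultimately have "norm x = m * sqrt (1 + \<rho>\<^sup>2)" using eq m0 by simp
  then have "m * sqrt (1 + \<rho>\<^sup>2) = 1" using x by (auto simp: S_iff)
  then have m1: "m = 1 / sqrt (1 + \<rho>\<^sup>2)" by (metis mult_zero_right nonzero_eq_divide_eq zero_neq_one)
  then have xw: "x = sector_pt p v w \<rho> \<theta>" using eq by (simp add: sector_pt_def)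
  have r0: "\<rho> > 0"
  proof (rule ccontr)
    assume "\<not> \<rho> > 0"
    then have "\<rho> = 0" by (simp add: \<rho>_def)
    then show False using xw x sector_pt_zero by simp
  qed
  have "1 / sqrt (1 + rho0\<^sup>2) < 1 / sqrt (1 + \<rho>\<^sup>2)" using assms(5) m1 m_def by simp
  then have "sqrt (1 + \<rho>\<^sup>2) < sqrt (1 + rho0\<^sup>2)"
    using one_plus_sq_pos[of \<rho>] one_plus_sq_pos[of rho0] by (simp add: field_simps)
  then have "\<rho>\<^sup>2 < rho0\<^sup>2" by simp
  then have r1: "\<rho> \<le> rho0" using rho0_pos by (simp add: power2_less_imp_less less_imp_le)
  have "sin \<theta> \<ge> 0" using pz(2) r0 bg alpha(4) by (metis mult_nonneg_nonneg less_imp_le zero_le_mult_iff not_less)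
  have tb: "- pi < \<theta>" "\<theta> \<le> pi" using Arg_bounded[of z] by (auto simp: \<theta>_def)
  have t0: "0 \<le> \<theta>"
  proof (rule ccontr)
    assume "\<not> 0 \<le> \<theta>"
    then have "sin (- \<theta>) > 0" using tb by (intro sin_gt_zero) auto
    then show False using \<open>sin \<theta> \<ge> 0\<close> by simp
  qed
  have "sin (alpha - \<theta>) \<ge> 0" using ps r0 bg alpha(4) by (metis mult_nonneg_nonneg less_imp_le zero_le_mult_iff not_less)
  have ta: "\<theta> \<le> alpha"
  proof (rule ccontr)
    assume "\<not> \<theta> \<le> alpha"
    then have "sin (\<theta> - alpha) > 0" using tb alpha(2) by (intro sin_gt_zero) auto
    then have "sin (alpha - \<theta>) < 0" by (metis minus_diff_eq sin_minus neg_less_0_iff_less)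
    then show False using \<open>sin (alpha - \<theta>) \<ge> 0\<close> by simp
  qed
  show ?thesis by (rule that[OF r0 r1 t0 ta xw])
qed

lemma sector_pt_sdist_vertex:
  assumes "labelling p v w s"
  shows "sdist (sector_pt p v w \<rho> \<theta>) p = sdist (pol \<rho> \<phi>) (pol 0 0)"
proof -
  have "pol 0 (\<phi> - \<theta>) = pol 0 0" by (simp add: pol_def)
  then show ?thesis
    using sector_pt_inner[OF assms, of \<rho> \<theta> 0 0 "\<phi> - \<theta>"] sector_pt_zero[of p v w 0] by (simp add: sdist_def)
qed

lemma vertex_shortcut_contra:
  assumes xp: "sdist x p = sdist (pol \<rho> \<phi>) (pol 0 0)" and yp: "sdist y p = sdist (pol \<rho>' \<phi>') (pol 0 0)"
    and le: "intrinsic_dist S x y \<le> ennreal (sdist (pol \<rho> \<phi>) (pol \<rho>' \<phi>'))"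
    and \<rho>: "0 < \<rho>" "0 < \<rho>'" "\<bar>\<phi>' - \<phi>\<bar> < pi"
  shows "\<not> intrinsic_dist S x p + intrinsic_dist S p y \<le> intrinsic_dist S x y"
proof
  assume a: "intrinsic_dist S x p + intrinsic_dist S p y \<le> intrinsic_dist S x y"
  have nn: "sdist x p \<ge> 0" "sdist p y \<ge> 0"
    using cos_sdist(2)[OF norm_pol norm_pol] xp yp by (simp_all add: sdist_commute[of p])
  have "ennreal (sdist x p + sdist p y) = ennreal (sdist x p) + ennreal (sdist p y)"
    using nn by (rule ennreal_plus)
  also have "\<dots> \<le> intrinsic_dist S x p + intrinsic_dist S p y"
    by (intro add_mono intrinsic_dist_ge S_sphere)
  also note a
  also note le
  finally have "sdist x p + sdist p y \<le> sdist (pol \<rho> \<phi>) (pol \<rho>' \<phi>')"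
    using cos_sdist(2)[OF norm_pol norm_pol, of \<rho> \<phi> \<rho>' \<phi>'] by (simp add: ennreal_le_iff)
  then show False
    using pol_shortcut[OF \<rho>, of 0] xp yp by (simp add: sdist_commute[of p] sdist_commute[of "pol 0 0"])
qed

lemma vertex_same_sector:
  assumes l: "labelling p q r s" and x: "x = sector_pt p q r \<rho> \<theta>" "0 < \<rho>" "\<rho> \<le> rho0" "0 \<le> \<theta>" "\<theta> \<le> alpha"
    and y: "y = sector_pt p q r \<rho>' \<theta>'" "0 < \<rho>'" "\<rho>' \<le> rho0" "0 \<le> \<theta>'" "\<theta>' \<le> alpha"
  shows "\<not> intrinsic_dist S x p + intrinsic_dist S p y \<le> intrinsic_dist S x y"
proof (rule vertex_shortcut_contra)
  show "sdist x p = sdist (pol \<rho> \<theta>) (pol 0 0)" "sdist y p = sdist (pol \<rho>' \<theta>') (pol 0 0)"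
    unfolding x y by (rule sector_pt_sdist_vertex[OF l])+
  show "intrinsic_dist S x y \<le> ennreal (sdist (pol \<rho> \<theta>) (pol \<rho>' \<theta>'))"
    unfolding x y using sector_pt_dist[OF l, of \<theta> \<rho> \<theta>' \<rho>' 0] x y by simp
  show "\<bar>\<theta>' - \<theta>\<bar> < pi" using x y alpha pi_gt_zero by (auto simp: abs_if)
qed (use x y in auto)

text \<open>The angle from x to y at p is \<open>alpha + \<theta>' - \<theta>\<close> one way round
  and \<open>3 * alpha\<close> minus that the other way. Since \<open>3 * alpha < 2 * pi\<close>,
  one of the two is below pi, and on that side a curve missing p is shorter; it passes through one
  or two edges at points supplied by \<open>pol_split\<close>.\<close>

lemma vertex_next_sector:
  assumes l: "labelling p q r s" and x: "x = sector_pt p q r \<rho> \<theta>" "0 < \<rho>" "\<rho> \<le> rho0" "0 \<le> \<theta>" "\<theta> \<le> alpha"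
    and y: "y = sector_pt p r s \<rho>' \<theta>'" "0 < \<rho>'" "\<rho>' \<le> rho0" "0 \<le> \<theta>'" "\<theta>' \<le> alpha"
  shows "\<not> intrinsic_dist S x p + intrinsic_dist S p y \<le> intrinsic_dist S x y"
proof (cases "alpha + \<theta>' - \<theta> < pi")
  case True
  obtain \<rho>1 where r: "0 < \<rho>1" "\<rho>1 \<le> rho0" and sp:
    "sdist (pol \<rho> \<theta>) (pol \<rho>1 alpha) + sdist (pol \<rho>1 alpha) (pol \<rho>' (alpha + \<theta>')) = sdist (pol \<rho> \<theta>) (pol \<rho>' (alpha + \<theta>'))"
    by (rule pol_split[of \<theta> alpha "alpha + \<theta>'" \<rho> rho0 \<rho>']) (use True x y in auto)
  let ?w = "sector_pt p q r \<rho>1 alpha"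
  show ?thesis
  proof (rule vertex_shortcut_contra)
    show "sdist x p = sdist (pol \<rho> \<theta>) (pol 0 0)" "sdist y p = sdist (pol \<rho>' (alpha + \<theta>')) (pol 0 0)"
      unfolding x y by (rule sector_pt_sdist_vertex[OF l] sector_pt_sdist_vertex[OF labelling_perm(7)[OF labelling_perm(1)[OF l]]] sector_pt_sdist_vertex[OF labelling_perm(13)[OF l]])+
    have "intrinsic_dist S x y \<le> intrinsic_dist S x ?w + intrinsic_dist S ?w y"
      by (rule intrinsic_dist_triangle[OF S_sphere])
    also have "\<dots> \<le> ennreal (sdist (pol \<rho> \<theta>) (pol \<rho>1 alpha)) + ennreal (sdist (pol \<rho>1 alpha) (pol \<rho>' (alpha + \<theta>')))"
    proof (rule add_mono)
      show "intrinsic_dist S x ?w \<le> ennreal (sdist (pol \<rho> \<theta>) (pol \<rho>1 alpha))"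
        unfolding x using sector_pt_dist[OF l, of \<theta> \<rho> alpha \<rho>1 0] x r alpha(2) by simp
      show "intrinsic_dist S ?w y \<le> ennreal (sdist (pol \<rho>1 alpha) (pol \<rho>' (alpha + \<theta>')))"
        unfolding y sector_pt_edge[of p q r \<rho>1 s]
        using sector_pt_dist[of p r s q 0 \<rho>1 \<theta>' \<rho>' alpha] labelling_perm(13)[OF l] y r alpha(2) by (simp add: add.commute)
    qed
    also have "\<dots> = ennreal (sdist (pol \<rho> \<theta>) (pol \<rho>' (alpha + \<theta>')))"
      unfolding sp[symmetric] by (intro ennreal_plus[symmetric] cos_sdist norm_pol)
    finally show "intrinsic_dist S x y \<le> ennreal (sdist (pol \<rho> \<theta>) (pol \<rho>' (alpha + \<theta>')))" .
    show "\<bar>alpha + \<theta>' - \<theta>\<bar> < pi" using True x y by auto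
  qed (use x y in auto)
next
  case False
  \<comment> \<open>The point x is placed one full turn later, so that the unfolded faces run from y
    through the third face back to x.\<close>
  let ?a = "alpha + \<theta>'" and ?b = "3 * alpha + \<theta>"
  have ab: "?b - ?a < pi" using False alpha(3) by linarith
  obtain \<rho>1 where r1: "0 < \<rho>1" "\<rho>1 \<le> rho0" and sp1:
    "sdist (pol \<rho>' ?a) (pol \<rho>1 (2 * alpha)) + sdist (pol \<rho>1 (2 * alpha)) (pol \<rho> ?b) = sdist (pol \<rho>' ?a) (pol \<rho> ?b)"
    by (rule pol_split[of ?a "2 * alpha" ?b \<rho>' rho0 \<rho>]) (use ab alpha(2) x y in auto)
  obtain \<rho>2 where r2: "0 < \<rho>2" "\<rho>2 \<le> rho0" and sp2:
    "sdist (pol \<rho>1 (2 * alpha)) (pol \<rho>2 (3 * alpha)) + sdist (pol \<rho>2 (3 * alpha)) (pol \<rho> ?b) = sdist (pol \<rho>1 (2 * alpha)) (pol \<rho> ?b)"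
    by (rule pol_split[of "2 * alpha" "3 * alpha" ?b \<rho>1 rho0 \<rho>]) (use ab alpha(2) x y r1 in auto)
  let ?w1 = "sector_pt p s q \<rho>1 0" and ?w2 = "sector_pt p s q \<rho>2 alpha"
  have l2: "labelling p s q r" "labelling p r s q" using l by (auto intro: labelling_perm)
  show ?thesis
  proof (rule vertex_shortcut_contra)
    show "sdist x p = sdist (pol \<rho> ?b) (pol 0 0)" "sdist y p = sdist (pol \<rho>' ?a) (pol 0 0)"
      unfolding x y by (rule sector_pt_sdist_vertex[OF l] sector_pt_sdist_vertex[OF l2(2)])+
    have "intrinsic_dist S x y \<le> intrinsic_dist S x ?w2 + (intrinsic_dist S ?w2 ?w1 + intrinsic_dist S ?w1 y)"
      using intrinsic_dist_triangle[OF S_sphere] add_left_mono order_trans by meson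
    also have "\<dots> \<le> ennreal (sdist (pol \<rho> ?b) (pol \<rho>2 (3 * alpha))) +
       (ennreal (sdist (pol \<rho>2 (3 * alpha)) (pol \<rho>1 (2 * alpha))) + ennreal (sdist (pol \<rho>1 (2 * alpha)) (pol \<rho>' ?a)))"
    proof (intro add_mono)
      show "intrinsic_dist S x ?w2 \<le> ennreal (sdist (pol \<rho> ?b) (pol \<rho>2 (3 * alpha)))"
        unfolding x sector_pt_edge[of p s q \<rho>2 r]
        using sector_pt_dist[OF l, of \<theta> \<rho> 0 \<rho>2 "3 * alpha"] x r2 alpha(2) by (simp add: add.commute)
      show "intrinsic_dist S ?w2 ?w1 \<le> ennreal (sdist (pol \<rho>2 (3 * alpha)) (pol \<rho>1 (2 * alpha)))"
        using sector_pt_dist[OF l2(1), of alpha \<rho>2 0 \<rho>1 "2 * alpha"] r1 r2 alpha(2) by simp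
      show "intrinsic_dist S ?w1 y \<le> ennreal (sdist (pol \<rho>1 (2 * alpha)) (pol \<rho>' ?a))"
        unfolding y sector_pt_edge[of p r s \<rho>1 q, symmetric]
        using sector_pt_dist[OF l2(2), of alpha \<rho>1 \<theta>' \<rho>' alpha] y r1 alpha(2) by (simp add: add.commute)
    qed
    also have "\<dots> = ennreal (sdist (pol \<rho> ?b) (pol \<rho>2 (3 * alpha)) +
       (sdist (pol \<rho>2 (3 * alpha)) (pol \<rho>1 (2 * alpha)) + sdist (pol \<rho>1 (2 * alpha)) (pol \<rho>' ?a)))"
      using cos_sdist(2)[OF norm_pol norm_pol] by (simp add: ennreal_plus)
    also have "sdist (pol \<rho> ?b) (pol \<rho>2 (3 * alpha)) +
       (sdist (pol \<rho>2 (3 * alpha)) (pol \<rho>1 (2 * alpha)) + sdist (pol \<rho>1 (2 * alpha)) (pol \<rho>' ?a))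
       = sdist (pol \<rho> ?b) (pol \<rho>' ?a)"
      using sp1 sp2 by (simp add: sdist_commute)
    finally show "intrinsic_dist S x y \<le> ennreal (sdist (pol \<rho> ?b) (pol \<rho>' ?a))" .
    show "\<bar>?a - ?b\<bar> < pi" using ab x y alpha(2) by (auto simp: abs_if)
  qed (use x y in auto)
qed

lemma vertex_not_between:
  assumes p: "p \<in> V" and x: "x \<in> S" "x \<noteq> p" "coord p x > 0" "x \<bullet> p > 1 / sqrt (1 + rho0\<^sup>2)"
    and y: "y \<in> S" "y \<noteq> p" "coord p y > 0" "y \<bullet> p > 1 / sqrt (1 + rho0\<^sup>2)"
  shows "\<not> intrinsic_dist S x p + intrinsic_dist S p y \<le> intrinsic_dist S x y"
proof -
  obtain s where s: "s \<in> V" "coord s x = 0" using x by (auto simp: S_iff)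
  then have "p \<noteq> s" using x by auto
  obtain q r where "labelling p s q r" using labelling_ex[OF p s(1) \<open>p \<noteq> s\<close>] by metis
  then have l: "labelling p q r s" by (auto intro: labelling_perm)
  obtain \<rho> \<theta> where X: "0 < \<rho>" "\<rho> \<le> rho0" "0 \<le> \<theta>" "\<theta> \<le> alpha" "x = sector_pt p q r \<rho> \<theta>"
    by (rule sector_pt_ex[OF l x(1) s(2) x(2,4)])
  consider "coord s y = 0" | "coord q y = 0" | "coord r y = 0"
    using y S_labelling[OF l] by auto
  then show ?thesis
  proof cases
    case 1
    obtain \<rho>' \<theta>' where Y: "0 < \<rho>'" "\<rho>' \<le> rho0" "0 \<le> \<theta>'" "\<theta>' \<le> alpha" "y = sector_pt p q r \<rho>' \<theta>'"
      by (rule sector_pt_ex[OF l y(1) 1 y(2,4)])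
    show ?thesis by (rule vertex_same_sector[OF l X(5,1-4) Y(5,1-4)])
  next
    case 2
    have l': "labelling p r s q" using l by (auto intro: labelling_perm)
    obtain \<rho>' \<theta>' where Y: "0 < \<rho>'" "\<rho>' \<le> rho0" "0 \<le> \<theta>'" "\<theta>' \<le> alpha" "y = sector_pt p r s \<rho>' \<theta>'"
      by (rule sector_pt_ex[OF l' y(1) 2 y(2,4)])
    show ?thesis by (rule vertex_next_sector[OF l X(5,1-4) Y(5,1-4)])
  next
    case 3
    have l': "labelling p q s r" "labelling p r q s" using l by (auto intro: labelling_perm)
    obtain \<rho>' \<theta>' where Y: "0 < \<rho>'" "\<rho>' \<le> rho0" "0 \<le> \<theta>'" "\<theta>' \<le> alpha" "y = sector_pt p q s \<rho>' \<theta>'"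
      by (rule sector_pt_ex[OF l'(1) y(1) 3 y(2,4)])
    have "x = sector_pt p r q \<rho> (alpha - \<theta>)" using X(5) sector_pt_swap by simp
    then show ?thesis using vertex_next_sector[OF l'(2) _ X(1,2) _ _ Y(5,1-4)] X by simp
  qed
qed

end

section \<open>Geodesics are locally straight\<close>

lemma continuous_on_loop_frac:
  fixes g :: "real \<Rightarrow> 'a::topological_space"
  assumes g: "continuous_on {0..1} g" "g 1 = g 0"
  shows "continuous_on UNIV (\<lambda>t. g (frac t))"
proof -
  have piece: "continuous_on {of_int n .. of_int n + 1} (\<lambda>t. g (frac t))" for n :: int
  proof -
    have c1: "continuous_on {of_int n .. of_int n + 1} (\<lambda>t. g (t - of_int n))"
      by (rule continuous_on_compose2[OF g(1)]) (auto intro!: continuous_intros)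
    have c2: "g (frac t) = g (t - of_int n)" if "t \<in> {of_int n .. of_int n + 1}" for t :: real
    proof (cases "t = of_int n + 1")
      case True
      then show ?thesis using g(2) by (simp add: frac_def)
    next
      case False
      then have "\<lfloor>t\<rfloor> = n" using that by (intro floor_unique) auto
      then show ?thesis by (simp add: frac_def)
    qed
    show ?thesis by (rule continuous_on_eq[OF c1]) (simp add: c2)
  qed
  have "isCont (\<lambda>t. g (frac t)) t" for t
  proof -
    define n where "n = \<lfloor>t\<rfloor>"
    have "continuous_on ({of_int (n - 1) .. of_int (n - 1) + 1} \<union> {of_int n .. of_int n + 1}) (\<lambda>t. g (frac t))"
      by (intro continuous_on_closed_Un piece) auto
    moreover have "{of_int (n - 1) .. of_int (n - 1) + 1} \<union> {of_int n .. of_int n + 1 :: real} = {of_int n - 1 .. of_int n + 1}"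
      by auto
    moreover have "t \<in> interior {of_int n - 1 .. of_int n + 1 :: real}"
      unfolding n_def interior_atLeastAtMost_real greaterThanLessThan_iff by linarith
    ultimately show ?thesis by (metis continuous_on_interior)
  qed
  then show ?thesis by (simp add: continuous_at_imp_continuous_on)
qed

text \<open>A vector orthogonal to the nonzero vector product of u and v lies in their span.
  Cramer's rule is applied in the two coordinates that belong to a nonzero component of the
  product.\<close>

lemma cross_coordinates:
  fixes u1 u2 u3 v1 v2 v3 y1 y2 y3 :: real
  defines "a \<equiv> u2 * v3 - u3 * v2" and "b \<equiv> u3 * v1 - u1 * v3" and "d \<equiv> u1 * v2 - u2 * v1"
  assumes ne: "a \<noteq> 0 \<or> b \<noteq> 0 \<or> d \<noteq> 0" and y: "a * y1 + b * y2 + d * y3 = 0"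
  obtains \<alpha> \<beta> where "y1 = \<alpha> * u1 + \<beta> * v1" "y2 = \<alpha> * u2 + \<beta> * v2" "y3 = \<alpha> * u3 + \<beta> * v3"
proof -
  consider "a \<noteq> 0" | "b \<noteq> 0" | "d \<noteq> 0" using ne by blast
  then show ?thesis
  proof cases
    case 1
    define \<alpha> \<beta> where "\<alpha> = (y2 * v3 - y3 * v2) / a" and "\<beta> = (u2 * y3 - u3 * y2) / a"
    have h: "a * \<alpha> = y2 * v3 - y3 * v2" "a * \<beta> = u2 * y3 - u3 * y2" using 1 by (auto simp: \<alpha>_def \<beta>_def)
    have "a * y2 = a * (\<alpha> * u2 + \<beta> * v2)" "a * y3 = a * (\<alpha> * u3 + \<beta> * v3)"
      unfolding distrib_left mult.assoc[symmetric] h by (simp_all add: a_def algebra_simps)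
    moreover have "a * y1 = a * (\<alpha> * u1 + \<beta> * v1)"
    proof -
      have "a * y1 = - (b * y2 + d * y3)" using y by linarith
      then show ?thesis unfolding distrib_left mult.assoc[symmetric] h by (simp add: b_def d_def algebra_simps)
    qed
    ultimately show ?thesis using that 1 by auto
  next
    case 2
    define \<alpha> \<beta> where "\<alpha> = (y3 * v1 - y1 * v3) / b" and "\<beta> = (u3 * y1 - u1 * y3) / b"
    have h: "b * \<alpha> = y3 * v1 - y1 * v3" "b * \<beta> = u3 * y1 - u1 * y3" using 2 by (auto simp: \<alpha>_def \<beta>_def)
    have "b * y1 = b * (\<alpha> * u1 + \<beta> * v1)" "b * y3 = b * (\<alpha> * u3 + \<beta> * v3)"
      unfolding distrib_left mult.assoc[symmetric] h by (simp_all add: b_def algebra_simps)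
    moreover have "b * y2 = b * (\<alpha> * u2 + \<beta> * v2)"
    proof -
      have "b * y2 = - (a * y1 + d * y3)" using y by linarith
      then show ?thesis unfolding distrib_left mult.assoc[symmetric] h by (simp add: a_def d_def algebra_simps)
    qed
    ultimately show ?thesis using that 2 by auto
  next
    case 3
    define \<alpha> \<beta> where "\<alpha> = (y1 * v2 - y2 * v1) / d" and "\<beta> = (u1 * y2 - u2 * y1) / d"
    have h: "d * \<alpha> = y1 * v2 - y2 * v1" "d * \<beta> = u1 * y2 - u2 * y1" using 3 by (auto simp: \<alpha>_def \<beta>_def)
    have "d * y1 = d * (\<alpha> * u1 + \<beta> * v1)" "d * y2 = d * (\<alpha> * u2 + \<beta> * v2)"
      unfolding distrib_left mult.assoc[symmetric] h by (simp_all add: d_def algebra_simps)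
    moreover have "d * y3 = d * (\<alpha> * u3 + \<beta> * v3)"
    proof -
      have "d * y3 = - (a * y1 + b * y2)" using y by linarith
      then show ?thesis unfolding distrib_left mult.assoc[symmetric] h by (simp add: a_def b_def algebra_simps)
    qed
    ultimately show ?thesis using that 3 by auto
  qed
qed

lemma cross_zero_proportional:
  fixes u1 u2 u3 v1 v2 v3 :: real
  assumes "u2 * v3 = u3 * v2" "u3 * v1 = u1 * v3" "u1 * v2 = u2 * v1" and ne: "u1 \<noteq> 0 \<or> u2 \<noteq> 0 \<or> u3 \<noteq> 0"
  obtains t where "v1 = t * u1" "v2 = t * u2" "v3 = t * u3"
proof -
  consider "u1 \<noteq> 0" | "u2 \<noteq> 0" | "u3 \<noteq> 0" using ne by blast
  then show ?thesis
  proof cases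
    case 1 show ?thesis by (rule that[of "v1 / u1"]) (use 1 assms in \<open>auto simp: field_simps\<close>)
  next
    case 2 show ?thesis by (rule that[of "v2 / u2"]) (use 2 assms in \<open>auto simp: field_simps\<close>)
  next
    case 3 show ?thesis by (rule that[of "v3 / u3"]) (use 3 assms in \<open>auto simp: field_simps\<close>)
  qed
qed

context reg_tetra
begin

definition lin :: "real ^ 4 \<Rightarrow> real ^ 4 \<Rightarrow> real ^ 4 \<Rightarrow> real ^ 4 \<Rightarrow> real \<Rightarrow> real \<Rightarrow> real \<Rightarrow> real \<Rightarrow> real ^ 4 \<Rightarrow> real" where
  "lin p q r s a b d e y = a * coord p y + b * coord q y + d * coord r y + e * coord s y"

text \<open>Near each of its points the curve \<open>K\<close> is the intersection of the surface with a plane through the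
  origin of the developed pair of faces; \<open>d + e = k * (a + b)\<close> says that the linear form with these values
  at the vertices is compatible with the development.\<close>

definition loc_straight :: "(real ^ 4) set \<Rightarrow> bool" where
  "loc_straight K \<longleftrightarrow> (\<forall>p q r s z. labelling p q r s \<longrightarrow> z \<in> K \<longrightarrow> coord p z > 0 \<longrightarrow> coord q z > 0 \<longrightarrow> coord s z = 0 \<longrightarrow>
     (\<exists>a b d e \<epsilon>. \<epsilon> > 0 \<and> (a \<noteq> 0 \<or> b \<noteq> 0 \<or> d \<noteq> 0) \<and> d + e = k * (a + b) \<and>
        (\<forall>y\<in>S. dist y z < \<epsilon> \<longrightarrow> (y \<in> K \<longleftrightarrow> lin p q r s a b d e y = 0))))"

text \<open>The periodic extension treats the base point like any other; \<open>simple_path\<close>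
  becomes injectivity on parameters less than one period apart, and local minimality becomes
  additivity of intrinsic distances.\<close>

lemma geodesic_lift:
  assumes g: "closed_geodesic S g" "simple_path g"
  obtains \<gamma> :: "real \<Rightarrow> real ^ 4" where "continuous_on UNIV \<gamma>" "range \<gamma> = path_image g" "range \<gamma> \<subseteq> S"
    "\<forall>t. \<gamma> (t + 1) = \<gamma> t" "\<forall>s t. \<bar>s - t\<bar> < 1 \<longrightarrow> \<gamma> s = \<gamma> t \<longrightarrow> s = t"
    "\<forall>t. \<exists>e>0. \<forall>u w v. t - e \<le> u \<and> u \<le> w \<and> w \<le> v \<and> v \<le> t + e \<longrightarrow>
       intrinsic_dist S (\<gamma> u) (\<gamma> w) + intrinsic_dist S (\<gamma> w) (\<gamma> v) \<le> intrinsic_dist S (\<gamma> u) (\<gamma> v)"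
proof -
  define \<gamma> where "\<gamma> t = g (frac t)" for t
  have p: "continuous_on {0..1} g" "path_image g \<subseteq> S" "g 1 = g 0"
    using g(1) by (auto simp: closed_geodesic_def path_def pathstart_def pathfinish_def)
  have cc: "continuous_on UNIV \<gamma>" unfolding \<gamma>_def by (rule continuous_on_loop_frac[OF p(1,3)])
  have fr: "frac t \<in> {0..1}" for t :: real using frac_ge_0 frac_lt_1[of t] by (auto intro: less_imp_le)
  have im: "range \<gamma> = path_image g"
  proof
    show "range \<gamma> \<subseteq> path_image g" using fr by (auto simp: \<gamma>_def path_image_def)
    show "path_image g \<subseteq> range \<gamma>"
    proof
      fix y assume "y \<in> path_image g"
      then obtain t where t: "t \<in> {0..1}" "y = g t" by (auto simp: path_image_def)
      then have "y = \<gamma> t" using p(3) by (cases "t = 1") (auto simp: \<gamma>_def frac_eq)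
      then show "y \<in> range \<gamma>" by simp
    qed
  qed
  have per: "\<gamma> (t + 1) = \<gamma> t" for t by (simp add: \<gamma>_def frac_def)
  have inj: "s = t" if "\<bar>s - t\<bar> < 1" "\<gamma> s = \<gamma> t" for s t
  proof -
    have "frac s = frac t"
      using g(2) that(2) fr[of s] fr[of t] frac_lt_1[of s] frac_lt_1[of t]
      unfolding simple_path_def loop_free_def \<gamma>_def by fastforce
    then have eq: "s - t = of_int (\<lfloor>s\<rfloor> - \<lfloor>t\<rfloor>)" by (simp add: frac_def)
    then have "\<bar>of_int (\<lfloor>s\<rfloor> - \<lfloor>t\<rfloor>) :: real\<bar> < 1" using that(1) by simp
    then have "\<lfloor>s\<rfloor> - \<lfloor>t\<rfloor> = 0" by linarith
    then show ?thesis using eq by simp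
  qed
  have ex: "\<exists>e>0. \<forall>u w v. t - e \<le> u \<and> u \<le> w \<and> w \<le> v \<and> v \<le> t + e \<longrightarrow>
       intrinsic_dist S (\<gamma> u) (\<gamma> w) + intrinsic_dist S (\<gamma> w) (\<gamma> v) \<le> intrinsic_dist S (\<gamma> u) (\<gamma> v)" for t
  proof -
    obtain e where e: "e > 0" "shortest_on S \<gamma> (t - e) (t + e)"
      using g(1) unfolding closed_geodesic_def \<gamma>_def by blast
    have "continuous_on {t - e..t + e} \<gamma>" "\<gamma> ` {t - e..t + e} \<subseteq> S"
      using cc im p(2) by (auto intro: continuous_on_subset)
    then show ?thesis using e shortest_on_between[OF e(2) S_sphere] by blast
  qed
  show ?thesis
  proof (rule that[of \<gamma>])
    show "range \<gamma> \<subseteq> S" using im p(2) by simp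
  qed (use cc im per inj ex in auto)
qed

lemma isCont_eventually_interval:
  fixes \<gamma> :: "real \<Rightarrow> real ^ 4"
  assumes "continuous_on UNIV \<gamma>" "open U" "\<gamma> t \<in> U"
  obtains \<eta> where "\<eta> > 0" "\<And>s. \<bar>s - t\<bar> \<le> \<eta> \<Longrightarrow> \<gamma> s \<in> U"
proof -
  have "open (\<gamma> -` U)" using assms by (simp add: open_vimage)
  then obtain h where "h > 0" "cball t h \<subseteq> \<gamma> -` U" using assms(3) open_contains_cball by blast
  then show ?thesis using that[of h] by (auto simp: subset_iff dist_real_def abs_minus_commute)
qed

lemma geodesic_no_vertex:
  assumes g: "closed_geodesic S g" "simple_path g" and p: "p \<in> V"
  shows "p \<notin> path_image g"
proof
  assume "p \<in> path_image g"
  obtain \<gamma> :: "real \<Rightarrow> real ^ 4" where \<gamma>: "continuous_on UNIV \<gamma>" "range \<gamma> = path_image g" "range \<gamma> \<subseteq> S"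
    "\<forall>t. \<gamma> (t + 1) = \<gamma> t" "\<forall>s t. \<bar>s - t\<bar> < 1 \<longrightarrow> \<gamma> s = \<gamma> t \<longrightarrow> s = t"
    "\<forall>t. \<exists>e>0. \<forall>u w v. t - e \<le> u \<and> u \<le> w \<and> w \<le> v \<and> v \<le> t + e \<longrightarrow>
       intrinsic_dist S (\<gamma> u) (\<gamma> w) + intrinsic_dist S (\<gamma> w) (\<gamma> v) \<le> intrinsic_dist S (\<gamma> u) (\<gamma> v)"
    by (rule geodesic_lift[OF g])
  obtain t where t: "\<gamma> t = p" using \<open>p \<in> path_image g\<close> \<gamma>(2) by (metis rangeE)
  obtain e where e: "e > 0" "\<And>u w v. t - e \<le> u \<and> u \<le> w \<and> w \<le> v \<and> v \<le> t + e \<Longrightarrow>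
       intrinsic_dist S (\<gamma> u) (\<gamma> w) + intrinsic_dist S (\<gamma> w) (\<gamma> v) \<le> intrinsic_dist S (\<gamma> u) (\<gamma> v)"
    using \<gamma>(6) by blast
  define U where "U = {x. coord p x > 0 \<and> x \<bullet> p > 1 / sqrt (1 + rho0\<^sup>2)}"
  have "open U" unfolding U_def by (intro open_Collect_conj open_Collect_less continuous_intros)
  moreover have "1 < sqrt (1 + rho0\<^sup>2)" using rho0_pos by (intro real_less_rsqrt) simp
  then have "1 / sqrt (1 + rho0\<^sup>2) < 1" by (simp only: divide_less_eq_1_pos less_trans[OF zero_less_one])
  then have "\<gamma> t \<in> U" using t p unit_V coord_V by (simp add: U_def)
  ultimately obtain h where h: "h > 0" "\<And>s. \<bar>s - t\<bar> \<le> h \<Longrightarrow> \<gamma> s \<in> U"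
    using isCont_eventually_interval[OF \<gamma>(1)] by metis
  define m where "m = min (min e h) (1/2)"
  have m: "m > 0" "m \<le> e" "m \<le> h" "m < 1" using e h by (auto simp: m_def)
  have "\<gamma> (t - m) \<in> U" "\<gamma> (t + m) \<in> U" using h m by auto
  moreover have "\<gamma> (t - m) \<noteq> p" "\<gamma> (t + m) \<noteq> p" using \<gamma>(5)[rule_format, of "t - m" t] \<gamma>(5)[rule_format, of "t + m" t] t m by auto
  moreover have "\<gamma> (t - m) \<in> S" "\<gamma> (t + m) \<in> S" using \<gamma>(3) by auto
  ultimately have "\<not> intrinsic_dist S (\<gamma> (t - m)) p + intrinsic_dist S p (\<gamma> (t + m)) \<le> intrinsic_dist S (\<gamma> (t - m)) (\<gamma> (t + m))"
    by (intro vertex_not_between[OF p]) (auto simp: U_def)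
  then show False using e(2)[of "t - m" t "t + m"] m t by simp
qed

text \<open>Near z the intrinsic distance is the distance of developed points. Additivity therefore
  puts the developed curve into the cone of two of its points U and W, that is, on the great circle
  through them.\<close>

lemma geodesic_loc_straight:
  assumes g: "closed_geodesic S g" "simple_path g"
  shows "loc_straight (path_image g)"
  unfolding loc_straight_def
proof (intro allI impI)
  fix p q r s z assume l: "labelling p q r s" and zK: "z \<in> path_image g" and z: "coord p z > 0" "coord q z > 0" "coord s z = 0"
  obtain \<gamma> :: "real \<Rightarrow> real ^ 4" where \<gamma>: "continuous_on UNIV \<gamma>" "range \<gamma> = path_image g" "range \<gamma> \<subseteq> S"
    "\<forall>t. \<gamma> (t + 1) = \<gamma> t" "\<forall>s t. \<bar>s - t\<bar> < 1 \<longrightarrow> \<gamma> s = \<gamma> t \<longrightarrow> s = t"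
    "\<forall>t. \<exists>e>0. \<forall>u w v. t - e \<le> u \<and> u \<le> w \<and> w \<le> v \<and> v \<le> t + e \<longrightarrow>
       intrinsic_dist S (\<gamma> u) (\<gamma> w) + intrinsic_dist S (\<gamma> w) (\<gamma> v) \<le> intrinsic_dist S (\<gamma> u) (\<gamma> v)"
    by (rule geodesic_lift[OF g])
  let ?D = "dev p q r s"
  obtain t where t: "\<gamma> t = z" using zK \<gamma>(2) by (metis rangeE)
  have cS: "\<gamma> s \<in> S" for s using \<gamma>(3) by auto
  then have zS: "z \<in> S" using t by auto
  obtain e where e: "e > 0" "\<And>u w v. t - e \<le> u \<and> u \<le> w \<and> w \<le> v \<and> v \<le> t + e \<Longrightarrow>
       intrinsic_dist S (\<gamma> u) (\<gamma> w) + intrinsic_dist S (\<gamma> w) (\<gamma> v) \<le> intrinsic_dist S (\<gamma> u) (\<gamma> v)"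
    using \<gamma>(6) by blast
  obtain \<delta> where \<delta>: "\<delta> > 0" "ball z \<delta> \<subseteq> nbhd p q r s"
    and iso0: "\<forall>x y. x \<in> S \<longrightarrow> y \<in> S \<longrightarrow> x \<in> ball z \<delta> \<longrightarrow> y \<in> ball z \<delta> \<longrightarrow>
       intrinsic_dist S x y = ennreal (sdist (?D x) (?D y)) \<and> ?D x \<noteq> - ?D y"
    by (rule dev_isometry_near[OF l zS z])
  note iso = iso0[rule_format]
  have Dn: "norm (?D x) = 1" if "x \<in> S" "x \<in> ball z \<delta>" for x
    using dev_norm[OF l that(1)] nbhd_face[OF l that(1)] that \<delta>(2) by blast
  have Dinj: "x = y" if "x \<in> S" "y \<in> S" "x \<in> ball z \<delta>" "y \<in> ball z \<delta>" "?D x = ?D y" for x y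
  proof -
    have "ennreal (sdist x y) \<le> ennreal 0"
      using iso[OF that(1-4)] intrinsic_dist_ge[OF S_sphere, of x y] that(5) Dn[OF that(2,4)] by simp
    then have "sdist x y \<le> 0" using ennreal_le_iff[of 0 "sdist x y"] by simp
    moreover have u: "norm x = 1" "norm y = 1" using that by (auto simp: S_iff)
    ultimately have "sdist x y = 0" using cos_sdist(2)[OF u] by simp
    then show ?thesis using cos_sdist(1)[OF u] unit_inner_eq_1[OF u] by simp
  qed
  obtain h where h: "h > 0" "\<And>s. \<bar>s - t\<bar> \<le> h \<Longrightarrow> \<gamma> s \<in> ball z \<delta>"
    using isCont_eventually_interval[OF \<gamma>(1) open_ball[of z \<delta>]] t \<delta> by (metis centre_in_ball)
  define m where "m = min (min e h) (1/4)"
  have m: "m > 0" "m \<le> e" "m \<le> h" "m \<le> 1/4" using e h by (auto simp: m_def)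
  define A B where "A = t - m" and "B = t + m"
  have inb: "\<gamma> s \<in> ball z \<delta>" if "A \<le> s" "s \<le> B" for s using that h m by (auto simp: A_def B_def abs_le_iff)
  define U W where "U = ?D (\<gamma> A)" and "W = ?D (\<gamma> B)"
  have AB: "A \<le> t" "t \<le> B" "A \<le> B" using m by (auto simp: A_def B_def)
  have nU: "norm U = 1" "norm W = 1" using Dn[OF cS inb] AB by (auto simp: U_def W_def)
  have cAB: "\<gamma> A \<noteq> \<gamma> B" "\<gamma> A \<noteq> z" "\<gamma> B \<noteq> z"
    using \<gamma>(5)[rule_format, of A B] \<gamma>(5)[rule_format, of A t] \<gamma>(5)[rule_format, of B t] t m by (auto simp: A_def B_def)
  have UW: "U \<noteq> W" "U \<noteq> - W"
    using Dinj[OF cS cS inb inb, of A B] iso[OF cS cS inb inb, of A B] cAB AB by (auto simp: U_def W_def)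
  have cone: "\<exists>\<alpha> \<beta>. \<alpha> \<ge> 0 \<and> \<beta> \<ge> 0 \<and> ?D (\<gamma> s) = \<alpha> *\<^sub>R U + \<beta> *\<^sub>R W" if s: "A \<le> s" "s \<le> B" for s
  proof -
    have nn: "0 \<le> sdist (?D (\<gamma> x)) (?D (\<gamma> y))" if "A \<le> x" "x \<le> B" "A \<le> y" "y \<le> B" for x y
      using cos_sdist(2)[OF Dn[OF cS inb] Dn[OF cS inb]] that by simp
    have "intrinsic_dist S (\<gamma> A) (\<gamma> s) + intrinsic_dist S (\<gamma> s) (\<gamma> B) \<le> intrinsic_dist S (\<gamma> A) (\<gamma> B)"
      using s m by (intro e(2)) (auto simp: A_def B_def)
    then have "ennreal (sdist U (?D (\<gamma> s))) + ennreal (sdist (?D (\<gamma> s)) W) \<le> ennreal (sdist U W)"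
      using iso[OF cS cS inb inb, of A s] iso[OF cS cS inb inb, of s B] iso[OF cS cS inb inb, of A B] s AB
      by (simp add: U_def W_def)
    then have "ennreal (sdist U (?D (\<gamma> s)) + sdist (?D (\<gamma> s)) W) \<le> ennreal (sdist U W)"
      using nn s AB by (simp add: U_def W_def)
    then have "sdist U (?D (\<gamma> s)) + sdist (?D (\<gamma> s)) W \<le> sdist U W"
      using nn[of A B] AB by (simp add: U_def W_def ennreal_le_iff)
    then show ?thesis
      using sdist_triangle_eq[OF nU(1) Dn[OF cS inb[OF s]] nU(2) UW(2)] by metis
  qed
  define \<kappa> where "\<kappa> = U \<bullet> W"
  have \<kappa>: "1 - \<kappa>\<^sup>2 > 0"
  proof -
    have "\<kappa> \<noteq> 1" "\<kappa> \<noteq> -1" using UW unit_inner_eq_1[OF nU] unit_inner_eq_m1[OF nU] by (auto simp: \<kappa>_def)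
    moreover have "\<bar>\<kappa>\<bar> \<le> 1" using inner_unit_bounds[OF nU] by (simp add: \<kappa>_def)
    ultimately have "\<bar>\<kappa>\<bar> < 1" by linarith
    then show ?thesis by (simp add: abs_square_less_1)
  qed
  have UU: "U \<bullet> U = 1" "W \<bullet> W = 1" using nU by (auto simp: norm_eq_1)
  \<comment> \<open>\<open>ca\<close> and \<open>cb\<close> read off the two coefficients of a
    combination of U and W.\<close>
  define ca where "ca x = (x \<bullet> U - \<kappa> * (x \<bullet> W)) / (1 - \<kappa>\<^sup>2)" for x
  define cb where "cb x = (x \<bullet> W - \<kappa> * (x \<bullet> U)) / (1 - \<kappa>\<^sup>2)" for x
  have cab: "ca (\<alpha> *\<^sub>R U + \<beta> *\<^sub>R W) = \<alpha>" "cb (\<alpha> *\<^sub>R U + \<beta> *\<^sub>R W) = \<beta>" for \<alpha> \<beta>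
  proof -
    have i: "(\<alpha> *\<^sub>R U + \<beta> *\<^sub>R W) \<bullet> U = \<alpha> + \<beta> * \<kappa>" "(\<alpha> *\<^sub>R U + \<beta> *\<^sub>R W) \<bullet> W = \<alpha> * \<kappa> + \<beta>"
      by (simp_all add: inner_add_left UU \<kappa>_def inner_commute[of W U])
    have "\<alpha> + \<beta> * \<kappa> - \<kappa> * (\<alpha> * \<kappa> + \<beta>) = \<alpha> * (1 - \<kappa>\<^sup>2)" "\<alpha> * \<kappa> + \<beta> - \<kappa> * (\<alpha> + \<beta> * \<kappa>) = \<beta> * (1 - \<kappa>\<^sup>2)"
      by (simp_all add: algebra_simps power2_eq_square)
    then show "ca (\<alpha> *\<^sub>R U + \<beta> *\<^sub>R W) = \<alpha>" "cb (\<alpha> *\<^sub>R U + \<beta> *\<^sub>R W) = \<beta>"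
      unfolding ca_def cb_def i using \<kappa> by simp_all
  qed
  have cacont: "continuous_on X (\<lambda>x. ca (f x))" "continuous_on X (\<lambda>x. cb (f x))" if "continuous_on X f" for X and f :: "'x::topological_space \<Rightarrow> real ^ 4"
    unfolding ca_def cb_def by (intro continuous_intros that; use \<kappa> in auto)+
  have czero: "coord s U = 0" "coord s W = 0" by (auto simp: U_def W_def dev_coord[OF l])
  \<comment> \<open>The vector product of U and W in the coordinates of the face, so the form that
    vanishes on both; \<open>e'\<close> is its value at the developed vertex s.\<close>
  define a b d where "a = coord q U * coord r W - coord r U * coord q W" and "b = coord r U * coord p W - coord p U * coord r W"
    and "d = coord p U * coord q W - coord q U * coord p W"
  define e' where "e' = k * (a + b) - d"
  have linD: "lin p q r s a b d e' y = a * coord p (?D y) + b * coord q (?D y) + d * coord r (?D y)" for y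
    unfolding lin_def dev_coord[OF l] e'_def by (simp add: algebra_simps)
  have ne: "a \<noteq> 0 \<or> b \<noteq> 0 \<or> d \<noteq> 0"
  proof (rule ccontr)
    assume "\<not> ?thesis"
    then have z0: "coord q U * coord r W = coord r U * coord q W" "coord r U * coord p W = coord p U * coord r W" "coord p U * coord q W = coord q U * coord p W"
      by (auto simp: a_def b_def d_def)
    have "coord p U \<noteq> 0 \<or> coord q U \<noteq> 0 \<or> coord r U \<noteq> 0"
      using labelling_expand[OF l, of U] czero nU by auto
    then obtain x where "coord p W = x * coord p U" "coord q W = x * coord q U" "coord r W = x * coord r U"
      using cross_zero_proportional[OF z0] by blast
    then have W: "W = x *\<^sub>R U" using czero by (intro coord_eq_imp_eq[OF l]) (auto simp: coord_scale)
    then have "\<bar>x\<bar> = 1" using nU by simp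
    then show False using W UW by (auto simp: abs_if split: if_splits)
  qed
  have Dz: "ca (?D z) > 0" "cb (?D z) > 0"
  proof -
    obtain \<alpha> \<beta> where ab: "\<alpha> \<ge> 0" "\<beta> \<ge> 0" "?D z = \<alpha> *\<^sub>R U + \<beta> *\<^sub>R W" using cone[OF AB(1,2)] t by auto
    have zb: "z \<in> ball z \<delta>" using \<delta> by simp
    have "\<alpha> \<noteq> 0"
    proof
      assume "\<alpha> = 0"
      then have "\<bar>\<beta>\<bar> = 1" using ab(3) nU Dn[OF zS zb] by simp
      then have "?D z = ?D (\<gamma> B)" using ab \<open>\<alpha> = 0\<close> by (simp add: W_def)
      then show False using Dinj[OF zS cS zb inb, of B] AB cAB by auto
    qed
    moreover have "\<beta> \<noteq> 0"
    proof
      assume "\<beta> = 0"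
      then have "\<bar>\<alpha>\<bar> = 1" using ab(3) nU Dn[OF zS zb] by simp
      then have "?D z = ?D (\<gamma> A)" using ab \<open>\<beta> = 0\<close> by (simp add: U_def)
      then show False using Dinj[OF zS cS zb inb, of A] AB cAB by auto
    qed
    ultimately show "ca (?D z) > 0" "cb (?D z) > 0" unfolding ab(3) cab using ab by auto
  qed
  \<comment> \<open>Removing the image of the rest of the period is where simplicity enters: no
    other part of the curve comes near z.\<close>
  define N where "N = {y. ca (?D y) > 0} \<inter> {y. cb (?D y) > 0} \<inter> ball z \<delta> \<inter> - (\<gamma> ` {t + m .. t + 1 - m})"
  have "open N" unfolding N_def
  proof (intro open_Int open_ball open_Compl)
    show "open {y. ca (?D y) > 0}" "open {y. cb (?D y) > 0}"
      by (intro open_Collect_less continuous_intros cacont)+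
    show "closed (\<gamma> ` {t + m .. t + 1 - m})"
      by (intro compact_imp_closed compact_continuous_image continuous_on_subset[OF \<gamma>(1)]) auto
  qed
  moreover have "z \<in> N"
  proof -
    have "z \<noteq> \<gamma> s" if "s \<in> {t + m .. t + 1 - m}" for s
      using \<gamma>(5)[rule_format, of s t] t that m by auto
    then have "z \<notin> \<gamma> ` {t + m .. t + 1 - m}" by blast
    then show ?thesis using Dz \<delta> unfolding N_def by simp
  qed
  ultimately obtain \<epsilon> where \<epsilon>: "\<epsilon> > 0" "ball z \<epsilon> \<subseteq> N" using openE by blast
  have main: "y \<in> path_image g \<longleftrightarrow> lin p q r s a b d e' y = 0" if yS: "y \<in> S" and yd: "dist y z < \<epsilon>" for y
  proof
    have yN: "y \<in> N" using \<epsilon> yd by (auto simp: dist_commute subset_iff)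
    assume "y \<in> path_image g"
    then obtain s0 where s0: "y = \<gamma> s0" using \<gamma>(2) by (metis rangeE)
    define n where "n = \<lfloor>s0 - (t - m)\<rfloor>"
    define s1 where "s1 = s0 - of_int n"
    have s1: "t - m \<le> s1" "s1 < t - m + 1" by (auto simp: s1_def n_def) linarith+
    have peri: "\<gamma> (x + of_int j) = \<gamma> x" for x and j :: int
    proof (induction j rule: int_induct[where k = 0])
      case (step1 i) then show ?case using \<gamma>(4)[rule_format, of "x + of_int i"] by (simp add: add.assoc)
    next
      case (step2 i) then show ?case using \<gamma>(4)[rule_format, of "x + of_int i - 1"] by (simp add: algebra_simps)
    qed auto
    have y1: "y = \<gamma> s1" using peri[of s1 n] s0 by (simp add: s1_def)
    have "s1 \<notin> {t + m .. t + 1 - m}" using yN y1 by (auto simp: N_def)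
    then have "A \<le> s1" "s1 \<le> B" using s1 by (auto simp: A_def B_def)
    then obtain \<alpha> \<beta> where "?D y = \<alpha> *\<^sub>R U + \<beta> *\<^sub>R W" using cone y1 by blast
    then show "lin p q r s a b d e' y = 0"
      unfolding linD by (simp add: coord_add coord_scale a_def b_def d_def algebra_simps)
  next
    have yN: "y \<in> N" using \<epsilon> yd by (auto simp: dist_commute subset_iff)
    then have yb: "y \<in> ball z \<delta>" and pos: "ca (?D y) > 0" "cb (?D y) > 0" by (auto simp: N_def)
    assume "lin p q r s a b d e' y = 0"
    then have l0: "a * coord p (?D y) + b * coord q (?D y) + d * coord r (?D y) = 0" by (simp add: linD)
    obtain \<alpha> \<beta> where ab: "coord p (?D y) = \<alpha> * coord p U + \<beta> * coord p W" "coord q (?D y) = \<alpha> * coord q U + \<beta> * coord q W"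
      "coord r (?D y) = \<alpha> * coord r U + \<beta> * coord r W"
      using cross_coordinates[OF ne[unfolded a_def b_def d_def] l0[unfolded a_def b_def d_def]] by blast
    have Dy: "?D y = \<alpha> *\<^sub>R U + \<beta> *\<^sub>R W"
      using ab czero dev_coord(4)[OF l, of y] by (intro coord_eq_imp_eq[OF l]) (auto simp: coord_add coord_scale)
    then have \<alpha>\<beta>: "\<alpha> > 0" "\<beta> > 0" using pos cab by auto
    \<comment> \<open>The developed curve runs from U to W inside their cone, so it meets the ray of
      \<open>?D y\<close> where f vanishes. Unit norms and injectivity of the development then make
      the point found equal to y.\<close>
    define f where "f s = ca (?D (\<gamma> s)) * \<beta> - cb (?D (\<gamma> s)) * \<alpha>" for s
    have "continuous_on {A..B} f" unfolding f_def
      by (intro continuous_intros cacont continuous_on_subset[OF \<gamma>(1)]) auto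
    moreover have "f A = \<beta>" "f B = - \<alpha>"
      using cab[of 1 0] cab[of 0 1] by (simp_all add: f_def U_def[symmetric] W_def[symmetric])
    ultimately obtain s where s: "A \<le> s" "s \<le> B" "f s = 0"
      using IVT2'[of f B 0 A] \<alpha>\<beta> AB by auto
    obtain \<alpha>' \<beta>' where ab': "\<alpha>' \<ge> 0" "\<beta>' \<ge> 0" "?D (\<gamma> s) = \<alpha>' *\<^sub>R U + \<beta>' *\<^sub>R W" using cone s by blast
    then have "\<alpha>' * \<beta> = \<beta>' * \<alpha>" using s(3) cab by (simp add: f_def)
    then have "\<beta>' = (\<alpha>' / \<alpha>) * \<beta>" "\<alpha>' = (\<alpha>' / \<alpha>) * \<alpha>" using \<alpha>\<beta> by (auto simp: field_simps)
    then have eq: "?D (\<gamma> s) = (\<alpha>' / \<alpha>) *\<^sub>R ?D y" unfolding ab'(3) Dy by (metis scaleR_add_right scaleR_scaleR)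
    have "norm (?D (\<gamma> s)) = \<bar>\<alpha>' / \<alpha>\<bar> * norm (?D y)" by (simp only: eq norm_scaleR)
    then have "\<bar>\<alpha>' / \<alpha>\<bar> = 1" using Dn[OF cS inb[OF s(1,2)]] Dn[OF yS yb] by (simp only: mult_1_right)
    moreover have "0 \<le> \<alpha>' / \<alpha>" using ab' \<alpha>\<beta> by simp
    ultimately have "\<alpha>' / \<alpha> = 1" by (simp only: abs_of_nonneg)
    then have "?D (\<gamma> s) = ?D y" using eq by simp
    then have "\<gamma> s = y" using Dinj[OF cS yS inb[OF s(1,2)] yb] by simp
    then show "y \<in> path_image g" using \<gamma>(2) by auto
  qed
  show "\<exists>a b d e \<epsilon>. \<epsilon> > 0 \<and> (a \<noteq> 0 \<or> b \<noteq> 0 \<or> d \<noteq> 0) \<and> d + e = k * (a + b) \<and>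
        (\<forall>y\<in>S. dist y z < \<epsilon> \<longrightarrow> (y \<in> path_image g \<longleftrightarrow> lin p q r s a b d e y = 0))"
    using \<epsilon>(1) ne main by (intro exI[of _ a] exI[of _ b] exI[of _ d] exI[of _ e'] exI[of _ \<epsilon>]) (auto simp: e'_def)
qed

end

section \<open>Arcs in a face\<close>

lemma cross_orthogonal:
  fixes u1 u2 u3 v1 v2 v3 a b d :: real
  defines "n1 \<equiv> u2 * v3 - u3 * v2" and "n2 \<equiv> u3 * v1 - u1 * v3" and "n3 \<equiv> u1 * v2 - u2 * v1"
  assumes ne: "n1 \<noteq> 0 \<or> n2 \<noteq> 0 \<or> n3 \<noteq> 0"
    and u: "a * u1 + b * u2 + d * u3 = 0" and v: "a * v1 + b * v2 + d * v3 = 0"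
  obtains t where "a = t * n1" "b = t * n2" "d = t * n3"
proof -
  have 1: "a * n2 = b * n1"
  proof -
    have "a * n2 - b * n1 = u3 * (a * v1 + b * v2) - v3 * (a * u1 + b * u2)" by (simp add: n1_def n2_def algebra_simps)
    also have "a * v1 + b * v2 = - (d * v3)" using v by linarith
    also have "a * u1 + b * u2 = - (d * u3)" using u by linarith
    finally show ?thesis by simp
  qed
  have 2: "b * n3 = d * n2"
  proof -
    have "b * n3 - d * n2 = u1 * (b * v2 + d * v3) - v1 * (b * u2 + d * u3)" by (simp add: n3_def n2_def algebra_simps)
    also have "b * v2 + d * v3 = - (a * v1)" using v by linarith
    also have "b * u2 + d * u3 = - (a * u1)" using u by linarith
    finally show ?thesis by simp
  qed
  have 3: "d * n1 = a * n3"
  proof -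
    have "d * n1 - a * n3 = u2 * (d * v3 + a * v1) - v2 * (d * u3 + a * u1)" by (simp add: n3_def n1_def algebra_simps)
    also have "d * v3 + a * v1 = - (b * v2)" using v by linarith
    also have "d * u3 + a * u1 = - (b * u2)" using u by linarith
    finally show ?thesis by simp
  qed
  consider "n1 \<noteq> 0" | "n2 \<noteq> 0" | "n3 \<noteq> 0" using ne by blast
  then show ?thesis
  proof cases
    case 1 show ?thesis by (rule that[of "a / n1"]) (use 1 \<open>a * n2 = b * n1\<close> \<open>d * n1 = a * n3\<close> in \<open>auto simp: field_simps\<close>)
  next
    case 2 show ?thesis by (rule that[of "b / n2"]) (use 2 \<open>a * n2 = b * n1\<close> \<open>b * n3 = d * n2\<close> in \<open>auto simp: field_simps\<close>)
  next
    case 3 show ?thesis by (rule that[of "d / n3"]) (use 3 \<open>b * n3 = d * n2\<close> \<open>d * n1 = a * n3\<close> in \<open>auto simp: field_simps\<close>)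
  qed
qed

text \<open>With these signs the zero set of the form in a face joins interior points of two edges
  and misses the vertices.\<close>

definition mixed :: "real \<Rightarrow> real \<Rightarrow> real \<Rightarrow> bool" where
  "mixed a b d \<longleftrightarrow> a \<noteq> 0 \<and> b \<noteq> 0 \<and> d \<noteq> 0 \<and> \<not> (a > 0 \<and> b > 0 \<and> d > 0) \<and> \<not> (a < 0 \<and> b < 0 \<and> d < 0)"

context reg_tetra
begin

text \<open>Finiteness is proved for these point sets. Connectedness and closedness replace the
  parametrization: local information is propagated along them.\<close>

definition geodesic_set :: "(real ^ 4) set \<Rightarrow> bool" where
  "geodesic_set K \<longleftrightarrow> closed K \<and> connected K \<and> K \<subseteq> S \<and> K \<noteq> {} \<and> V \<inter> K = {} \<and> loc_straight K"

lemma geodesic_set_geodesic: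
  assumes "closed_geodesic S g" "simple_path g"
  shows "geodesic_set (path_image g)"
  using assms geodesic_no_vertex[OF assms] geodesic_loc_straight[OF assms]
    connected_path_image[of g] compact_path_image[of g]
  by (auto simp: geodesic_set_def closed_geodesic_def compact_imp_closed path_image_nonempty)

lemma V_in_S: "p \<in> V \<Longrightarrow> p \<in> S"
  using card_V finite_V unfolding S_iff
  by (auto simp: coord_V norm_eq_1 unit_V) (metis card_le_Suc0_iff_eq coord_V numeral_le_one_iff One_nat_def semiring_norm(69))

definition arc_of :: "real ^ 4 \<Rightarrow> real ^ 4 \<Rightarrow> real ^ 4 \<Rightarrow> real ^ 4 \<Rightarrow> real \<Rightarrow> real \<Rightarrow> real \<Rightarrow> (real ^ 4) set" where
  "arc_of p q r s a b d = {y \<in> S. coord s y = 0 \<and> a * coord p y + b * coord q y + d * coord r y = 0}"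

lemma arc_of_perm: "arc_of p q r s a b d = arc_of q p r s b a d" "arc_of p q r s a b d = arc_of p r q s a d b"
  by (auto simp: arc_of_def algebra_simps)

lemma arc_of_scale: "t \<noteq> 0 \<Longrightarrow> arc_of p q r s (t * a) (t * b) (t * d) = arc_of p q r s a b d"
proof -
  assume "t \<noteq> 0"
  moreover have "t * a * coord p y + t * b * coord q y + t * d * coord r y = t * (a * coord p y + b * coord q y + d * coord r y)" for y
    by (simp add: algebra_simps)
  ultimately show ?thesis by (simp add: arc_of_def)
qed

lemma normalize_face:
  assumes l: "labelling p q r s" and nn: "x \<ge> 0" "y \<ge> 0" "z \<ge> 0" and ne: "x \<noteq> 0 \<or> y \<noteq> 0 \<or> z \<noteq> 0"
  obtains t v where "t > 0" "v \<in> S" "coord p v = t * x" "coord q v = t * y" "coord r v = t * z" "coord s v = 0"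
proof -
  define u where "u = x *\<^sub>R p + y *\<^sub>R q + z *\<^sub>R r"
  have cu: "coord p u = x" "coord q u = y" "coord r u = z" "coord s u = 0" by (simp_all add: u_def coord_add coord_scale labelling_coord[OF l])
  have "u \<noteq> 0" using ne cu linear_0[OF linear_coord] by auto
  then have n: "norm u > 0" by simp
  define v where "v = (1 / norm u) *\<^sub>R u"
  have "norm v = 1" using n by (simp add: v_def)
  then have "v \<in> S" unfolding S_labelling[OF l] using cu nn n by (simp add: v_def coord_scale)
  then show ?thesis using that[of "1 / norm u" v] n cu by (simp add: v_def coord_scale)
qed

text \<open>The arc is the radial projection of a convex set, the part of the plane in the triangle
  where the coordinates have sum 1.\<close>

lemma connected_arc_of:
  assumes l: "labelling p q r s"
  shows "connected (arc_of p q r s a b d)"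
proof -
  define C where "C = {x. coord p x \<ge> 0 \<and> coord q x \<ge> 0 \<and> coord r x \<ge> 0 \<and> coord s x = 0 \<and> coord p x + coord q x + coord r x = 1 \<and>
    a * coord p x + b * coord q x + d * coord r x = 0}"
  have "convex C" unfolding convex_def
  proof (intro ballI allI impI)
    fix x y and u v :: real assume xy: "x \<in> C" "y \<in> C" and uv: "u \<ge> 0" "v \<ge> 0" "u + v = 1"
    have "coord p (u *\<^sub>R x + v *\<^sub>R y) + coord q (u *\<^sub>R x + v *\<^sub>R y) + coord r (u *\<^sub>R x + v *\<^sub>R y) =
        u * (coord p x + coord q x + coord r x) + v * (coord p y + coord q y + coord r y)"
      "a * coord p (u *\<^sub>R x + v *\<^sub>R y) + b * coord q (u *\<^sub>R x + v *\<^sub>R y) + d * coord r (u *\<^sub>R x + v *\<^sub>R y) =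
        u * (a * coord p x + b * coord q x + d * coord r x) + v * (a * coord p y + b * coord q y + d * coord r y)"
      by (simp_all add: coord_add coord_scale algebra_simps)
    then show "u *\<^sub>R x + v *\<^sub>R y \<in> C" using xy uv by (simp add: C_def) (simp add: coord_add coord_scale)
  qed
  then have "connected C" by (rule convex_connected)
  have nz: "x \<noteq> 0" if "x \<in> C" for x using that linear_0[OF linear_coord] by (auto simp: C_def)
  have "arc_of p q r s a b d = (\<lambda>x. (1 / norm x) *\<^sub>R x) ` C"
  proof
    show "(\<lambda>x. (1 / norm x) *\<^sub>R x) ` C \<subseteq> arc_of p q r s a b d"
    proof
      fix y assume "y \<in> (\<lambda>x. (1 / norm x) *\<^sub>R x) ` C"
      then obtain x where x: "x \<in> C" "y = (1 / norm x) *\<^sub>R x" by auto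
      have n: "norm x > 0" using nz x by simp
      have "a * coord p y + b * coord q y + d * coord r y = (1 / norm x) * (a * coord p x + b * coord q x + d * coord r x)"
        by (simp add: x(2) coord_scale distrib_left)
      then show "y \<in> arc_of p q r s a b d"
        unfolding arc_of_def mem_Collect_eq S_labelling[OF l] using x n by (simp add: C_def coord_scale)
    qed
    show "arc_of p q r s a b d \<subseteq> (\<lambda>x. (1 / norm x) *\<^sub>R x) ` C"
    proof
      fix y assume y: "y \<in> arc_of p q r s a b d"
      then have y': "coord p y \<ge> 0" "coord q y \<ge> 0" "coord r y \<ge> 0" "coord s y = 0" "norm y = 1"
        unfolding arc_of_def S_labelling[OF l] by auto
      define m where "m = coord p y + coord q y + coord r y"
      have "m \<noteq> 0"
      proof
        assume "m = 0"
        then have "coord p y = 0" "coord q y = 0" "coord r y = 0" using y' by (auto simp: m_def add_nonneg_eq_0_iff)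
        then have "y = 0" using labelling_expand[OF l, of y] y' by simp
        then show False using y' by simp
      qed
      then have m: "m > 0" using y' by (simp add: m_def)
      define x where "x = (1 / m) *\<^sub>R y"
      have "coord p x + coord q x + coord r x = 1" using m by (simp add: x_def coord_scale m_def add_divide_distrib[symmetric])
      moreover have "a * coord p x + b * coord q x + d * coord r x = (1 / m) * (a * coord p y + b * coord q y + d * coord r y)"
        by (simp add: x_def coord_scale distrib_left)
      ultimately have "x \<in> C" using y y' m by (simp add: C_def arc_of_def) (simp add: x_def coord_scale)
      moreover have "y = (1 / norm x) *\<^sub>R x" using m y' by (simp add: x_def)
      ultimately show "y \<in> (\<lambda>x. (1 / norm x) *\<^sub>R x) ` C" by blast
    qed
  qed
  moreover have "continuous_on C (\<lambda>x. (1 / norm x) *\<^sub>R x)"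
    by (intro continuous_intros) (use nz in auto)
  ultimately show ?thesis using \<open>connected C\<close> by (simp add: connected_continuous_image)
qed

text \<open>Distinct points of the surface are never antipodal, hence linearly independent. Every
  form vanishing on both is a multiple of their vector product.\<close>

lemma two_points_functional:
  assumes l: "labelling p q r s" and y: "y \<in> arc_of p q r s a b d" "y \<in> arc_of p q r s a' b' d'"
    and y': "y' \<in> arc_of p q r s a b d" "y' \<in> arc_of p q r s a' b' d'" and ne: "y \<noteq> y'"
    and nz: "a \<noteq> 0 \<or> b \<noteq> 0 \<or> d \<noteq> 0" "a' \<noteq> 0 \<or> b' \<noteq> 0 \<or> d' \<noteq> 0"
  obtains t where "t \<noteq> 0" "a' = t * a" "b' = t * b" "d' = t * d"
proof -
  let ?u1 = "coord p y" and ?u2 = "coord q y" and ?u3 = "coord r y"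
  let ?v1 = "coord p y'" and ?v2 = "coord q y'" and ?v3 = "coord r y'"
  have S: "y \<in> S" "y' \<in> S" "coord s y = 0" "coord s y' = 0" using y y' by (auto simp: arc_of_def)
  have n: "?u2 * ?v3 - ?u3 * ?v2 \<noteq> 0 \<or> ?u3 * ?v1 - ?u1 * ?v3 \<noteq> 0 \<or> ?u1 * ?v2 - ?u2 * ?v1 \<noteq> 0"
  proof (rule ccontr)
    assume "\<not> ?thesis"
    then have z0: "?u2 * ?v3 = ?u3 * ?v2" "?u3 * ?v1 = ?u1 * ?v3" "?u1 * ?v2 = ?u2 * ?v1" by auto
    have "?u1 \<noteq> 0 \<or> ?u2 \<noteq> 0 \<or> ?u3 \<noteq> 0" using labelling_expand[OF l, of y] S by (auto simp: S_iff)
    then obtain t where "?v1 = t * ?u1" "?v2 = t * ?u2" "?v3 = t * ?u3"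
      using cross_zero_proportional[OF z0] by blast
    then have W: "y' = t *\<^sub>R y" using S by (intro coord_eq_imp_eq[OF l]) (auto simp: coord_scale)
    then have "\<bar>t\<bar> = 1" using S by (simp add: S_iff)
    then show False using W ne face_not_antipodal[OF S(1,2)] by (auto simp: abs_if split: if_splits)
  qed
  obtain t where t: "a = t * (?u2 * ?v3 - ?u3 * ?v2)" "b = t * (?u3 * ?v1 - ?u1 * ?v3)" "d = t * (?u1 * ?v2 - ?u2 * ?v1)"
    by (rule cross_orthogonal[OF n, of a b d]) (use y y' in \<open>auto simp: arc_of_def\<close>)
  obtain t' where t': "a' = t' * (?u2 * ?v3 - ?u3 * ?v2)" "b' = t' * (?u3 * ?v1 - ?u1 * ?v3)" "d' = t' * (?u1 * ?v2 - ?u2 * ?v1)"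
    by (rule cross_orthogonal[OF n, of a' b' d']) (use y y' in \<open>auto simp: arc_of_def\<close>)
  have "t \<noteq> 0" "t' \<noteq> 0" using t t' nz by auto
  then show ?thesis using that[of "t' / t"] t t' by simp
qed

lemma arc_of_near:
  assumes l: "labelling p q r s" and y: "y \<in> arc_of p q r s a b d" and two: "\<And>x. arc_of p q r s a b d \<noteq> {x}" and e: "\<epsilon> > 0"
  obtains y' where "y' \<in> arc_of p q r s a b d" "y' \<noteq> y" "dist y' y < \<epsilon>"
  using connected_imp_perfect[OF connected_arc_of[OF l] y two] e unfolding islimpt_approachable by blast

lemma geodesic_set_face:
  assumes K: "geodesic_set K" and l: "labelling p q r s" and z: "z \<in> K" "coord s z = 0"
  obtains a b d \<epsilon> where "\<epsilon> > 0" "a \<noteq> 0 \<or> b \<noteq> 0 \<or> d \<noteq> 0" "z \<in> arc_of p q r s a b d"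
    "\<And>y. y \<in> S \<Longrightarrow> coord s y = 0 \<Longrightarrow> dist y z < \<epsilon> \<Longrightarrow> y \<in> K \<longleftrightarrow> y \<in> arc_of p q r s a b d"
proof -
  note goal = that
  have zS: "z \<in> S" "z \<notin> V" and ls: "loc_straight K" using K z by (auto simp: geodesic_set_def)
  have *: thesis if l': "labelling p' q' r' s" and pos: "coord p' z > 0" "coord q' z > 0"
    and perm: "\<And>a b d. \<exists>a' b' d'. arc_of p' q' r' s a b d = arc_of p q r s a' b' d' \<and>
       (a \<noteq> 0 \<or> b \<noteq> 0 \<or> d \<noteq> 0 \<longrightarrow> a' \<noteq> 0 \<or> b' \<noteq> 0 \<or> d' \<noteq> 0)" for p' q' r'
  proof -
    obtain a b d e \<epsilon> where h: "\<epsilon> > 0" "a \<noteq> 0 \<or> b \<noteq> 0 \<or> d \<noteq> 0"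
      "\<forall>y\<in>S. dist y z < \<epsilon> \<longrightarrow> (y \<in> K \<longleftrightarrow> lin p' q' r' s a b d e y = 0)"
      using ls l' z pos unfolding loc_straight_def by metis
    have h2: "y \<in> K \<longleftrightarrow> y \<in> arc_of p' q' r' s a b d" if "y \<in> S" "coord s y = 0" "dist y z < \<epsilon>" for y
      using h(3) that by (auto simp: arc_of_def lin_def)
    have h3: "z \<in> arc_of p' q' r' s a b d" using h2[of z] zS z h(1) by auto
    obtain a' b' d' where "arc_of p' q' r' s a b d = arc_of p q r s a' b' d'" "a' \<noteq> 0 \<or> b' \<noteq> 0 \<or> d' \<noteq> 0"
      using perm h(2) by metis
    then show thesis using goal[of \<epsilon> a' b' d'] h(1) h2 h3 by auto
  qed
  have nn: "coord p z \<ge> 0" "coord q z \<ge> 0" "coord r z \<ge> 0" using zS S_labelling[OF l] by auto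
  have V1: "\<not> (coord v z = 0 \<and> coord w z = 0)" if lv: "labelling u v w s" for u v w
  proof
    assume a: "coord v z = 0 \<and> coord w z = 0"
    then have zu: "z = coord u z *\<^sub>R u" using labelling_expand[OF lv, of z] z by simp
    moreover have "norm u = 1" "norm z = 1" using labelling_inner[OF lv] zS by (auto simp: norm_eq_1 S_iff)
    moreover have "coord u z \<ge> 0" using zS S_labelling[OF lv] by auto
    ultimately have "coord u z = 1" by (metis abs_of_nonneg mult_1_right norm_scaleR)
    then show False using zu zS labelling_in[OF lv] by auto
  qed
  have l2: "labelling p r q s" "labelling q r p s" "labelling r p q s" "labelling q p r s" using l by (auto intro: labelling_perm)
  consider "coord p z > 0" "coord q z > 0" | "coord p z > 0" "coord r z > 0" | "coord q z > 0" "coord r z > 0"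
    using V1[OF l] V1[OF l2(3)] V1[OF l2(4)] nn by linarith
  then show ?thesis
  proof cases
    case 1 show ?thesis by (rule *[OF l 1]) blast
  next
    case 2 show ?thesis by (rule *[OF l2(1) 2]) (metis arc_of_perm)
  next
    case 3 show ?thesis by (rule *[OF l2(2) 3]) (metis arc_of_perm)
  qed
qed

text \<open>Being contained in K near a point is locally constant along the arc. Near a point of K
  the set K is a single arc, and sharing two points with it means coinciding with it; near a point
  outside the closed set K the property fails throughout.\<close>

lemma arc_extends:
  assumes K: "geodesic_set K" and l: "labelling p q r s" and nz: "a \<noteq> 0 \<or> b \<noteq> 0 \<or> d \<noteq> 0"
    and z: "z \<in> arc_of p q r s a b d" and e: "\<epsilon> > 0"
    and near: "\<And>y. y \<in> arc_of p q r s a b d \<Longrightarrow> dist y z < \<epsilon> \<Longrightarrow> y \<in> K"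
  shows "arc_of p q r s a b d \<subseteq> K"
proof (cases "\<exists>x. arc_of p q r s a b d = {x}")
  case True
  then show ?thesis using near z e by force
next
  case False
  let ?A = "arc_of p q r s a b d"
  have two: "\<And>x. ?A \<noteq> {x}" using False by blast
  define P where "P x \<longleftrightarrow> (\<exists>\<epsilon>>0. \<forall>y\<in>?A. dist y x < \<epsilon> \<longrightarrow> y \<in> K)" for x
  have PK: "x \<in> K" if "P x" "x \<in> ?A" for x using that by (auto simp: P_def)
  have "P w" if w: "w \<in> ?A" for w
  proof (rule connected_induction_simple[OF connected_arc_of[OF l] z w])
    show "P z" using near e by (auto simp: P_def)
    fix x assume x: "x \<in> ?A"
    show "\<exists>T. openin (top_of_set ?A) T \<and> x \<in> T \<and> (\<forall>y\<in>T. \<forall>y'\<in>T. P y \<longrightarrow> P y')"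
    proof (cases "x \<in> K")
      case False
      have "closed K" using K by (simp add: geodesic_set_def)
      then have "openin (top_of_set ?A) (?A \<inter> - K)" by (intro openin_open_Int) auto
      then show ?thesis using False x PK by (intro exI[of _ "?A \<inter> - K"]) auto
    next
      case True
      have xs: "coord s x = 0" "x \<in> S" using x by (auto simp: arc_of_def)
      obtain a' b' d' \<delta> where h: "\<delta> > 0" "a' \<noteq> 0 \<or> b' \<noteq> 0 \<or> d' \<noteq> 0" "x \<in> arc_of p q r s a' b' d'"
        "\<And>y. y \<in> S \<Longrightarrow> coord s y = 0 \<Longrightarrow> dist y x < \<delta> \<Longrightarrow> y \<in> K \<longleftrightarrow> y \<in> arc_of p q r s a' b' d'"
        by (rule geodesic_set_face[OF K l True xs(1)]) blast
      have op: "openin (top_of_set ?A) (?A \<inter> ball x \<delta>)" by (intro openin_open_Int) auto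
      have PP: "P y'" if yy: "y \<in> ?A" "dist x y < \<delta>" "y' \<in> ?A" "dist x y' < \<delta>" "P y" for y y'
      proof -
        obtain \<epsilon>1 where e1: "\<epsilon>1 > 0" "\<And>v. v \<in> ?A \<Longrightarrow> dist v y < \<epsilon>1 \<Longrightarrow> v \<in> K" using yy by (auto simp: P_def)
        define \<epsilon>2 where "\<epsilon>2 = min \<epsilon>1 (\<delta> - dist x y)"
        have e2: "\<epsilon>2 > 0" "\<epsilon>2 \<le> \<epsilon>1" "\<epsilon>2 \<le> \<delta> - dist x y" using e1 yy by (auto simp: \<epsilon>2_def)
        obtain v where v: "v \<in> ?A" "v \<noteq> y" "dist v y < \<epsilon>2" using arc_of_near[OF l yy(1) two e2(1)] by blast
        have "dist v x < \<delta>" using v e2 dist_triangle[of v x y] by (simp add: dist_commute)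
        moreover have "v \<in> S" "coord s v = 0" "y \<in> S" "coord s y = 0" using v yy by (auto simp: arc_of_def)
        moreover have "v \<in> K" "y \<in> K" using e1 e2 v yy by auto
        ultimately have "v \<in> arc_of p q r s a' b' d'" "y \<in> arc_of p q r s a' b' d'"
          using h(4)[of v] h(4)[of y] yy by (auto simp: dist_commute)
        then obtain t where "t \<noteq> 0" "a' = t * a" "b' = t * b" "d' = t * d"
          using two_points_functional[OF l v(1) _ yy(1) _ v(2) nz h(2)] by blast
        then have eq: "arc_of p q r s a' b' d' = ?A" using arc_of_scale by simp
        show "P y'" unfolding P_def
        proof (intro exI[of _ "\<delta> - dist x y'"] conjI ballI impI)
          show "\<delta> - dist x y' > 0" using yy by simp
          fix v' assume v': "v' \<in> ?A" "dist v' y' < \<delta> - dist x y'"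
          then have "dist v' x < \<delta>" using dist_triangle[of v' x y'] by (simp add: dist_commute)
          then show "v' \<in> K" using h(4)[of v'] v' eq by (auto simp: arc_of_def)
        qed
      qed
      show ?thesis
      proof (intro exI[of _ "?A \<inter> ball x \<delta>"] conjI ballI impI op)
        show "x \<in> ?A \<inter> ball x \<delta>" using x h(1) by simp
        fix y y' assume "y \<in> ?A \<inter> ball x \<delta>" "y' \<in> ?A \<inter> ball x \<delta>" "P y"
        then show "P y'" using PP[of y y'] by simp
      qed
    qed
  qed
  then show ?thesis using PK by blast
qed

section \<open>Arcs that belong to the curve\<close>

definition has_arc :: "(real ^ 4) set \<Rightarrow> real ^ 4 \<Rightarrow> real ^ 4 \<Rightarrow> real ^ 4 \<Rightarrow> real ^ 4 \<Rightarrow> real \<Rightarrow> real \<Rightarrow> real \<Rightarrow> bool" where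
  "has_arc K p q r s a b d \<longleftrightarrow> labelling p q r s \<and> mixed a b d \<and> arc_of p q r s a b d \<subseteq> K"

lemma has_arc_perm: "has_arc K p q r s a b d = has_arc K q p r s b a d" "has_arc K p q r s a b d = has_arc K p r q s a d b"
  using arc_of_perm labelling_perm(1,2) unfolding has_arc_def mixed_def by metis+

lemma has_arc_scale: "t \<noteq> 0 \<Longrightarrow> has_arc K p q r s a b d \<Longrightarrow> has_arc K p q r s (t * a) (t * b) (t * d)"
  unfolding has_arc_def arc_of_scale mixed_def by (auto simp: zero_less_mult_iff mult_less_0_iff)

text \<open>A zero coefficient would put that vertex on the arc and so into K, and coefficients of
  equal sign would leave the arc empty.\<close>

lemma arc_mixed:
  assumes K: "geodesic_set K" and l: "labelling p q r s" and sub: "arc_of p q r s a b d \<subseteq> K" and z: "z \<in> arc_of p q r s a b d"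
  shows "has_arc K p q r s a b d"
proof -
  have nv: "v \<notin> K" if "v \<in> V" for v using K that by (auto simp: geodesic_set_def)
  have "p \<in> arc_of p q r s a b d" if "a = 0" using that labelling_coord[OF l] V_in_S labelling_in[OF l] by (auto simp: arc_of_def)
  moreover have "q \<in> arc_of p q r s a b d" if "b = 0" using that labelling_coord[OF l] V_in_S labelling_in[OF l] by (auto simp: arc_of_def)
  moreover have "r \<in> arc_of p q r s a b d" if "d = 0" using that labelling_coord[OF l] V_in_S labelling_in[OF l] by (auto simp: arc_of_def)
  ultimately have nz: "a \<noteq> 0" "b \<noteq> 0" "d \<noteq> 0" using nv sub labelling_in[OF l] by auto
  have zz: "coord p z \<ge> 0" "coord q z \<ge> 0" "coord r z \<ge> 0" "a * coord p z + b * coord q z + d * coord r z = 0" "z \<noteq> 0" "coord s z = 0"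
    using z unfolding arc_of_def S_labelling[OF l] by auto
  have pos: "coord p z > 0 \<or> coord q z > 0 \<or> coord r z > 0" using labelling_expand[OF l, of z] zz by (cases "coord p z = 0"; cases "coord q z = 0"; cases "coord r z = 0") auto
  have "\<not> (a > 0 \<and> b > 0 \<and> d > 0)"
  proof
    assume h: "a > 0 \<and> b > 0 \<and> d > 0"
    then have "a * coord p z \<ge> 0" "b * coord q z \<ge> 0" "d * coord r z \<ge> 0" using zz by auto
    then have "a * coord p z = 0" "b * coord q z = 0" "d * coord r z = 0" using zz(4) by linarith+
    then show False using h pos by auto
  qed
  moreover have "\<not> (a < 0 \<and> b < 0 \<and> d < 0)"
  proof
    assume h: "a < 0 \<and> b < 0 \<and> d < 0"
    then have "a * coord p z \<le> 0" "b * coord q z \<le> 0" "d * coord r z \<le> 0" using zz by (auto simp: mult_nonpos_nonneg)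
    then have "a * coord p z = 0" "b * coord q z = 0" "d * coord r z = 0" using zz(4) by linarith+
    then show False using h pos by auto
  qed
  ultimately show ?thesis using nz l sub by (simp add: has_arc_def mixed_def)
qed

lemma arc_edge_point:
  assumes l: "labelling p q r s" and ab: "a > 0" "b < 0"
  obtains x where "x \<in> arc_of p q r s a b d" "coord p x > 0" "coord q x > 0" "coord r x = 0" "coord s x = 0"
proof -
  obtain t v where "t > 0" "v \<in> S" "coord p v = t * (- b)" "coord q v = t * a" "coord r v = t * 0" "coord s v = 0"
    by (rule normalize_face[OF l, of "- b" a 0]) (use ab in auto)
  moreover from this have "t * b < 0" "t * a > 0" using ab by (auto simp: mult_pos_neg)
  ultimately show ?thesis using that[of v] by (auto simp: arc_of_def)
qed

lemma mixed_two_points: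
  assumes l: "labelling p q r s" and m: "mixed a b d"
  shows "arc_of p q r s a b d \<noteq> {x}"
proof -
  have two: "arc_of u v w s a' b' d' \<noteq> {x}"
    if lu: "labelling u v w s" and sg: "a' > 0" "b' < 0" "d' < 0" for u v w a' b' d'
  proof -
    obtain y where y: "y \<in> arc_of u v w s a' b' d'" "coord v y > 0"
      by (rule arc_edge_point[OF lu sg(1,2)]) blast
    obtain y' where y': "y' \<in> arc_of u w v s a' d' b'" "coord v y' = 0"
      by (rule arc_edge_point[OF labelling_perm(2)[OF lu] sg(1,3)]) blast
    then have "y' \<in> arc_of u v w s a' b' d'" using arc_of_perm(2) by simp
    moreover have "y \<noteq> y'" using y y' by auto
    ultimately show ?thesis using y by auto
  qed
  have two': "arc_of u v w s a' b' d' \<noteq> {x}"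
    if lu: "labelling u v w s" and sg: "(a' > 0 \<and> b' < 0 \<and> d' < 0) \<or> (a' < 0 \<and> b' > 0 \<and> d' > 0)" for u v w a' b' d'
    using two[OF lu, of a' b' d'] two[OF lu, of "- a'" "- b'" "- d'"] arc_of_scale[of "-1" u v w s a' b' d'] sg by auto
  have ls: "labelling q p r s" "labelling r p q s" using l by (auto intro: labelling_perm)
  have "((a > 0 \<and> b < 0 \<and> d < 0) \<or> (a < 0 \<and> b > 0 \<and> d > 0)) \<or> ((b > 0 \<and> a < 0 \<and> d < 0) \<or> (b < 0 \<and> a > 0 \<and> d > 0))
     \<or> ((d > 0 \<and> a < 0 \<and> b < 0) \<or> (d < 0 \<and> a > 0 \<and> b > 0))"
    using m unfolding mixed_def by linarith
  then show ?thesis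
    using two'[OF l, of a b d] two'[OF ls(1), of b a d] two'[OF ls(2), of d a b] arc_of_perm by metis
qed

text \<open>Near the common point K is a single arc. Each of the two given arcs shares a second
  point with it, so both forms are proportional to its form. This is the form in which simplicity is
  used from here on.\<close>

lemma same_arc:
  assumes K: "geodesic_set K" and f: "has_arc K p q r s a b d" "has_arc K p q r s a' b' d'"
    and y: "y \<in> arc_of p q r s a b d" "y \<in> arc_of p q r s a' b' d'"
  obtains t where "t \<noteq> 0" "a' = t * a" "b' = t * b" "d' = t * d"
proof -
  have l: "labelling p q r s" and m: "mixed a b d" "mixed a' b' d'" and sub: "arc_of p q r s a b d \<subseteq> K" "arc_of p q r s a' b' d' \<subseteq> K"
    using f by (auto simp: has_arc_def)
  have yK: "y \<in> K" "coord s y = 0" using y sub by (auto simp: arc_of_def)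
  obtain a0 b0 d0 \<epsilon> where h: "\<epsilon> > 0" "a0 \<noteq> 0 \<or> b0 \<noteq> 0 \<or> d0 \<noteq> 0" "y \<in> arc_of p q r s a0 b0 d0"
    "\<And>x. x \<in> S \<Longrightarrow> coord s x = 0 \<Longrightarrow> dist x y < \<epsilon> \<Longrightarrow> x \<in> K \<longleftrightarrow> x \<in> arc_of p q r s a0 b0 d0"
    by (rule geodesic_set_face[OF K l yK]) blast
  have *: "\<exists>t. t \<noteq> 0 \<and> a1 = t * a0 \<and> b1 = t * b0 \<and> d1 = t * d0"
    if m1: "mixed a1 b1 d1" and s1: "arc_of p q r s a1 b1 d1 \<subseteq> K" and y1: "y \<in> arc_of p q r s a1 b1 d1" for a1 b1 d1
  proof -
    obtain x where x: "x \<in> arc_of p q r s a1 b1 d1" "x \<noteq> y" "dist x y < \<epsilon>"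
      by (rule arc_of_near[OF l y1 mixed_two_points[OF l m1] h(1)])
    then have "x \<in> arc_of p q r s a0 b0 d0" using h(4)[of x] s1 by (auto simp: arc_of_def)
    moreover have "a1 \<noteq> 0 \<or> b1 \<noteq> 0 \<or> d1 \<noteq> 0" using m1 by (simp add: mixed_def)
    ultimately show ?thesis using two_points_functional[OF l _ x(1) h(3) y1 x(2) h(2)] by metis
  qed
  obtain t where t: "t \<noteq> 0" "a = t * a0" "b = t * b0" "d = t * d0" using *[OF m(1) sub(1) y(1)] by blast
  obtain t' where t': "t' \<noteq> 0" "a' = t' * a0" "b' = t' * b0" "d' = t' * d0" using *[OF m(2) sub(2) y(2)] by blast
  show ?thesis by (rule that[of "t' / t"]) (use t t' in auto)
qed

text \<open>The vector product of the coefficient vectors gives the coordinates of a common point of the two arcs.\<close>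

lemma arcs_no_cross:
  assumes K: "geodesic_set K" and f: "has_arc K p q r s a b d" "has_arc K p q r s a' b' d'"
    and nn: "b * d' - d * b' \<ge> 0" "d * a' - a * d' \<ge> 0" "a * b' - b * a' \<ge> 0"
  shows "b * d' - d * b' = 0" "d * a' - a * d' = 0" "a * b' - b * a' = 0"
proof -
  have l: "labelling p q r s" using f by (auto simp: has_arc_def)
  have "b * d' - d * b' = 0 \<and> d * a' - a * d' = 0 \<and> a * b' - b * a' = 0"
  proof (rule ccontr)
    assume ne: "\<not> ?thesis"
    obtain t v where v: "t > 0" "v \<in> S" "coord p v = t * (b * d' - d * b')" "coord q v = t * (d * a' - a * d')"
      "coord r v = t * (a * b' - b * a')" "coord s v = 0"
      by (rule normalize_face[OF l nn]) (use ne in blast)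
    have "v \<in> arc_of p q r s a b d" "v \<in> arc_of p q r s a' b' d'"
      using v(2,6) unfolding arc_of_def mem_Collect_eq by (simp_all add: v(3-5)) (simp_all add: algebra_simps)
    then obtain u where "a' = u * a" "b' = u * b" "d' = u * d" using same_arc[OF K f] by metis
    then show False using ne by (simp add: algebra_simps)
  qed
  then show "b * d' - d * b' = 0" "d * a' - a * d' = 0" "a * b' - b * a' = 0" by auto
qed

end

section \<open>Edge crossings\<close>

context reg_tetra
begin

text \<open>The curve crosses the edge \<open>pq\<close>, between the faces \<open>pqr\<close> and \<open>pqs\<close>, along the developed plane on
  which the linear form with values \<open>a, b, d, e\<close> at \<open>p, q, r, s\<close> vanishes.\<close>

definition crosses :: "(real ^ 4) set \<Rightarrow> real ^ 4 \<Rightarrow> real ^ 4 \<Rightarrow> real ^ 4 \<Rightarrow> real ^ 4 \<Rightarrow> real \<Rightarrow> real \<Rightarrow> real \<Rightarrow> real \<Rightarrow> bool" where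
  "crosses K p q r s a b d e \<longleftrightarrow> a > 0 \<and> b < 0 \<and> d + e = k * (a + b) \<and> has_arc K p q r s a b d \<and> has_arc K p q s r a b e"

lemma crosses_labelling: "crosses K p q r s a b d e \<Longrightarrow> labelling p q r s"
  by (simp add: crosses_def has_arc_def)

lemma crosses_nz: "crosses K p q r s a b d e \<Longrightarrow> d \<noteq> 0 \<and> e \<noteq> 0"
  by (simp add: crosses_def has_arc_def mixed_def)

lemma crosses_sym: "crosses K p q r s a b d e \<Longrightarrow> crosses K p q s r a b e d"
  by (simp add: crosses_def add.commute)

lemma crosses_scale: "t > 0 \<Longrightarrow> crosses K p q r s a b d e \<Longrightarrow> crosses K p q r s (t * a) (t * b) (t * d) (t * e)"
  unfolding crosses_def by (auto intro: has_arc_scale simp: mult_pos_neg distrib_left[symmetric])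

lemma crosses_neg:
  assumes "crosses K p q r s a b d e"
  shows "crosses K q p r s (- b) (- a) (- d) (- e)"
proof -
  have "has_arc K q p r s (- b) (- a) (- d)" "has_arc K q p s r (- b) (- a) (- e)"
    using assms has_arc_scale[of "-1" K p q r s a b d] has_arc_scale[of "-1" K p q s r a b e] has_arc_perm(1)[of K p q]
    by (auto simp: crosses_def)
  moreover have "- d + - e = k * (- b + - a)"
    using assms by (simp add: crosses_def algebra_simps)
  ultimately show ?thesis using assms by (simp add: crosses_def)
qed

lemma crosses_ex:
  assumes K: "geodesic_set K" and l: "labelling p q r s" and x: "x \<in> K" "coord r x = 0" "coord s x = 0"
  obtains a b d e \<epsilon> where "crosses K p q r s a b d e" "a * coord p x + b * coord q x = 0" "\<epsilon> > 0"
    "\<forall>y\<in>S. dist y x < \<epsilon> \<longrightarrow> (y \<in> K \<longleftrightarrow> lin p q r s a b d e y = 0)" "coord p x > 0" "coord q x > 0"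
proof -
  have xS: "x \<in> S" "x \<notin> V" and ls: "loc_straight K" using K x by (auto simp: geodesic_set_def)
  have xe: "x = coord p x *\<^sub>R p + coord q x *\<^sub>R q" using labelling_expand[OF l, of x] x by simp
  have nn: "coord p x \<ge> 0" "coord q x \<ge> 0" "norm x = 1" using xS S_labelling[OF l] by auto
  have np: "norm p = 1" "norm q = 1" using labelling_inner[OF l] by (auto simp: norm_eq_1)
  have pos: "coord p x > 0" "coord q x > 0"
  proof -
    have "coord p x \<noteq> 0"
    proof
      assume 0: "coord p x = 0"
      then have "norm x = coord q x" using xe nn np by (metis abs_of_nonneg add_0 mult_1_right norm_scaleR scaleR_zero_left)
      then show False using xe 0 nn xS labelling_in[OF l] by auto
    qed
    moreover have "coord q x \<noteq> 0"
    proof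
      assume 0: "coord q x = 0"
      then have "norm x = coord p x" using xe nn np by (metis abs_of_nonneg add_0_right mult_1_right norm_scaleR scaleR_zero_left)
      then show False using xe 0 nn xS labelling_in[OF l] by auto
    qed
    ultimately show "coord p x > 0" "coord q x > 0" using nn by auto
  qed
  obtain a b d e \<epsilon> where h: "\<epsilon> > 0" "a \<noteq> 0 \<or> b \<noteq> 0 \<or> d \<noteq> 0" "d + e = k * (a + b)"
    "\<forall>y\<in>S. dist y x < \<epsilon> \<longrightarrow> (y \<in> K \<longleftrightarrow> lin p q r s a b d e y = 0)"
    using ls l x pos unfolding loc_straight_def by metis
  have ab: "a * coord p x + b * coord q x = 0" using h xS x by (auto simp: lin_def)
  have xa: "x \<in> arc_of p q r s a b d" "x \<in> arc_of p q s r a b e" using ab xS x by (auto simp: arc_of_def)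
  have "arc_of p q r s a b d \<subseteq> K"
    using h(4) by (intro arc_extends[OF K l h(2) xa(1) h(1)]) (auto simp: arc_of_def lin_def)
  then have A1: "has_arc K p q r s a b d" by (rule arc_mixed[OF K l _ xa(1)])
  then have nz: "a \<noteq> 0" "b \<noteq> 0" by (auto simp: has_arc_def mixed_def)
  have l': "labelling p q s r" using l by (rule labelling_perm)
  have "arc_of p q s r a b e \<subseteq> K"
    using h(4) nz by (intro arc_extends[OF K l' _ xa(2) h(1)]) (auto simp: arc_of_def lin_def)
  then have A2: "has_arc K p q s r a b e" by (rule arc_mixed[OF K l' _ xa(2)])
  show ?thesis
  proof (cases "a > 0")
    case True
    then have "a * coord p x > 0" using pos by simp
    then have "b * coord q x < 0" using ab by linarith
    then have "b < 0" using pos by (simp add: mult_less_0_iff)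
    then have "crosses K p q r s a b d e" using True A1 A2 h(3) by (simp add: crosses_def)
    then show ?thesis using that ab h pos by blast
  next
    case False
    then have "a < 0" using nz by simp
    then have "a * coord p x < 0" using pos by (simp add: mult_neg_pos)
    then have "b * coord q x > 0" using ab by linarith
    then have "b > 0" using pos by (simp add: zero_less_mult_iff)
    then have "crosses K p q r s (- a) (- b) (- d) (- e)"
      using \<open>a < 0\<close> has_arc_scale[OF _ A1, of "-1"] has_arc_scale[OF _ A2, of "-1"] h(3)
      by (simp add: crosses_def algebra_simps)
    moreover have "lin p q r s (- a) (- b) (- d) (- e) y = - lin p q r s a b d e y" for y by (simp add: lin_def)
    ultimately show ?thesis using that[of "- a" "- b" "- d" "- e" \<epsilon>] ab h pos by simp
  qed
qed

lemma crosses_unique: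
  assumes K: "geodesic_set K" and A: "crosses K p q r s a b d e" "crosses K p q r s a' b' d' e'" and eq: "a * b' = a' * b"
  obtains t where "t > 0" "a' = t * a" "b' = t * b" "d' = t * d" "e' = t * e"
proof -
  have l: "labelling p q r s" "labelling p q s r" using A crosses_labelling crosses_sym by blast+
  have sg: "a > 0" "b < 0" "a' > 0" using A by (auto simp: crosses_def)
  obtain x where x: "x \<in> arc_of p q r s a b d" "coord r x = 0" "coord s x = 0"
    by (rule arc_edge_point[OF l(1) sg(1,2)]) blast
  have xS: "x \<in> S" "a * coord p x + b * coord q x = 0" using x by (auto simp: arc_of_def)
  have "a * (a' * coord p x + b' * coord q x) = a' * (a * coord p x) + (a * b') * coord q x" by (simp add: algebra_simps)
  also have "\<dots> = a' * (a * coord p x + b * coord q x)" unfolding eq by (simp add: algebra_simps)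
  finally have "a' * coord p x + b' * coord q x = 0" using xS sg by simp
  then have xa: "x \<in> arc_of p q r s a' b' d'" "x \<in> arc_of p q s r a' b' e'" "x \<in> arc_of p q s r a b e"
    using x xS by (auto simp: arc_of_def)
  have arcs: "has_arc K p q r s a b d" "has_arc K p q r s a' b' d'" "has_arc K p q s r a b e" "has_arc K p q s r a' b' e'"
    using A by (auto simp: crosses_def)
  obtain t where t: "a' = t * a" "b' = t * b" "d' = t * d" by (rule same_arc[OF K arcs(1,2) x(1) xa(1)])
  obtain u where u: "a' = u * a" "b' = u * b" "e' = u * e" by (rule same_arc[OF K arcs(3,4) xa(3,2)])
  have "u = t" using t u sg by simp
  moreover have "t > 0" using t sg by (simp add: zero_less_mult_iff)
  ultimately show ?thesis using that t u by blast
qed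

text \<open>Since \<open>e > 0\<close> and \<open>b < 0\<close>, the arc in the face
  \<open>pqs\<close> leaves through the edge \<open>sq\<close>. Behind that edge lies r again, now
  developed across \<open>sq\<close>, so its value is \<open>k * (e + b) - a\<close> and not
  d.\<close>

lemma crosses_step:
  assumes K: "geodesic_set K" and A: "crosses K p q r s a b d e" and e: "e > 0"
  shows "crosses K s q p r e b a (k * (e + b) - a)"
proof -
  have "labelling p q r s" using crosses_labelling A by blast
  then have l': "labelling s q p r" by (rule labelling_perm)
  have b: "b < 0" using A by (simp add: crosses_def)
  have arc: "has_arc K s q p r e b a" using A has_arc_perm unfolding crosses_def by metis
  obtain x where x: "x \<in> arc_of s q p r e b a" "coord p x = 0" "coord r x = 0"
    by (rule arc_edge_point[OF l' e b]) blast
  then have "x \<in> K" using arc by (auto simp: has_arc_def)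
  obtain e' b' a' f' where A': "crosses K s q p r e' b' a' f'" "e' * coord s x + b' * coord q x = 0"
    by (rule crosses_ex[OF K l' \<open>x \<in> K\<close> x(2,3)])
  have "x \<in> arc_of s q p r e' b' a'" using x A' by (auto simp: arc_of_def)
  moreover have "has_arc K s q p r e' b' a'" using A' by (simp add: crosses_def)
  ultimately obtain t where t: "t \<noteq> 0" "e' = t * e" "b' = t * b" "a' = t * a"
    using same_arc[OF K arc _ x(1)] by metis
  have "t > 0" using A' t e by (auto simp: crosses_def zero_less_mult_iff)
  then have AA: "crosses K s q p r e b a (f' / t)" using crosses_scale[of "1 / t", OF _ A'(1)] t by simp
  then have "f' / t = k * (e + b) - a" by (simp add: crosses_def)
  then show ?thesis using AA by simp
qed

lemma crosses_step_neg:
  assumes K: "geodesic_set K" and A: "crosses K p q r s a b d e" and e: "e < 0"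
  shows "crosses K p s q r a e b (k * (a + e) - b)"
proof -
  have "crosses K s p q r (- e) (- a) (- b) (k * (- e + - a) - - b)"
    using crosses_step[OF K crosses_neg[OF A]] e by simp
  then have "crosses K p s q r a e b (- (k * (- e + - a) - - b))" using crosses_neg by fastforce
  moreover have "- (k * (- e + - a) - - b) = k * (a + e) - b" by (simp add: algebra_simps)
  ultimately show ?thesis by simp
qed

lemma crosses_exists:
  assumes K: "geodesic_set K"
  obtains p q r s a b d e where "crosses K p q r s a b d e"
proof -
  obtain z where z: "z \<in> K" using K by (auto simp: geodesic_set_def)
  then have "z \<in> S" "z \<notin> V" using K by (auto simp: geodesic_set_def)
  then obtain s where s: "s \<in> V" "coord s z = 0" by (auto simp: S_iff)
  have "\<not> V \<subseteq> {s}" using card_V card_mono[of "{s}" V] by auto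
  then obtain q where "q \<in> V" "q \<noteq> s" by blast
  then obtain p r where "labelling q s p r" using labelling_ex[of q s] s by metis
  then have l: "labelling p q r s" by (auto intro: labelling_perm)
  obtain a b d \<epsilon> where h: "\<epsilon> > 0" "a \<noteq> 0 \<or> b \<noteq> 0 \<or> d \<noteq> 0" "z \<in> arc_of p q r s a b d"
    "\<And>y. y \<in> S \<Longrightarrow> coord s y = 0 \<Longrightarrow> dist y z < \<epsilon> \<Longrightarrow> y \<in> K \<longleftrightarrow> y \<in> arc_of p q r s a b d"
    by (rule geodesic_set_face[OF K l z s(2)]) blast
  have "arc_of p q r s a b d \<subseteq> K"
    using h(4) by (intro arc_extends[OF K l h(2,3,1)]) (auto simp: arc_of_def)
  then have A: "has_arc K p q r s a b d" by (rule arc_mixed[OF K l _ h(3)])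
  have ex: thesis if arc: "has_arc K p' q' r' s a' b' d'" and sg: "a' > 0" "b' < 0" for p' q' r' a' b' d'
  proof -
    have l': "labelling p' q' r' s" using arc by (simp add: has_arc_def)
    obtain x where x: "x \<in> arc_of p' q' r' s a' b' d'" "coord r' x = 0" "coord s x = 0"
      by (rule arc_edge_point[OF l' sg]) blast
    then have "x \<in> K" using arc by (auto simp: has_arc_def)
    then show thesis using crosses_ex[OF K l' _ x(2,3)] \<open>\<And>p q r s a b d e. crosses K p q r s a b d e \<Longrightarrow> thesis\<close> by metis
  qed
  have A2: "has_arc K q p r s b a d" "has_arc K p r q s a d b" "has_arc K r p q s d a b" "has_arc K q r p s b d a" "has_arc K r q p s d b a"
    using A has_arc_perm by metis+
  have "mixed a b d" using A by (simp add: has_arc_def)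
  then consider "a > 0" "b < 0" | "a < 0" "b > 0" | "a > 0" "d < 0" | "a < 0" "d > 0"
    unfolding mixed_def by linarith
  then show ?thesis
  proof cases
    case 1 then show ?thesis using ex[OF A] by simp
  next
    case 2 then show ?thesis using ex[OF A2(1)] by simp
  next
    case 3 then show ?thesis using ex[OF A2(2)] by simp
  next
    case 4 then show ?thesis using ex[OF A2(3)] by simp
  qed
qed

text \<open>At the crossing point the coordinates at q and p have the ratio
  \<open>a / (- b)\<close>; the inequality compares these ratios without division. So this is the
  crossing of \<open>pq\<close> closest to p, and it exists by compactness.\<close>

definition nearest :: "(real ^ 4) set \<Rightarrow> real ^ 4 \<Rightarrow> real ^ 4 \<Rightarrow> real ^ 4 \<Rightarrow> real ^ 4 \<Rightarrow> real \<Rightarrow> real \<Rightarrow> real \<Rightarrow> real \<Rightarrow> bool" where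
  "nearest K p q r s a b d e \<longleftrightarrow> crosses K p q r s a b d e \<and>
     (\<forall>a' b' d' e'. crosses K p q r s a' b' d' e' \<longrightarrow> a * (- b') \<le> a' * (- b))"

lemma nearest_ex:
  assumes K: "geodesic_set K" and A: "crosses K p q r s a b d e"
  obtains a' b' d' e' where "nearest K p q r s a' b' d' e'"
proof -
  have l: "labelling p q r s" using crosses_labelling A by blast
  define E where "E = K \<inter> {x. coord r x = 0} \<inter> {x. coord s x = 0}"
  have pt: "\<exists>x\<in>E. a' * coord p x + b' * coord q x = 0 \<and> coord p x > 0" if A': "crosses K p q r s a' b' d' e'" for a' b' d' e'
  proof -
    have sg: "a' > 0" "b' < 0" using A' by (auto simp: crosses_def)
    obtain x where x: "x \<in> arc_of p q r s a' b' d'" "coord p x > 0" "coord r x = 0" "coord s x = 0"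
      by (rule arc_edge_point[OF l sg]) blast
    moreover have "x \<in> K" using A' x by (auto simp: crosses_def has_arc_def)
    ultimately show ?thesis by (intro bexI[of _ x]) (auto simp: E_def arc_of_def)
  qed
  have "closed K" "K \<subseteq> sphere 0 1" using K S_sphere by (auto simp: geodesic_set_def)
  then have "compact K" by (metis bounded_sphere bounded_subset compact_eq_bounded_closed)
  moreover have "closed {x. coord r x = 0}" "closed {x. coord s x = 0}" by (intro closed_Collect_eq continuous_intros)+
  ultimately have cE: "compact E" unfolding E_def by (intro compact_Int_closed)
  have nE: "E \<noteq> {}" using pt[OF A] by auto
  have pE: "coord p x > 0" if "x \<in> E" for x
  proof -
    have "x \<in> K" "coord r x = 0" "coord s x = 0" using that by (auto simp: E_def)
    then show ?thesis by (rule crosses_ex[OF K l])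
  qed
  have "continuous_on E (\<lambda>x. coord q x / coord p x)" using pE by (intro continuous_intros) force
  then have "\<exists>x\<in>E. \<forall>y\<in>E. coord q x / coord p x \<le> coord q y / coord p y"
    by (rule continuous_attains_inf[OF cE nE])
  then obtain x0 where x0: "x0 \<in> E" "\<And>y. y \<in> E \<Longrightarrow> coord q x0 / coord p x0 \<le> coord q y / coord p y" by blast
  have "x0 \<in> K" "coord r x0 = 0" "coord s x0 = 0" using x0(1) by (auto simp: E_def)
  then obtain a0 b0 d0 e0 where A0: "crosses K p q r s a0 b0 d0 e0" "a0 * coord p x0 + b0 * coord q x0 = 0"
    by (rule crosses_ex[OF K l])
  have ratio: "coord q x / coord p x = a' / (- b')" if "b' < 0" "coord p x > 0" "a' * coord p x + b' * coord q x = 0" for a' b' x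
    using that by (simp add: field_simps)
  have "nearest K p q r s a0 b0 d0 e0" unfolding nearest_def
  proof (intro conjI allI impI A0(1))
    fix a' b' d' e' assume A': "crosses K p q r s a' b' d' e'"
    obtain y where y: "y \<in> E" "a' * coord p y + b' * coord q y = 0" using pt[OF A'] by blast
    have b: "b0 < 0" "b' < 0" using A0 A' by (auto simp: crosses_def)
    have "a0 / (- b0) \<le> a' / (- b')" using x0(2)[OF y(1)] ratio[OF b(1) pE[OF x0(1)] A0(2)] ratio[OF b(2) pE[OF y(1)] y(2)] by simp
    then show "a0 * (- b') \<le> a' * (- b0)" using b by (simp add: field_simps)
  qed
  then show ?thesis by (rule that)
qed

section \<open>One crossing determines the curve\<close>

lemma crosses_local:
  assumes K: "geodesic_set K" and A: "crosses K p q r s a b d e"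
  obtains x \<epsilon> where "x \<in> K" "coord r x = 0" "coord s x = 0" "a * coord p x + b * coord q x = 0" "\<epsilon> > 0"
    "\<forall>y\<in>S. dist y x < \<epsilon> \<longrightarrow> (y \<in> K \<longleftrightarrow> lin p q r s a b d e y = 0)"
proof -
  have l: "labelling p q r s" using crosses_labelling A by blast
  have sg: "a > 0" "b < 0" using A by (auto simp: crosses_def)
  obtain x where x: "x \<in> arc_of p q r s a b d" "coord p x > 0" "coord r x = 0" "coord s x = 0"
    by (rule arc_edge_point[OF l sg]) blast
  have xK: "x \<in> K" using A x by (auto simp: crosses_def has_arc_def)
  have x0: "a * coord p x + b * coord q x = 0" using x by (auto simp: arc_of_def)
  obtain a' b' d' e' \<epsilon> where h: "crosses K p q r s a' b' d' e'" "a' * coord p x + b' * coord q x = 0" "\<epsilon> > 0"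
    "\<forall>y\<in>S. dist y x < \<epsilon> \<longrightarrow> (y \<in> K \<longleftrightarrow> lin p q r s a' b' d' e' y = 0)" "coord q x > 0"
    by (rule crosses_ex[OF K l xK x(3,4)])
  have "a * b' = a' * b"
  proof -
    have "coord q x * (a * b' - a' * b) = a * (b' * coord q x) - a' * (b * coord q x)" by (simp add: algebra_simps)
    moreover have "b' * coord q x = - (a' * coord p x)" "b * coord q x = - (a * coord p x)" using h(2) x0 by linarith+
    ultimately have "coord q x * (a * b' - a' * b) = 0" by (simp add: algebra_simps)
    then show ?thesis using h(5) by simp
  qed
  then obtain t where t: "t > 0" "a' = t * a" "b' = t * b" "d' = t * d" "e' = t * e"
    by (rule crosses_unique[OF K A h(1)])
  have "lin p q r s a' b' d' e' y = t * lin p q r s a b d e y" for y unfolding t lin_def by (simp add: algebra_simps)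
  then have "\<forall>y\<in>S. dist y x < \<epsilon> \<longrightarrow> (y \<in> K \<longleftrightarrow> lin p q r s a b d e y = 0)" using h(4) t(1) by simp
  then show ?thesis using that xK x x0 h(3) by blast
qed

text \<open>That K and K' agree near a point is locally constant along the connected set K: two
  local forms that agree near one point of a small ball are proportional, hence describe the same
  set in the whole ball.\<close>

lemma geodesic_set_subset:
  assumes K: "geodesic_set K" "geodesic_set K'" and A: "crosses K p q r s a b d e" "crosses K' p q r s a b d e"
  shows "K \<subseteq> K'"
proof
  fix w assume w: "w \<in> K"
  define P where "P x \<longleftrightarrow> (\<exists>\<epsilon>>0. \<forall>y\<in>S. dist y x < \<epsilon> \<longrightarrow> (y \<in> K \<longleftrightarrow> y \<in> K'))" for x
  have KS: "K \<subseteq> S" "closed K'" "connected K" using K by (auto simp: geodesic_set_def)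
  have PK: "x \<in> K'" if "P x" "x \<in> K" for x using that KS by (auto simp: P_def)
  obtain x0 \<epsilon> where x0: "x0 \<in> K" "coord r x0 = 0" "coord s x0 = 0" "a * coord p x0 + b * coord q x0 = 0" "\<epsilon> > 0"
    "\<forall>y\<in>S. dist y x0 < \<epsilon> \<longrightarrow> (y \<in> K \<longleftrightarrow> lin p q r s a b d e y = 0)"
    by (rule crosses_local[OF K(1) A(1)])
  obtain x1 \<epsilon>1 where x1: "x1 \<in> K'" "coord r x1 = 0" "coord s x1 = 0" "a * coord p x1 + b * coord q x1 = 0" "\<epsilon>1 > 0"
    "\<forall>y\<in>S. dist y x1 < \<epsilon>1 \<longrightarrow> (y \<in> K' \<longleftrightarrow> lin p q r s a b d e y = 0)"
    by (rule crosses_local[OF K(2) A(2)])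
  have l: "labelling p q r s" using crosses_labelling A by blast
  have "x0 = x1"
  proof -
    have S: "x0 \<in> S" "x1 \<in> S" using x0 x1 K by (auto simp: geodesic_set_def)
    have "a > 0" "b < 0" using A by (auto simp: crosses_def)
    then have e: "coord p x0 = (- b / a) * coord q x0" "coord p x1 = (- b / a) * coord q x1"
      using x0(4) x1(4) by (simp_all add: field_simps)
    define u where "u = (- b / a) *\<^sub>R p + q"
    have eu: "v = coord q v *\<^sub>R u" if "coord r v = 0" "coord s v = 0" "coord p v = (- b / a) * coord q v" for v
    proof -
      have "coord q v *\<^sub>R u = coord p v *\<^sub>R p + coord q v *\<^sub>R q" unfolding that(3) u_def by (simp add: algebra_simps)
      then show ?thesis using labelling_expand[OF l, of v] that by simp
    qed
    have "x0 = coord q x0 *\<^sub>R u" "x1 = coord q x1 *\<^sub>R u" using eu[OF x0(2,3) e(1)] eu[OF x1(2,3) e(2)] by simp_all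
    moreover have "coord q x0 \<ge> 0" "coord q x1 \<ge> 0" "norm x0 = 1" "norm x1 = 1" using S S_labelling[OF l] by auto
    ultimately have "coord q x0 * norm u = 1" "coord q x1 * norm u = 1" by (metis abs_of_nonneg norm_scaleR)+
    then have "coord q x0 = coord q x1" by (metis mult_cancel_right mult_zero_right zero_neq_one)
    then show ?thesis using \<open>x0 = coord q x0 *\<^sub>R u\<close> \<open>x1 = coord q x1 *\<^sub>R u\<close> by simp
  qed
  then have "P x0" unfolding P_def using x0(5,6) x1(5,6) by (intro exI[of _ "min \<epsilon> \<epsilon>1"]) simp
  have "P w"
  proof (rule connected_induction_simple[where P = P, OF KS(3) x0(1) w \<open>P x0\<close>])
    fix z assume z: "z \<in> K"
    show "\<exists>T. openin (top_of_set K) T \<and> z \<in> T \<and> (\<forall>x\<in>T. \<forall>y\<in>T. P x \<longrightarrow> P y)"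
    proof (cases "z \<in> K'")
      case False
      have "openin (top_of_set K) (K \<inter> - K')" using KS by (intro openin_open_Int) auto
      then show ?thesis using z False PK by (intro exI[of _ "K \<inter> - K'"]) auto
    next
      case True
      have zS: "z \<in> S" "z \<notin> V" using z K by (auto simp: geodesic_set_def)
      obtain p' q' r' s' where l': "labelling p' q' r' s'" and pos: "coord p' z > 0" "coord q' z > 0" "coord s' z = 0"
      proof -
        obtain s1 where s1: "s1 \<in> V" "coord s1 z = 0" using zS by (auto simp: S_iff)
        obtain q1 where "q1 \<in> V" "coord q1 z \<noteq> 0"
          using labelling_expand[OF l, of z] zS labelling_in[OF l] by (metis S_iff add.right_neutral norm_zero scaleR_zero_left zero_neq_one)
        then have q1: "q1 \<in> V" "q1 \<noteq> s1" "coord q1 z > 0" using zS s1 by (auto simp: S_iff less_le)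
        obtain u v where "labelling q1 s1 u v" using labelling_ex[OF q1(1) s1(1) q1(2)] by metis
        then have l1: "labelling q1 u v s1" "labelling q1 v u s1" by (auto intro: labelling_perm)
        have nn: "coord u z \<ge> 0" "coord v z \<ge> 0" using zS S_labelling[OF l1(1)] by auto
        have "coord u z \<noteq> 0 \<or> coord v z \<noteq> 0"
        proof (rule ccontr)
          assume "\<not> ?thesis"
          then have zu: "z = coord q1 z *\<^sub>R q1" using labelling_expand[OF l1(1), of z] s1 by simp
          moreover have "norm q1 = 1" "norm z = 1" using labelling_inner[OF l1(1)] zS by (auto simp: norm_eq_1 S_iff)
          ultimately have "coord q1 z = 1" using q1 by (metis abs_of_pos mult_1_right norm_scaleR)
          then show False using zu zS q1 by auto
        qed
        then show ?thesis using that[OF l1(1) q1(3) _ s1(2)] that[OF l1(2) q1(3) _ s1(2)] nn by (auto simp: less_le)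
      qed
      obtain a1 b1 d1 e1 \<delta>1 where h1: "\<delta>1 > 0" "a1 \<noteq> 0 \<or> b1 \<noteq> 0 \<or> d1 \<noteq> 0" "d1 + e1 = k * (a1 + b1)"
        "\<forall>y\<in>S. dist y z < \<delta>1 \<longrightarrow> (y \<in> K \<longleftrightarrow> lin p' q' r' s' a1 b1 d1 e1 y = 0)"
        using K(1) l' z pos unfolding geodesic_set_def loc_straight_def by metis
      obtain a2 b2 d2 e2 \<delta>2 where h2: "\<delta>2 > 0" "a2 \<noteq> 0 \<or> b2 \<noteq> 0 \<or> d2 \<noteq> 0" "d2 + e2 = k * (a2 + b2)"
        "\<forall>y\<in>S. dist y z < \<delta>2 \<longrightarrow> (y \<in> K' \<longleftrightarrow> lin p' q' r' s' a2 b2 d2 e2 y = 0)"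
        using K(2) l' True pos unfolding geodesic_set_def loc_straight_def by metis
      \<comment> \<open>If z lies inside a face, the ball is shrunk so that it stays in that face.
        Every face of the pair that contains a point x of the ball on the surface then contains z as
        well.\<close>
      have "open ({x. coord p' x > 0} \<inter> {x. coord q' x > 0} \<inter> (if coord r' z > 0 then {x. coord r' x > 0} else UNIV))"
        by (auto intro!: open_Int open_Collect_less continuous_intros)
      moreover have "z \<in> {x. coord p' x > 0} \<inter> {x. coord q' x > 0} \<inter> (if coord r' z > 0 then {x. coord r' x > 0} else UNIV)" using pos by auto
      ultimately obtain \<delta>3 where d3: "\<delta>3 > 0"
        "ball z \<delta>3 \<subseteq> {x. coord p' x > 0} \<inter> {x. coord q' x > 0} \<inter> (if coord r' z > 0 then {x. coord r' x > 0} else UNIV)"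
        using openE by metis
      define \<delta> where "\<delta> = min \<delta>1 (min \<delta>2 \<delta>3)"
      have \<delta>: "\<delta> > 0" "\<delta> \<le> \<delta>1" "\<delta> \<le> \<delta>2" "\<delta> \<le> \<delta>3" using h1 h2 d3 by (auto simp: \<delta>_def)
      have lin1: "lin p' q' r' s' a1 b1 d1 e1 z = 0" using h1 zS z by auto
      have l'': "labelling p' q' s' r'" using l' by (rule labelling_perm)
      have near1: "y \<in> K" if "lin p' q' r' s' a1 b1 d1 e1 y = 0" "y \<in> S" "dist y z < \<delta>1" for y using h1(4) that by auto
      have op: "openin (top_of_set K) (K \<inter> ball z \<delta>)" by (intro openin_open_Int) auto
      have key: "\<exists>t. t \<noteq> 0 \<and> a2 = t * a1 \<and> b2 = t * b1 \<and> d2 = t * d1 \<and> e2 = t * e1"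
        if x: "x \<in> K" "dist x z < \<delta>" and Px: "P x" for x
      proof -
        have xS: "x \<in> S" using x KS by auto
        have "x \<in> ball z \<delta>3" using x \<delta> by (simp add: dist_commute)
        then have xp: "coord p' x > 0" "coord q' x > 0" "coord r' z > 0 \<Longrightarrow> coord r' x > 0" using d3(2) by (auto split: if_splits)
        have lx: "lin p' q' r' s' a1 b1 d1 e1 x = 0" using h1(4) x \<delta> xS by auto
        obtain \<epsilon>' where e': "\<epsilon>' > 0" "\<And>y. y \<in> S \<Longrightarrow> dist y x < \<epsilon>' \<Longrightarrow> y \<in> K \<longleftrightarrow> y \<in> K'" using Px by (auto simp: P_def)
        define \<epsilon>2 where "\<epsilon>2 = min \<epsilon>' (\<delta> - dist x z)"
        have e2: "\<epsilon>2 > 0" "\<epsilon>2 \<le> \<epsilon>'" "\<epsilon>2 \<le> \<delta> - dist x z" using e' x by (auto simp: \<epsilon>2_def)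
        have both: "lin p' q' r' s' a2 b2 d2 e2 y = 0" if "lin p' q' r' s' a1 b1 d1 e1 y = 0" "y \<in> S" "dist y x < \<epsilon>2" for y
        proof -
          have "dist y z < \<delta>" using dist_triangle[of y z x] e2 that by simp
          then show ?thesis using h1(4) h2(4) e'(2)[of y] that e2 \<delta> by auto
        qed
        have main: "\<exists>t. t \<noteq> 0 \<and> a2 = t * a1 \<and> b2 = t * b1 \<and> u2 = t * u1"
          if lu: "labelling p' q' u v" and zx: "coord v x = 0" "coord v z = 0"
            and L1: "\<And>y. coord v y = 0 \<Longrightarrow> lin p' q' r' s' a1 b1 d1 e1 y = a1 * coord p' y + b1 * coord q' y + u1 * coord u y"
            and L2: "\<And>y. coord v y = 0 \<Longrightarrow> lin p' q' r' s' a2 b2 d2 e2 y = a2 * coord p' y + b2 * coord q' y + u2 * coord u y"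
            and n1: "a1 \<noteq> 0 \<or> b1 \<noteq> 0 \<or> u1 \<noteq> 0" and n2: "a2 \<noteq> 0 \<or> b2 \<noteq> 0 \<or> u2 \<noteq> 0" for u v u1 u2
        proof -
          have za: "z \<in> arc_of p' q' u v a1 b1 u1" using lin1 L1[OF zx(2)] zS zx by (simp add: arc_of_def)
          have "arc_of p' q' u v a1 b1 u1 \<subseteq> K"
          proof (rule arc_extends[OF K(1) lu n1 za h1(1)])
            fix y assume y: "y \<in> arc_of p' q' u v a1 b1 u1" "dist y z < \<delta>1"
            then show "y \<in> K" using near1[of y] L1[of y] by (auto simp: arc_of_def)
          qed
          then have "mixed a1 b1 u1" using arc_mixed[OF K(1) lu _ za] by (simp add: has_arc_def)
          note two = mixed_two_points[OF lu this]
          have xa: "x \<in> arc_of p' q' u v a1 b1 u1" using lx L1[OF zx(1)] xS zx by (simp add: arc_of_def)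
          obtain y where y: "y \<in> arc_of p' q' u v a1 b1 u1" "y \<noteq> x" "dist y x < \<epsilon>2"
            by (rule arc_of_near[OF lu xa two e2(1)])
          have ys: "y \<in> S" "coord v y = 0" "lin p' q' r' s' a1 b1 d1 e1 y = 0" using y L1[of y] by (auto simp: arc_of_def)
          have "lin p' q' r' s' a2 b2 d2 e2 y = 0" "lin p' q' r' s' a2 b2 d2 e2 x = 0"
            using both[OF ys(3,1) y(3)] both[OF lx xS] e2(1) by auto
          then have "y \<in> arc_of p' q' u v a2 b2 u2" "x \<in> arc_of p' q' u v a2 b2 u2"
            using L2[OF ys(2)] L2[OF zx(1)] ys xS zx by (auto simp: arc_of_def)
          then show ?thesis using two_points_functional[OF lu y(1) _ xa _ y(2) n1 n2] by metis
        qed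
        consider "coord s' x = 0" | "coord r' x = 0" using xp S_labelling[OF l', of x] xS by auto
        then show ?thesis
        proof cases
          case 1
          obtain t where t: "t \<noteq> 0" "a2 = t * a1" "b2 = t * b1" "d2 = t * d1"
            using main[OF l' 1 pos(3), of d1 d2] h1(2) h2(2) by (auto simp: lin_def)
          have e: "e2 = k * (a2 + b2) - d2" "e1 = k * (a1 + b1) - d1" using h1(3) h2(3) by linarith+
          have "e2 = t * e1" unfolding e t by (simp add: algebra_simps)
          then show ?thesis using t by blast
        next
          case 2
          have "coord r' z = 0" using 2 xp(3) zS S_labelling[OF l'] by (auto simp: less_le)
          have "a1 \<noteq> 0 \<or> b1 \<noteq> 0 \<or> e1 \<noteq> 0" using h1 by auto
          moreover have "a2 \<noteq> 0 \<or> b2 \<noteq> 0 \<or> e2 \<noteq> 0" using h2 by auto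
          ultimately obtain t where t: "t \<noteq> 0" "a2 = t * a1" "b2 = t * b1" "e2 = t * e1"
            using main[OF l'' 2 \<open>coord r' z = 0\<close>, of e1 e2] by (auto simp: lin_def)
          have d: "d2 = k * (a2 + b2) - e2" "d1 = k * (a1 + b1) - e1" using h1(3) h2(3) by linarith+
          have "d2 = t * d1" unfolding d t by (simp add: algebra_simps)
          then show ?thesis using t by blast
        qed
      qed
      show ?thesis
      proof (intro exI[of _ "K \<inter> ball z \<delta>"] conjI ballI impI op)
        show "z \<in> K \<inter> ball z \<delta>" using z \<delta> by simp
        fix x y assume xy: "x \<in> K \<inter> ball z \<delta>" "y \<in> K \<inter> ball z \<delta>" "P x"
        obtain t where t: "t \<noteq> 0" "a2 = t * a1" "b2 = t * b1" "d2 = t * d1" "e2 = t * e1"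
          using key[of x] xy by (auto simp: dist_commute)
        have lt: "lin p' q' r' s' a2 b2 d2 e2 v = t * lin p' q' r' s' a1 b1 d1 e1 v" for v
          unfolding t lin_def by (simp add: algebra_simps)
        show "P y" unfolding P_def
        proof (intro exI[of _ "\<delta> - dist y z"] conjI ballI impI)
          show "\<delta> - dist y z > 0" using xy by (simp add: dist_commute)
          fix v assume v: "v \<in> S" "dist v y < \<delta> - dist y z"
          then have "dist v z < \<delta>" using dist_triangle[of v z y] by simp
          then show "v \<in> K \<longleftrightarrow> v \<in> K'" using h1(4) h2(4) v \<delta> lt t(1) by simp
        qed
      qed
    qed
  qed
  then show "w \<in> K'" using PK w by blast
qed

lemma geodesic_set_eq:
  assumes "geodesic_set K" "geodesic_set K'" "crosses K p q r s a b d e" "crosses K' p q r s a b d e"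
  shows "K = K'"
  using geodesic_set_subset[OF assms] geodesic_set_subset[OF assms(2,1,4,3)] by blast

end

section \<open>Corners cut off by the curve\<close>

lemma mult_chain_le:
  fixes a b c d x y :: real
  assumes "a * x \<le> b * y" "d * y \<le> c * x" "x > 0" "y > 0" "a \<ge> 0" "c \<ge> 0" "d \<ge> 0" "b \<ge> 0"
  shows "a * d \<le> b * c"
proof -
  have "(a * x) * (d * y) \<le> (b * y) * (c * x)" by (rule mult_mono) (use assms in auto)
  then have "(a * d) * (x * y) \<le> (b * c) * (x * y)" by (simp add: algebra_simps)
  then show ?thesis using assms by simp
qed

lemma mult_chain_less:
  fixes a b c d x y :: real
  assumes "a * x < b * y" "d * y \<le> c * x" "x > 0" "y > 0" "a \<ge> 0" "c > 0" "d \<ge> 0" "b > 0"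
  shows "a * d < b * c"
proof -
  have "(a * x) * (d * y) \<le> (a * x) * (c * x)" using assms by (intro mult_left_mono) auto
  also have "\<dots> < (b * y) * (c * x)" using assms by (intro mult_strict_right_mono) auto
  finally have "(a * d) * (x * y) < (b * c) * (x * y)" by (simp add: algebra_simps)
  then show ?thesis using assms by simp
qed

context reg_tetra
begin

definition crossed :: "(real ^ 4) set \<Rightarrow> real ^ 4 \<Rightarrow> real ^ 4 \<Rightarrow> bool" where
  "crossed K p q \<longleftrightarrow> (\<exists>r s a b d e. crosses K p q r s a b d e)"

text \<open>Some arc of the curve in the face \<open>pqr\<close> separates \<open>p\<close> from \<open>q\<close> and \<open>r\<close>.\<close>

definition cut :: "(real ^ 4) set \<Rightarrow> real ^ 4 \<Rightarrow> real ^ 4 \<Rightarrow> real ^ 4 \<Rightarrow> real ^ 4 \<Rightarrow> bool" where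
  "cut K p q r s \<longleftrightarrow> (\<exists>a b d e. crosses K p q r s a b d e \<and> d < 0)"

lemma crosses_turn_neg:
  assumes "geodesic_set K" "crosses K p q r s a b d e" "d < 0"
  shows "crosses K p r q s a d b (k * (a + d) - b)"
  using crosses_step_neg[OF assms(1) crosses_sym[OF assms(2)] assms(3)] .

lemma crosses_turn_pos:
  assumes "geodesic_set K" "crosses K p q r s a b d e" "d > 0"
  shows "crosses K r q p s d b a (k * (d + b) - a)"
  using crosses_step[OF assms(1) crosses_sym[OF assms(2)] assms(3)] .

lemma cut_sym: "geodesic_set K \<Longrightarrow> cut K p q r s \<Longrightarrow> cut K p r q s"
  unfolding cut_def using crosses_turn_neg crosses_def by metis

lemma crosses_crossed: "crosses K p q r s a b d e \<Longrightarrow> crossed K p q"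
  unfolding crossed_def by blast

lemma crossed_exists:
  assumes K: "geodesic_set K"
  shows "\<exists>p q. crossed K p q"
proof (rule ccontr)
  assume n: "\<nexists>p q. crossed K p q"
  show False
  proof (rule crosses_exists[OF K])
    fix p q r s a b d e assume "crosses K p q r s a b d e"
    then have "crossed K p q" by (rule crosses_crossed)
    then show False using n by blast
  qed
qed

lemma crossed_in: "crossed K p q \<Longrightarrow> p \<in> V \<and> q \<in> V \<and> p \<noteq> q"
  unfolding crossed_def using crosses_labelling labelling_in labelling_neq by metis

lemma crossed_sym: "crossed K p q \<Longrightarrow> crossed K q p"
  unfolding crossed_def using crosses_neg by blast

lemma crossed_labelling:
  assumes "crossed K p q" "labelling p q r s"
  obtains a b d e where "crosses K p q r s a b d e"
proof -
  obtain r' s' a b d e where A: "crosses K p q r' s' a b d e" using assms by (auto simp: crossed_def)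
  then have "labelling p q r' s'" by (rule crosses_labelling)
  then have "{r', s'} = V - {p, q}" "r' \<noteq> s'" by (auto simp: labelling_def)
  moreover have "{r, s} = V - {p, q}" using assms(2) by (auto simp: labelling_def)
  ultimately have "(r' = r \<and> s' = s) \<or> (r' = s \<and> s' = r)" by (metis doubleton_eq_iff)
  then show ?thesis using that A crosses_sym by blast
qed

lemma cut_crossed: "geodesic_set K \<Longrightarrow> cut K p q r s \<Longrightarrow> crossed K p q \<and> crossed K p r"
  using cut_sym[of K p q r s] unfolding cut_def crossed_def by blast

lemma crosses_cut_neg: "crosses K p q r s a b d e \<Longrightarrow> d < 0 \<Longrightarrow> cut K p q r s"
  by (auto simp: cut_def)

lemma crosses_cut_pos:
  assumes "geodesic_set K" "crosses K p q r s a b d e" "d > 0"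
  shows "cut K q r p s"
proof -
  have "crosses K q r p s (- b) (- d) (- a) (- (k * (d + b) - a))"
    using crosses_neg[OF crosses_turn_pos[OF assms]] .
  moreover have "a > 0" using assms by (simp add: crosses_def)
  ultimately show ?thesis unfolding cut_def by (metis neg_less_0_iff_less)
qed

text \<open>An arc that enters the face \<open>pqr\<close> through \<open>pq\<close> leaves through
  \<open>pr\<close> or \<open>qr\<close>, and so cuts off p or q.\<close>

lemma crossed_cut:
  assumes K: "geodesic_set K" and l: "labelling p q r s" and cr: "crossed K p q"
  shows "cut K p q r s \<or> cut K q p r s"
proof -
  obtain a b d e where A: "crosses K p q r s a b d e" by (rule crossed_labelling[OF cr l])
  then have "d \<noteq> 0" using crosses_nz by blast
  then consider "d < 0" | "d > 0" by linarith
  then show ?thesis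
    using crosses_cut_neg[OF A] crosses_cut_pos[OF K A] cut_sym[OF K] by (cases; blast)
qed

lemma crosses_no_cross:
  assumes K: "geodesic_set K" and A: "has_arc K p q r s a b d" "has_arc K p q r s a' b' d'"
    and ge: "b * d' - d * b' \<ge> 0" "d * a' - a * d' \<ge> 0" "a * b' - b * a' \<ge> 0"
    and gt: "b * d' - d * b' > 0 \<or> d * a' - a * d' > 0 \<or> a * b' - b * a' > 0"
  shows False
  using arcs_no_cross[OF K A ge] gt by linarith

lemma crosses_arc: "crosses K p q r s a b d e \<Longrightarrow> has_arc K p q r s a b d"
  and crosses_arc': "crosses K p q r s a b d e \<Longrightarrow> has_arc K p q s r a b e"
  by (auto simp: crosses_def)

lemma nearest_crosses: "nearest K p q r s a b d e \<Longrightarrow> crosses K p q r s a b d e"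
  by (simp add: nearest_def)

lemma nearest_le: "nearest K p q r s a b d e \<Longrightarrow> crosses K p q r s a' b' d' e' \<Longrightarrow> a * (- b') \<le> a' * (- b)"
  by (auto simp: nearest_def)

lemma nearest_sym: "nearest K p q r s a b d e \<Longrightarrow> nearest K p q s r a b e d"
  unfolding nearest_def using crosses_sym by blast

lemma nearest_unique:
  assumes K: "geodesic_set K" and n: "nearest K p q r s a b d e" "nearest K p q r s a' b' d' e'"
  obtains t where "t > 0" "a' = t * a" "b' = t * b" "d' = t * d" "e' = t * e"
proof -
  have "a * b' = a' * b" using nearest_le[OF n(1) nearest_crosses[OF n(2)]] nearest_le[OF n(2) nearest_crosses[OF n(1)]] by linarith
  then show ?thesis using crosses_unique[OF K nearest_crosses[OF n(1)] nearest_crosses[OF n(2)]] that by blast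
qed

lemma nearest_scale:
  assumes n: "nearest K p q r s a b d e" and t: "t > 0"
  shows "nearest K p q r s (t * a) (t * b) (t * d) (t * e)"
  unfolding nearest_def
proof (intro conjI allI impI)
  show "crosses K p q r s (t * a) (t * b) (t * d) (t * e)" using nearest_crosses[OF n] t by (rule crosses_scale[rotated])
  fix a' b' d' e' assume "crosses K p q r s a' b' d' e'"
  then have "a * (- b') \<le> a' * (- b)" using n by (rule nearest_le[rotated])
  then have "t * (a * (- b')) \<le> t * (a' * (- b))" using t by (intro mult_left_mono) auto
  then show "t * a * - b' \<le> a' * - (t * b)" by (simp add: algebra_simps)
qed

text \<open>If the arc from the nearest crossing did not cut off p, it would end on
  \<open>qr\<close> and cross an arc that does cut off p. It also meets \<open>pr\<close> at the
  nearest crossing: an arc through a nearer one would have to cross it, whether it returns to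
  \<open>pq\<close>, no nearer to p, or ends on \<open>qr\<close>.\<close>

lemma nearest_turn:
  assumes K: "geodesic_set K" and c: "cut K p q r s" and n: "nearest K p q r s a b d e"
  shows "d < 0" "nearest K p r q s a d b (k * (a + d) - b)"
proof -
  note A = nearest_crosses[OF n]
  have sg: "a > 0" "b < 0" "d \<noteq> 0" using A crosses_nz[OF A] by (auto simp: crosses_def)
  show d: "d < 0"
  proof (rule ccontr)
    assume "\<not> d < 0"
    then have d: "d > 0" using sg by simp
    obtain a1 b1 d1 e1 where A1: "crosses K p q r s a1 b1 d1 e1" "d1 < 0" using c by (auto simp: cut_def)
    have s1: "a1 > 0" "b1 < 0" using A1 by (auto simp: crosses_def)
    have "b * d1 > 0" "d * b1 < 0" "d * a1 > 0" "a * d1 < 0"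
      using sg d A1 s1 by (auto simp: mult_neg_neg mult_pos_neg)
    moreover have "a * b1 - b * a1 \<ge> 0" using nearest_le[OF n A1(1)] by (simp add: algebra_simps)
    ultimately show False using crosses_no_cross[OF K crosses_arc[OF A] crosses_arc[OF A1(1)]] by fastforce
  qed
  show "nearest K p r q s a d b (k * (a + d) - b)" unfolding nearest_def
  proof (intro conjI allI impI)
    show "crosses K p r q s a d b (k * (a + d) - b)" by (rule crosses_turn_neg[OF K A d])
    fix a2 b2 d2 e2 assume A2: "crosses K p r q s a2 b2 d2 e2"
    have s2: "a2 > 0" "b2 < 0" "d2 \<noteq> 0" using A2 crosses_nz[OF A2] by (auto simp: crosses_def)
    have arc2: "has_arc K p q r s a2 d2 b2" using crosses_arc[OF A2] has_arc_perm(2) by simp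
    show "a * - b2 \<le> a2 * - d"
    proof (rule ccontr)
      assume "\<not> a * - b2 \<le> a2 * - d"
      then have X2: "d * a2 - a * b2 > 0" by (simp add: algebra_simps)
      show False
      proof (cases "d2 < 0")
        case True
        have "a * (- d2) \<le> a2 * (- b)" using nearest_le[OF n crosses_turn_neg[OF K A2 True]] .
        then have X3: "a * d2 - b * a2 \<ge> 0" by (simp add: algebra_simps)
        have "(- d) * (- d2) < (- b2) * (- b)"
          using mult_chain_less[of "- d" a2 "- b2" a "- d2" "- b"] X2 X3 sg s2 d True by (simp add: algebra_simps)
        then have X1: "b * b2 - d * d2 > 0" by (simp add: algebra_simps)
        show False by (rule crosses_no_cross[OF K crosses_arc[OF A] arc2]) (use X1 X2 X3 in auto)
      next
        case False
        then have "d2 > 0" using s2 by simp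
        then have "b * b2 > 0" "d * d2 < 0" "a * d2 > 0" "b * a2 < 0"
          using sg s2 d by (auto simp: mult_neg_neg mult_neg_pos)
        then show False by (intro crosses_no_cross[OF K crosses_arc[OF A] arc2]) (use X2 in auto)
      qed
    qed
  qed
qed

section \<open>Curves around a vertex and curves that miss an edge\<close>

definition allcut :: "(real ^ 4) set \<Rightarrow> real ^ 4 \<Rightarrow> real ^ 4 \<Rightarrow> real ^ 4 \<Rightarrow> real ^ 4 \<Rightarrow> bool" where
  "allcut K p q r s \<longleftrightarrow> cut K p q r s \<and> cut K p q s r \<and> cut K p r s q"

lemma nearest_cut_ex:
  assumes "geodesic_set K" "crossed K p q" "labelling p q r s"
  obtains a b d e where "nearest K p q r s a b d e"
  using crossed_labelling[OF assms(2,3)] nearest_ex[OF assms(1)] by metis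

text \<open>By \<open>k_c\<close> the number \<open>k / (2 - k)\<close> is c, so the values are
  those of the inner product with p: at this crossing the curve runs along the circle of radius pi/2
  around p.\<close>

lemma allcut_solution:
  assumes K: "geodesic_set K" and c: "allcut K p q r s"
  shows "crosses K p q r s 1 (k / (2 - k)) (k / (2 - k)) (k / (2 - k))"
proof -
  have c': "cut K p q r s" "cut K p q s r" "cut K p r s q" using c by (auto simp: allcut_def)
  have l: "labelling p q r s" using c'(1) crosses_labelling unfolding cut_def by blast
  have "crossed K p q" using c'(1) unfolding cut_def crossed_def by blast
  then obtain a b d e where n: "nearest K p q r s a b d e" by (rule nearest_cut_ex[OF K _ l])
  define x y where "x = k * (a + d) - b" and "y = k * (a + e) - b"
  have nr: "nearest K p r q s a d b x" using nearest_turn(2)[OF K c'(1) n] by (simp add: x_def)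
  have ns: "nearest K p s q r a e b y" using nearest_turn(2)[OF K c'(2) nearest_sym[OF n]] by (simp add: y_def)
  have ns': "nearest K p s r q a x d (k * (a + x) - d)" using nearest_turn(2)[OF K c'(3) nearest_sym[OF nr]] .
  \<comment> \<open>The edge \<open>ps\<close> is reached both ways around p. The value at p is a on
    either way, so the factor is 1.\<close>
  obtain t where t: "a = t * a" "x = t * e" "d = t * y" by (rule nearest_unique[OF K nearest_sym[OF ns] ns'])
  have a: "a > 0" using nearest_crosses[OF n] by (simp add: crosses_def)
  then have "t = 1" using t(1) by simp
  then have e1: "e = k * (a + d) - b" and e2: "d = k * (a + e) - b" using t by (auto simp: x_def y_def)
  have e3: "d + e = k * (a + b)" using nearest_crosses[OF n] by (simp add: crosses_def)
  have kk: "1 + k > 0" "2 - k > 0" using k_bounds by auto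
  have "e = k * a + k * d - b" "d = k * a + k * e - b" using e1 e2 by (simp_all only: distrib_left)
  moreover have "(1 + k) * (e - d) = (e - d) + (k * e - k * d)" by (simp add: algebra_simps)
  ultimately have "(1 + k) * (e - d) = 0" by linarith
  then have de: "e = d" using kk by simp
  have "d = k * a + k * d - b" "d + d = k * a + k * b" using e1 e3 unfolding de by (simp_all only: distrib_left)
  moreover have "(1 + k) * (d - b) = (d - b) + (k * d - k * b)" by (simp add: algebra_simps)
  ultimately have "(1 + k) * (d - b) = 0" by linarith
  then have db: "d = b" using kk by simp
  have "b * (2 - k) = k * a" using e3 unfolding de db by (simp add: algebra_simps)
  then have b: "b = a * (k / (2 - k))" using kk by (simp add: field_simps)
  have "crosses K p q r s (1 / a * a) (1 / a * b) (1 / a * d) (1 / a * e)"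
    using nearest_crosses[OF n] a by (intro crosses_scale) auto
  moreover have "1 / a * b = k / (2 - k)" using b a by simp
  ultimately show ?thesis using de db a by simp
qed

definition nocap :: "(real ^ 4) set \<Rightarrow> bool" where
  "nocap K \<longleftrightarrow> (\<forall>p q r s. \<not> allcut K p q r s)"

lemma nocapD:
  assumes "geodesic_set K" "nocap K" "cut K p q r s" "cut K p q s r" "cut K p r s q"
  shows False
  using assms by (auto simp: nocap_def allcut_def)

text \<open>Two uncrossed edges at p leave \<open>qr\<close> uncrossed too. A crossing of
  \<open>ps\<close> would then force all three corners at s to be cut, against \<open>nocap\<close>;
  without it no edge at all is crossed.\<close>

lemma uncrossed_other:
  assumes K: "geodesic_set K" and nc: "nocap K" and l: "labelling p q r s" and un: "\<not> crossed K p q"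
  shows "crossed K p r"
proof (rule ccontr)
  assume np: "\<not> crossed K p r"
  have ls: "labelling q r p s" "labelling p s q r" "labelling p s r q" "labelling q s r p" "labelling q s p r" "labelling r s p q"
    using l by (auto intro: labelling_perm)
  have cs: "crossed K a b \<longleftrightarrow> crossed K b a" for a b using crossed_sym by blast
  have nq: "\<not> crossed K q r"
    using crossed_cut[OF K ls(1)] cut_crossed[OF K] un np cs by metis
  have ps: "\<not> crossed K p s"
  proof
    assume c: "crossed K p s"
    have 1: "cut K s p q r" using crossed_cut[OF K ls(2) c] cut_crossed[OF K] un cs by metis
    have 2: "cut K s p r q" using crossed_cut[OF K ls(3) c] cut_crossed[OF K] np cs by metis
    have "crossed K q s" using 1 cut_crossed[OF K] cs by metis
    then have 3: "cut K s q r p" using crossed_cut[OF K ls(4)] cut_crossed[OF K] nq cs by metis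
    show False using nocapD[OF K nc 1 2 3] .
  qed
  have qs: "\<not> crossed K q s"
    using crossed_cut[OF K ls(5)] cut_crossed[OF K] un ps cs by metis
  have rs: "\<not> crossed K r s"
    using crossed_cut[OF K ls(6)] cut_crossed[OF K] np ps cs by metis
  obtain u v where "crossed K u v" using crossed_exists[OF K] by blast
  moreover from this have "u \<in> V \<and> v \<in> V \<and> u \<noteq> v" by (rule crossed_in)
  ultimately have "u \<in> {p, q, r, s}" "v \<in> {p, q, r, s}" "u \<noteq> v" "crossed K u v" using l by (auto simp: labelling_def)
  then show False using un np nq ps qs rs cs by auto
qed

text \<open>Otherwise the arcs through \<open>pr\<close> and \<open>ps\<close> cut two corners at r
  and two at s. An arc through \<open>rs\<close> in the face \<open>qrs\<close> cuts the third
  corner at one of them.\<close>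

lemma uncrossed_cut:
  assumes K: "geodesic_set K" and nc: "nocap K" and l: "labelling p q r s" and un: "\<not> crossed K p q"
  shows "cut K p r s q"
proof (rule ccontr)
  assume n: "\<not> cut K p r s q"
  have ls: "labelling p q s r" "labelling p r s q" "labelling p s r q" "labelling p r q s" "labelling p s q r" "labelling r s q p"
    using l by (auto intro: labelling_perm)
  have pr: "crossed K p r" and ps: "crossed K p s"
    using uncrossed_other[OF K nc l un] uncrossed_other[OF K nc ls(1) un] .
  have 1: "cut K r p s q" using crossed_cut[OF K ls(2) pr] n by blast
  have 2: "cut K s p r q" using crossed_cut[OF K ls(3) ps] n cut_sym[OF K] by blast
  have 3: "cut K r p q s" using crossed_cut[OF K ls(4) pr] cut_crossed[OF K] un by blast
  have 4: "cut K s p q r" using crossed_cut[OF K ls(5) ps] cut_crossed[OF K] un by blast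
  have "crossed K r s" using 1 cut_crossed[OF K] by blast
  then have "cut K r s q p \<or> cut K s r q p" by (rule crossed_cut[OF K ls(6)])
  then show False
    using nocapD[OF K nc 3 1] nocapD[OF K nc 4 2] cut_sym[OF K] by blast
qed

definition dev_form :: "real \<Rightarrow> real \<Rightarrow> real \<Rightarrow> real" where
  "dev_form x y z = x\<^sup>2 + y\<^sup>2 + z\<^sup>2 - k / (2 + k) * (x + y + z)\<^sup>2"

lemma dev_form_perm: "dev_form x y z = dev_form y x z" "dev_form x y z = dev_form x z y"
  by (simp_all add: dev_form_def algebra_simps)

lemma dev_form_scale: "dev_form (t * x) (t * y) (t * z) = t\<^sup>2 * dev_form x y z"
  by (simp add: dev_form_def power2_eq_square algebra_simps)

text \<open>\<open>dev_form\<close> is a multiple of the squared norm of the vector that represents the linear form, so it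
  does not change under the development.\<close>

lemma dev_form_reflect:
  assumes "z + z' = k * (x + y)"
  shows "dev_form x y z' = dev_form x y z"
proof -
  have k2: "2 + k > 0" using k_bounds by auto
  have z': "z' = k * (x + y) - z" using assms by simp
  define \<kappa> where "\<kappa> = k / (2 + k)"
  have \<kappa>: "\<kappa> * (2 + k) = k" using k2 by (simp add: \<kappa>_def)
  have "dev_form x y z' - dev_form x y z = (z' - z) * ((z' + z) - \<kappa> * (2 * (x + y) + (z + z')))"
    unfolding dev_form_def \<kappa>_def[symmetric] by (simp add: power2_eq_square algebra_simps)
  also have "(z' + z) - \<kappa> * (2 * (x + y) + (z + z')) = k * (x + y) - \<kappa> * (2 + k) * (x + y)"
    using assms by (simp add: algebra_simps)
  also have "\<dots> = 0" unfolding \<kappa> by simp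
  finally show ?thesis by simp
qed

text \<open>As \<open>k < 1\<close>, the factor \<open>k / (2 + k)\<close> is below 1/3, while the
  square of the sum is at most three times the sum of squares.\<close>

lemma dev_form_pos:
  assumes "x \<noteq> 0"
  shows "dev_form x y z > 0"
proof -
  have k2: "2 + k > 0" using k_bounds by auto
  have pos: "x\<^sup>2 + y\<^sup>2 + z\<^sup>2 > 0" using assms by (intro add_pos_nonneg) auto
  have s3: "(x + y + z)\<^sup>2 \<le> 3 * (x\<^sup>2 + y\<^sup>2 + z\<^sup>2)"
  proof -
    have "3 * (x\<^sup>2 + y\<^sup>2 + z\<^sup>2) - (x + y + z)\<^sup>2 = (x - y)\<^sup>2 + (y - z)\<^sup>2 + (z - x)\<^sup>2"
      by (simp add: power2_eq_square algebra_simps)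
    then show ?thesis by (smt (verit) zero_le_power2)
  qed
  show ?thesis
  proof (cases "k \<le> 0")
    case True
    then have "k / (2 + k) * (x + y + z)\<^sup>2 \<le> 0" using k2 by (intro mult_nonpos_nonneg divide_nonpos_pos) auto
    then show ?thesis using pos by (simp add: dev_form_def)
  next
    case False
    define \<kappa> where "\<kappa> = k / (2 + k)"
    have \<kappa>: "0 \<le> \<kappa>" "\<kappa> < 1 / 3" using k2 k_bounds False by (simp_all add: \<kappa>_def field_simps)
    have "\<kappa> * (x + y + z)\<^sup>2 \<le> \<kappa> * (3 * (x\<^sup>2 + y\<^sup>2 + z\<^sup>2))"
      using \<kappa> s3 by (intro mult_left_mono) auto
    also have "\<dots> < 1 / 3 * (3 * (x\<^sup>2 + y\<^sup>2 + z\<^sup>2))"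
      using pos \<kappa> by (intro mult_strict_right_mono) auto
    finally show ?thesis unfolding dev_form_def \<kappa>_def[symmetric] by simp
  qed
qed

text \<open>In both faces at the uncrossed edge \<open>pq\<close> the arc nearest to p is also the
  arc nearest to q. The curve is thus followed through a closed circuit of four crossings, and the
  resulting linear system has a single solution up to scale.\<close>

lemma uncrossed_solution:
  assumes K: "geodesic_set K" and nc: "nocap K" and l: "labelling p q r s" and un: "\<not> crossed K p q"
  shows "crosses K p r q s 1 (- 1) 1 (- 1)"
proof -
  have ls: "labelling p r q s" "labelling q p r s" "labelling q r p s" using l by (auto intro: labelling_perm)
  have un': "\<not> crossed K q p" using un crossed_sym by blast
  obtain a b d e where n: "nearest K p r q s a b d e"
    using nearest_cut_ex[OF K uncrossed_other[OF K nc l un] ls(1)] by metis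
  define d' where "d' = k * (a + e) - b"
  note A = nearest_crosses[OF n]
  have e: "e < 0" and n': "nearest K p s r q a e b d'"
    using nearest_turn[OF K uncrossed_cut[OF K nc l un] nearest_sym[OF n]] by (auto simp: d'_def)
  note A' = nearest_crosses[OF n']
  have sg: "a > 0" "b < 0" "d + e = k * (a + b)" using A by (auto simp: crosses_def)
  have d: "d > 0" using crosses_nz[OF A] crosses_cut_neg[OF A] cut_crossed[OF K] un by (metis linorder_neqE_linordered_idom)
  have d': "d' > 0" using crosses_nz[OF A'] crosses_cut_neg[OF crosses_sym[OF A']] cut_crossed[OF K] un by (metis linorder_neqE_linordered_idom)
  obtain a2 b2 d2 e2 where m: "nearest K q r p s a2 b2 d2 e2"
    using nearest_cut_ex[OF K uncrossed_other[OF K nc ls(2) un'] ls(3)] by metis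
  define d2' where "d2' = k * (a2 + e2) - b2"
  note B = nearest_crosses[OF m]
  have e2: "e2 < 0" and m': "nearest K q s r p a2 e2 b2 d2'"
    using nearest_turn[OF K uncrossed_cut[OF K nc ls(2) un'] nearest_sym[OF m]] by (auto simp: d2'_def)
  note B' = nearest_crosses[OF m']
  have sg2: "a2 > 0" "b2 < 0" "d2 + e2 = k * (a2 + b2)" using B by (auto simp: crosses_def)
  have d2: "d2 > 0" using crosses_nz[OF B] crosses_cut_neg[OF B] cut_crossed[OF K] un' by (metis linorder_neqE_linordered_idom)
  have d2': "d2' > 0" using crosses_nz[OF B'] crosses_cut_neg[OF crosses_sym[OF B']] cut_crossed[OF K] un' by (metis linorder_neqE_linordered_idom)
  \<comment> \<open>In the face \<open>pqw\<close> both arcs cut off w; the first is the closest to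
    p and the second the closest to q. As they do not cross, they are the same arc and their forms
    are proportional.\<close>
  have same: "u2 * v = u * x2 \<and> u2 * y = u * y2 \<and> x2 > 0"
    if nf: "nearest K p w q z y u v w1" and ng: "nearest K q w p z x2 u2 y2 w2" and vp: "v > 0" and yp: "y2 > 0"
    for w z y u v w1 x2 u2 y2 w2
  proof -
    note F = nearest_crosses[OF nf] and G = nearest_crosses[OF ng]
    have s: "y > 0" "u < 0" "x2 > 0" "u2 < 0" using F G by (auto simp: crosses_def)
    have 1: "x2 * (- u) \<le> v * (- u2)" using nearest_le[OF ng crosses_turn_pos[OF K F vp]] .
    have 2: "y * (- u2) \<le> y2 * (- u)" using nearest_le[OF nf crosses_turn_pos[OF K G yp]] .
    have 3: "x2 * y \<le> v * y2" by (rule mult_chain_le[OF 1 2]) (use s vp yp in auto)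
    have arcs: "has_arc K q p w z x2 y2 u2" "has_arc K q p w z v y u"
      using crosses_arc[OF F] crosses_arc[OF G] has_arc_perm by metis+
    have "y2 * u - u2 * y = 0 \<and> u2 * v - x2 * u = 0"
      using arcs_no_cross[OF K arcs(2,1)] arcs_no_cross[OF K arcs] 1 2 3 by (simp add: algebra_simps)
    then show ?thesis using s by (simp add: algebra_simps)
  qed
  have s1: "b2 * d = b * a2" "b2 * a = b * d2" using same[OF n m d d2] by auto
  have s2: "e2 * d' = e * a2" "e2 * a = e * d2'" using same[OF nearest_sym[OF n'] nearest_sym[OF m'] d' d2'] by auto
  define la mu where "la = b2 / b" and "mu = e2 / e"
  have lm: "la > 0" "mu > 0" using sg sg2 e e2 by (auto simp: la_def mu_def divide_neg_neg)
  have v1: "b2 = la * b" "a2 = la * d" "d2 = la * a"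
    using s1 sg by (auto simp: la_def field_simps)
  have v2: "e2 = mu * e" "a2 = mu * d'" "d2' = mu * a"
    using s2 e by (auto simp: mu_def field_simps)
  have q: "dev_form a b d = dev_form a b e" "dev_form a e b = dev_form a e d'" "dev_form a2 b2 d2 = dev_form a2 b2 e2" "dev_form a2 e2 b2 = dev_form a2 e2 d2'"
    using dev_form_reflect[of d e a b] dev_form_reflect[of b d' a e] dev_form_reflect[of d2 e2 a2 b2] dev_form_reflect[of b2 d2' a2 e2] sg sg2
    by (auto simp: d'_def d2'_def)
  \<comment> \<open>The factors found in the two faces are compared through the invariant
    \<open>dev_form\<close>; being positive, they are equal.\<close>
  have "la\<^sup>2 * dev_form a b d = dev_form a2 b2 d2" unfolding v1 dev_form_scale using dev_form_perm by metis
  also have "\<dots> = dev_form a2 e2 d2'" using q dev_form_perm by metis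
  also have "\<dots> = mu\<^sup>2 * dev_form a e d'" unfolding v2 dev_form_scale using dev_form_perm by metis
  also have "dev_form a e d' = dev_form a b d" using q dev_form_perm by metis
  finally have "la\<^sup>2 = mu\<^sup>2" using dev_form_pos[of a b d] sg by simp
  then have lmeq: "la = mu" using lm by (simp add: power2_eq_iff)
  then have dd: "d' = d" using v1 v2 lm by simp
  have E1: "a + e = k * (d + b)"
  proof -
    have "la * (a + e) = la * (k * (d + b))" using sg2(3) v1 v2(1) lmeq by (simp add: algebra_simps)
    then show ?thesis using lm by simp
  qed
  have E2: "a + b = k * (d + e)"
  proof -
    have "la * (a + b) = la * (k * (d + e))" using d2'_def v1 v2 lmeq by (simp add: algebra_simps)
    then show ?thesis using lm by simp
  qed
  have E3: "d + b = k * (a + e)" using dd by (simp add: d'_def)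
  have kk: "1 - k\<^sup>2 \<noteq> 0"
  proof -
    have "(1 - k) * (1 + k) > 0" using k_bounds by (intro mult_pos_pos) auto
    then show ?thesis by (simp add: power2_eq_square algebra_simps)
  qed
  have k2: "(1 - k\<^sup>2) * z = z - k * (k * z)" for z by (simp add: power2_eq_square algebra_simps)
  \<comment> \<open>The equations now come in pairs of the type X = k * Y, Y = k * X, which force X
    = 0 because the square of k is not 1.\<close>
  have "a + b = k * (k * (a + b))" using E2 sg(3) by simp
  then have "(1 - k\<^sup>2) * (a + b) = 0" using k2[of "a + b"] by linarith
  then have b: "b = - a" using kk by simp
  have "a + e = k * (k * (a + e))" using E1 E3 by simp
  then have "(1 - k\<^sup>2) * (a + e) = 0" using k2[of "a + e"] by linarith
  then have e: "e = - a" using kk by simp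
  have dv: "d = a" using E3 b e by simp
  have "crosses K p r q s (1 / a * a) (1 / a * b) (1 / a * d) (1 / a * e)" using A sg by (intro crosses_scale) auto
  then show ?thesis using b e dv sg by simp
qed

end

section \<open>Neighbouring strands\<close>

context reg_tetra
begin

definition all_crossed :: "(real ^ 4) set \<Rightarrow> bool" where
  "all_crossed K \<longleftrightarrow> (\<forall>p\<in>V. \<forall>q\<in>V. p \<noteq> q \<longrightarrow> crossed K p q)"

definition uncut :: "(real ^ 4) set \<Rightarrow> real ^ 4 \<Rightarrow> real ^ 4 \<Rightarrow> bool" where
  "uncut K v w \<longleftrightarrow> (\<exists>q r. labelling v q r w \<and> \<not> cut K v q r w)"

lemma uncutI: "labelling v q r w \<Longrightarrow> \<not> cut K v q r w \<Longrightarrow> uncut K v w"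
  unfolding uncut_def by (intro exI conjI)

lemma uncut_labelling:
  assumes "uncut K v w"
  obtains q r where "labelling v q r w" "\<not> cut K v q r w"
proof -
  have "\<exists>q r. labelling v q r w \<and> \<not> cut K v q r w" using assms unfolding uncut_def .
  then obtain q r where "labelling v q r w \<and> \<not> cut K v q r w" by (elim exE)
  then show ?thesis using that[of q r] by simp
qed

lemma uncut_in: "uncut K v w \<Longrightarrow> v \<in> V \<and> w \<in> V \<and> v \<noteq> w"
proof -
  assume "uncut K v w"
  then obtain q r where "labelling v q r w" by (rule uncut_labelling)
  then show ?thesis using labelling_in labelling_neq(3) by simp
qed

lemma uncutD:
  assumes K: "geodesic_set K" and u: "uncut K v w" and l: "labelling v q r w"
  shows "\<not> cut K v q r w"
proof -
  obtain x y where q: "labelling v x y w" "\<not> cut K v x y w" using u by (rule uncut_labelling)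
  have "{x, y} = V - {v, w}" "{q, r} = V - {v, w}" using q(1) l unfolding labelling_def by auto
  then have "(x = q \<and> y = r) \<or> (x = r \<and> y = q)" by (metis doubleton_eq_iff)
  then show ?thesis using q(2) cut_sym[OF K, of v q r w] by auto
qed

lemma uncut_ex:
  assumes K: "geodesic_set K" and nc: "nocap K" and v: "v \<in> V"
  shows "\<exists>w\<in>V. uncut K v w"
proof -
  have "\<not> V \<subseteq> {v}" using card_V card_mono[of "{v}" V] by auto
  then obtain q where q: "q \<in> V" "v \<noteq> q" by blast
  obtain r s where l: "labelling v q r s" using labelling_ex[OF v q] by metis
  then have "labelling v q s r" "labelling v r s q" by (auto intro: labelling_perm)
  then show ?thesis using nocapD[OF K nc, of v q r s] uncutI[OF l, of K] uncutI[of v q s r K] uncutI[of v r s q K] labelling_in[OF l] by meson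
qed

lemma uncut_face_unique:
  assumes K: "geodesic_set K" and ac: "all_crossed K" and u: "uncut K v w" "uncut K v' w"
  shows "v = v'"
proof (rule ccontr)
  assume ne: "v \<noteq> v'"
  have V: "v \<in> V" "v' \<in> V" "w \<in> V" "v \<noteq> w" "v' \<noteq> w" using u[THEN uncut_in] by auto
  obtain r s where lv: "labelling v w r s" using labelling_ex[OF V(1,3,4)] by metis
  have "V = {v, w, r, s}" using lv unfolding labelling_def by simp
  then have "v' = r \<or> v' = s" using V ne by blast
  moreover have "labelling v r s w" "labelling v s r w" using labelling_perm[OF lv] by simp_all
  ultimately obtain r' where l: "labelling v v' r' w" by blast
  then have "labelling v' v r' w" by (auto intro: labelling_perm)
  moreover have "crossed K v v'" using ac V ne by (auto simp: all_crossed_def)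
  ultimately show False using crossed_cut[OF K l] uncutD[OF K u(1) l] uncutD[OF K u(2)] by blast
qed

text \<open>Without a vertex whose corners are all cut, every vertex has an uncut corner; with all
  edges crossed, no face has two of them. Counting leaves exactly one uncut corner at each vertex
  and in each face.\<close>

lemma uncut_bij:
  assumes K: "geodesic_set K" and nc: "nocap K" and ac: "all_crossed K"
  obtains f where "bij_betw f V V" "\<forall>v\<in>V. \<forall>w. uncut K v w \<longleftrightarrow> w = f v"
proof -
  obtain f where f: "\<And>v. v \<in> V \<Longrightarrow> f v \<in> V \<and> uncut K v (f v)" using uncut_ex[OF K nc] by metis
  have inj: "inj_on f V"
  proof (rule inj_onI)
    fix x y assume "x \<in> V" "y \<in> V" "f x = f y"
    then show "x = y" using f uncut_face_unique[OF K ac] by metis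
  qed
  moreover have "f ` V \<subseteq> V" using f by auto
  ultimately have surj: "f ` V = V" using finite_V endo_inj_surj by blast
  have "uncut K v w \<longleftrightarrow> w = f v" if v: "v \<in> V" for v w
  proof
    assume u: "uncut K v w"
    then have "w \<in> V" using uncut_in by simp
    then obtain v' where v': "v' \<in> V" "w = f v'" using surj by blast
    then have "v = v'" using uncut_face_unique[OF K ac u] f by blast
    then show "w = f v" using v' by simp
  qed (use f v in auto)
  then show ?thesis using that[of f] inj surj by (auto simp: bij_betw_def)
qed

text \<open>Some vertex has its uncut corner in the face opposite n, and the corners at l and r
  there are cut, so it is a. The other two corners at a are then cut.\<close>

lemma cap_unique:
  assumes K: "geodesic_set K" and nc: "nocap K" and ac: "all_crossed K" and l: "labelling a l r n"
    and c: "cut K l r a n" "cut K r l a n"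
  shows "\<not> cut K a l r n" "cut K a l n r" "cut K a r n l"
proof -
  obtain f where f0: "bij_betw f V V" "\<forall>v\<in>V. \<forall>w. uncut K v w \<longleftrightarrow> w = f v"
    by (rule uncut_bij[OF K nc ac])
  have f: "bij_betw f V V" "\<And>v w. v \<in> V \<Longrightarrow> uncut K v w \<longleftrightarrow> w = f v" using f0 by auto
  have ls: "labelling l r a n" "labelling r l a n" "labelling a l n r" "labelling a r n l" using l by (auto intro: labelling_perm)
  note V = labelling_in[OF l] and N = labelling_neq[OF l]
  obtain v where v: "v \<in> V" "f v = n" using f(1) V(4) by (metis bij_betw_iff_bijections)
  have "uncut K v n" using f(2) v by simp
  then have "v \<noteq> l" "v \<noteq> r" "v \<noteq> n" using uncutD[OF K _ ls(1)] uncutD[OF K _ ls(2)] c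
    by (metis, metis, metis uncut_in)
  moreover have "V = {a, l, r, n}" using l unfolding labelling_def by simp
  ultimately have "v = a" using v by blast
  then have fa: "f a = n" using v by simp
  show "\<not> cut K a l r n" using uncutD[OF K _ l] f(2)[OF V(1)] fa by simp
  show "cut K a l n r" using uncutI[OF ls(3), of K] f(2)[OF V(1), of r] fa N by auto
  show "cut K a r n l" using uncutI[OF ls(4), of K] f(2)[OF V(1), of l] fa N by auto
qed

lemma cap_start:
  assumes K: "geodesic_set K" and nc: "nocap K" and ac: "all_crossed K"
  obtains a l r n where "labelling a l r n" "cut K l r a n" "cut K r l a n"
proof -
  obtain a where a: "a \<in> V" using card_V by fastforce
  obtain n where n: "n \<in> V" "uncut K a n" using uncut_ex[OF K nc a] by blast
  obtain l r where l: "labelling a l r n" using n(2) by (rule uncut_labelling)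
  then have ls: "labelling l r a n" "labelling r l a n" by (auto intro: labelling_perm)
  have "cut K l r a n" using uncutI[OF ls(1)] uncut_face_unique[OF K ac n(2)] labelling_neq[OF l] by metis
  moreover have "cut K r l a n" using uncutI[OF ls(2)] uncut_face_unique[OF K ac n(2)] labelling_neq[OF l] by metis
  ultimately show ?thesis using that l by blast
qed

text \<open>The linear form \<open>(a, d, b)\<close> on the face \<open>vlr\<close>, continued once around the vertex \<open>v\<close>, returns as
  \<open>(a, x, y)\<close>.\<close>

definition turn :: "real \<Rightarrow> real \<Rightarrow> real \<Rightarrow> real \<Rightarrow> real \<Rightarrow> bool" where
  "turn a d b x y \<longleftrightarrow> x = k * (a + (k * (a + b) - d)) - b \<and> y = k * (a + x) - (k * (a + b) - d)"

text \<open>Only the corner of v in the face \<open>vlr\<close> is uncut. So the nearest crossing of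
  \<open>vr\<close> can be followed around v through the other two faces, and it arrives at the
  nearest crossing of \<open>vl\<close>; t is the free scale of the form chosen there.\<close>

lemma cap_turn:
  assumes K: "geodesic_set K" and nc: "nocap K" and ac: "all_crossed K" and l: "labelling v l r n"
    and c: "cut K l r v n" "cut K r l v n"
    and n1: "nearest K v r l n a b d e" and n2: "nearest K v l r n a' b' d' e'"
  obtains t x y where "t > 0" "a' = t * a" "b' = t * x" "d' = t * y" "turn a d b x y" "d > 0" "y > 0" "x < 0"
proof -
  note cap = cap_unique[OF K nc ac l c]
  note A = nearest_crosses[OF n1] and A' = nearest_crosses[OF n2]
  have d: "d > 0" using crosses_nz[OF A] crosses_cut_neg[OF A] cut_sym[OF K] cap(1) by (metis linorder_neqE_linordered_idom)
  have d': "d' > 0" using crosses_nz[OF A'] crosses_cut_neg[OF A'] cap(1) by (metis linorder_neqE_linordered_idom)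
  define x where "x = k * (a + e) - b"
  have nn: "nearest K v n r l a e b x"
    using nearest_turn(2)[OF K cap(3) nearest_sym[OF n1]] by (simp add: x_def)
  have nn': "nearest K v n l r a' e' b' (k * (a' + e') - b')"
    using nearest_turn(2)[OF K cap(2) nearest_sym[OF n2]] .
  obtain t where t: "t > 0" "a' = t * a" "e' = t * e" "b' = t * x"
    by (rule nearest_unique[OF K nn nearest_sym[OF nn']])
  have e: "e = k * (a + b) - d" using A by (simp add: crosses_def)
  have "d' = k * (a' + b') - e'" using A' by (simp add: crosses_def)
  then have dy: "d' = t * (k * (a + x) - e)" using t by (simp add: algebra_simps)
  have "turn a d b x (k * (a + x) - e)" unfolding turn_def by (simp add: x_def e)
  moreover have "k * (a + x) - e > 0" using dy d' t by (simp add: zero_less_mult_iff)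
  moreover have "x < 0" using A' t by (simp add: crosses_def mult_less_0_iff)
  ultimately show ?thesis using that[OF t(1,2,4) dy] d by blast
qed

text \<open>The numbers X1, X2, X3 form the vector product of the two coefficient vectors, so
  \<open>a * X1 + b * X2 + d * X3 = 0\<close>. If X2 and X3 had the same weak sign, X1 would have it
  too and the arcs would cross. Thus the order of the two strands on one edge at p determines their
  order on the other.\<close>

lemma cut_opposite:
  assumes K: "geodesic_set K" and f: "has_arc K p q r s a b d" "has_arc K p q r s a' b' d'" and sg: "a * b < 0" "a * d < 0"
  shows "d * a' - a * d' > 0 \<longleftrightarrow> a * b' - b * a' < 0" "d * a' - a * d' < 0 \<longleftrightarrow> a * b' - b * a' > 0"
proof -
  define X1 X2 X3 where "X1 = b * d' - d * b'" and "X2 = d * a' - a * d'" and "X3 = a * b' - b * a'"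
  have "a * X1 + b * X2 + d * X3 = 0" by (simp add: X1_def X2_def X3_def algebra_simps)
  then have "a * (a * X1 + b * X2 + d * X3) = 0" by simp
  then have X: "(a * a) * X1 = - ((a * b) * X2) - (a * d) * X3" by (simp add: algebra_simps)
  have a0: "a \<noteq> 0" using sg by auto
  then have aa: "a * a > 0" using not_square_less_zero[of a] by (simp add: less_le)
  have nn: "X1 > 0 \<or> X1 = 0 \<and> X2 = 0 \<and> X3 = 0" if "X2 \<ge> 0" "X3 \<ge> 0"
  proof -
    have 1: "- ((a * b) * X2) \<ge> 0" "- ((a * d) * X3) \<ge> 0" using sg that by (auto simp: mult_nonpos_nonneg)
    show ?thesis
    proof (cases "X2 = 0 \<and> X3 = 0")
      case True
      then show ?thesis using X a0 by simp
    next
      case False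
      then have "X2 > 0 \<or> X3 > 0" using that by linarith
      then have "(a * b) * X2 < 0 \<or> (a * d) * X3 < 0" using mult_neg_pos[OF sg(1)] mult_neg_pos[OF sg(2)] by blast
      then have "(a * a) * X1 > 0" using X 1 by linarith
      then show ?thesis using aa by (simp add: zero_less_mult_iff)
    qed
  qed
  have np: "X1 < 0 \<or> X1 = 0 \<and> X2 = 0 \<and> X3 = 0" if "X2 \<le> 0" "X3 \<le> 0"
  proof -
    have 1: "- ((a * b) * X2) \<le> 0" "- ((a * d) * X3) \<le> 0" using sg that by (auto simp: mult_nonpos_nonpos)
    show ?thesis
    proof (cases "X2 = 0 \<and> X3 = 0")
      case True
      then show ?thesis using X a0 by simp
    next
      case False
      then have "X2 < 0 \<or> X3 < 0" using that by linarith
      then have "(a * b) * X2 > 0 \<or> (a * d) * X3 > 0" using mult_neg_neg[OF sg(1)] mult_neg_neg[OF sg(2)] by blast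
      then have "(a * a) * X1 < 0" using X 1 by linarith
      then show ?thesis using aa by (simp add: mult_less_0_iff)
    qed
  qed
  have P: "X2 = 0 \<and> X3 = 0" if "X2 \<ge> 0" "X3 \<ge> 0"
    using nn[OF that] arcs_no_cross[OF K f] that unfolding X1_def X2_def X3_def by linarith
  have N: "X2 = 0 \<and> X3 = 0" if "X2 \<le> 0" "X3 \<le> 0"
    using np[OF that] arcs_no_cross[OF K f(2,1)] that unfolding X1_def X2_def X3_def by (simp add: algebra_simps) linarith
  show "d * a' - a * d' > 0 \<longleftrightarrow> a * b' - b * a' < 0"
    unfolding X2_def[symmetric] X3_def[symmetric] using P N by (smt (verit))
  show "d * a' - a * d' < 0 \<longleftrightarrow> a * b' - b * a' > 0"
    unfolding X2_def[symmetric] X3_def[symmetric] using P N by (smt (verit))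
qed

lemma cut_opposite2:
  assumes K: "geodesic_set K" and f: "has_arc K p q r s a b d" "has_arc K p q r s a' b' d'" and sg: "b * a < 0" "b * d < 0"
  shows "b * d' - d * b' > 0 \<longleftrightarrow> a * b' - b * a' < 0" "b * d' - d * b' < 0 \<longleftrightarrow> a * b' - b * a' > 0"
  using cut_opposite[OF K, of q p r s b a d b' a' d'] f has_arc_perm(1)[of K p q r s] sg by auto

lemma cut_opposite3:
  assumes K: "geodesic_set K" and f: "has_arc K p q r s a b d" "has_arc K p q r s a' b' d'" and sg: "d * a < 0" "d * b < 0"
  shows "b * d' - d * b' > 0 \<longleftrightarrow> d * a' - a * d' < 0" "b * d' - d * b' < 0 \<longleftrightarrow> d * a' - a * d' > 0"
  using cut_opposite2[OF K, of p r q s a d b a' d' b'] f has_arc_perm(2)[of K p q r s] sg by auto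

text \<open>Two strands of the curve that cross the edge \<open>lr\<close> next to each other.  The second one is
  oriented against the first one, so that the region between them lies where both forms are positive.\<close>

definition Pair :: "(real ^ 4) set \<Rightarrow> real ^ 4 \<Rightarrow> real ^ 4 \<Rightarrow> real ^ 4 \<Rightarrow> real ^ 4 \<Rightarrow>
    real \<Rightarrow> real \<Rightarrow> real \<Rightarrow> real \<Rightarrow> real \<Rightarrow> real \<Rightarrow> bool" where
  "Pair K l r u n a b d a' b' d' \<longleftrightarrow>
     crosses K l r u n a b d (k * (a + b) - d) \<and> crosses K r l u n b' a' d' (k * (a' + b') - d') \<and> a * b' - a' * b > 0 \<and>
     (\<forall>g1 g2 g3 g4. crosses K l r u n g1 g2 g3 g4 \<longrightarrow> \<not> (b * g1 > a * g2 \<and> b' * g1 > a' * g2))"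

lemma Pair_mirror:
  assumes "Pair K l r u n a b d a' b' d'"
  shows "Pair K r l u n b' a' d' b a d"
  unfolding Pair_def
proof (intro conjI allI impI)
  show "crosses K r l u n b' a' d' (k * (b' + a') - d')" "crosses K l r u n a b d (k * (b + a) - d)" "b' * a - b * a' > 0"
    using assms by (simp_all add: Pair_def algebra_simps)
  fix g1 g2 g3 g4 assume "crosses K r l u n g1 g2 g3 g4"
  then have "crosses K l r u n (- g2) (- g1) (- g3) (- g4)" by (rule crosses_neg)
  then have "\<not> (b * (- g2) > a * (- g1) \<and> b' * (- g2) > a' * (- g1))"
    using assms unfolding Pair_def by blast
  then show "\<not> (a' * g1 > b' * g2 \<and> a * g1 > b * g2)" by auto
qed

lemma Pair_signs:
  assumes "Pair K l r u n a b d a' b' d'"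
  shows "a > 0" "b < 0" "a' < 0" "b' > 0" "labelling l r u n"
    "has_arc K l r n u a b (k * (a + b) - d)" "has_arc K l r n u a' b' (k * (a' + b') - d')"
    "k * (a + b) - d \<noteq> 0" "k * (a' + b') - d' \<noteq> 0"
proof -
  have A: "crosses K l r u n a b d (k * (a + b) - d)" and A': "crosses K r l u n b' a' d' (k * (a' + b') - d')"
    using assms by (auto simp: Pair_def)
  show "a > 0" "b < 0" "a' < 0" "b' > 0" using A A' by (auto simp: crosses_def)
  show "labelling l r u n" by (rule crosses_labelling[OF A])
  show "has_arc K l r n u a b (k * (a + b) - d)" by (rule crosses_arc'[OF A])
  show "has_arc K l r n u a' b' (k * (a' + b') - d')" using crosses_arc'[OF A'] has_arc_perm(1) by simp
  show "k * (a + b) - d \<noteq> 0" "k * (a' + b') - d' \<noteq> 0" using crosses_nz[OF A] crosses_nz[OF A'] by auto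
qed

text \<open>Both forms change sign between n and r, so both strands leave through \<open>nr\<close>.
  A strand crossing \<open>nr\<close> between them would, followed backwards, cross
  \<open>lr\<close> between them as well.\<close>

lemma Pair_step:
  assumes K: "geodesic_set K" and P: "Pair K l r u n a b d a' b' d'"
    and N: "k * (a + b) - d > 0" "k * (a' + b') - d' < 0"
  shows "Pair K n r l u (k * (a + b) - d) b a (k * (a' + b') - d') b' a'"
proof -
  define e e' where "e = k * (a + b) - d" and "e' = k * (a' + b') - d'"
  have A: "crosses K l r u n a b d e" and A': "crosses K r l u n b' a' d' e'" and det: "a * b' - a' * b > 0"
    and gap: "\<And>g1 g2 g3 g4. crosses K l r u n g1 g2 g3 g4 \<Longrightarrow> \<not> (b * g1 > a * g2 \<and> b' * g1 > a' * g2)"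
    using P by (auto simp: Pair_def e_def e'_def)
  have sg: "a > 0" "b < 0" "a' < 0" "b' > 0" "e > 0" "e' < 0" using Pair_signs[OF P] N by (auto simp: e_def e'_def)
  have arcs: "has_arc K l r n u a b e" "has_arc K l r n u a' b' e'" using Pair_signs[OF P] by (auto simp: e_def e'_def)
  have neg: "b * a < 0" "b * e < 0" "b' * a' < 0" "b' * e' < 0" using sg by (auto simp: mult_neg_pos mult_pos_neg)
  have B: "crosses K n r l u e b a (k * (e + b) - a)" by (rule crosses_step[OF K A sg(5)])
  have B': "crosses K r n l u b' e' a' (k * (b' + e') - a')" by (rule crosses_step_neg[OF K A' sg(6)])
  have "b * e' - e * b' < 0" using cut_opposite2(2)[OF K arcs neg(1,2)] det by (simp add: algebra_simps)
  then have det2: "e * b' - e' * b > 0" by (simp add: algebra_simps)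
  have gap2: "\<not> (b * g1 > e * g2 \<and> b' * g1 > e' * g2)" if G: "crosses K n r l u g1 g2 g3 g4" for g1 g2 g3 g4
  proof
    assume h: "b * g1 > e * g2 \<and> b' * g1 > e' * g2"
    have s: "g1 > 0" "g2 < 0" "g3 \<noteq> 0" using G crosses_nz[OF G] by (auto simp: crosses_def)
    have ga: "has_arc K l r n u g3 g2 g1" using crosses_arc[OF G] has_arc_perm by metis
    have 1: "a * g2 - b * g3 < 0" using cut_opposite2(1)[OF K arcs(1) ga neg(1,2)] h by simp
    have 2: "a' * g2 - b' * g3 < 0" using cut_opposite2(1)[OF K arcs(2) ga neg(3,4)] h by simp
    have "g3 > 0"
    proof (rule ccontr)
      assume "\<not> g3 > 0"
      then have "b' * g3 < 0" "a' * g2 > 0" using s sg by (auto simp: mult_pos_neg mult_neg_neg)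
      then show False using 2 by linarith
    qed
    then have "crosses K l r u n g3 g2 (k * (g3 + g2) - g1) g1" using crosses_sym[OF crosses_turn_pos[OF K G]] by simp
    then show False using gap 1 2 by fastforce
  qed
  show ?thesis unfolding Pair_def e_def[symmetric] e'_def[symmetric]
    using B B' det2 gap2 by (auto simp: add.commute)
qed

lemma Pair_step':
  assumes K: "geodesic_set K" and P: "Pair K l r u n a b d a' b' d'"
    and N: "k * (a + b) - d < 0" "k * (a' + b') - d' > 0"
  shows "Pair K l n r u a (k * (a + b) - d) b a' (k * (a' + b') - d') b'"
  using Pair_mirror[OF Pair_step[OF K Pair_mirror[OF P]]] N by (simp add: add.commute)

text \<open>By the determinant the first strand crosses \<open>lr\<close> closer to r than the
  second does. Here the first would leave through \<open>ln\<close> and the second through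
  \<open>rn\<close>, so they would have to cross.\<close>

lemma Pair_not_both_neg:
  assumes K: "geodesic_set K" and P: "Pair K l r u n a b d a' b' d'"
    and N: "k * (a + b) - d < 0" "k * (a' + b') - d' < 0"
  shows False
proof -
  define e e' where "e = k * (a + b) - d" and "e' = k * (a' + b') - d'"
  have sg: "a > 0" "b < 0" "a' < 0" "b' > 0" "e < 0" "e' < 0" using Pair_signs[OF P] N by (auto simp: e_def e'_def)
  have arcs: "has_arc K l r n u a b e" "has_arc K l r n u a' b' e'" using Pair_signs[OF P] by (auto simp: e_def e'_def)
  have det: "a * b' - b * a' > 0" using P by (simp add: Pair_def algebra_simps)
  have "a * b < 0" "a * e < 0" using sg by (auto simp: mult_pos_neg)
  then have "e * a' - a * e' < 0" using cut_opposite(2)[OF K arcs] det by simp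
  moreover have "e * a' > 0" "a * e' < 0" using sg by (auto simp: mult_neg_neg mult_pos_neg)
  ultimately show False by linarith
qed

text \<open>The strands part at n, cutting the corners r and l, so by \<open>cap_unique\<close> the
  corner n is not cut. A crossing of \<open>nr\<close> closer to n would then lead back to
  \<open>lr\<close>, between the two strands, against the last clause of
  \<open>Pair\<close>.\<close>

lemma Pair_end_nearest:
  assumes K: "geodesic_set K" and nc: "nocap K" and ac: "all_crossed K" and P: "Pair K l r u n a b d a' b' d'"
    and N: "k * (a + b) - d > 0" "k * (a' + b') - d' > 0"
  shows "cut K r l n u" "cut K l r n u"
    "nearest K n r l u (k * (a + b) - d) b a (k * ((k * (a + b) - d) + b) - a)"
proof -
  define e e' where "e = k * (a + b) - d" and "e' = k * (a' + b') - d'"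
  have A: "crosses K l r u n a b d e" and A': "crosses K r l u n b' a' d' e'"
    and gap: "\<And>g1 g2 g3 g4. crosses K l r u n g1 g2 g3 g4 \<Longrightarrow> \<not> (b * g1 > a * g2 \<and> b' * g1 > a' * g2)"
    using P by (auto simp: Pair_def e_def e'_def)
  have sg: "a > 0" "b < 0" "a' < 0" "b' > 0" "e > 0" "e' > 0" using Pair_signs[OF P] N by (auto simp: e_def e'_def)
  have arcs: "has_arc K l r n u a b e" "has_arc K l r n u a' b' e'" using Pair_signs[OF P] by (auto simp: e_def e'_def)
  have neg: "b * a < 0" "b * e < 0" "a' * b' < 0" "a' * e' < 0" using sg by (auto simp: mult_neg_pos)
  show c1: "cut K r l n u" using crosses_cut_pos[OF K crosses_sym[OF A] sg(5)] cut_sym[OF K] by blast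
  show c2: "cut K l r n u" using crosses_cut_pos[OF K crosses_sym[OF A'] sg(6)] cut_sym[OF K] by blast
  have l: "labelling n l r u" using crosses_labelling[OF A] by (auto intro: labelling_perm)
  have nn: "\<not> cut K n l r u"
    using cap_unique(1)[OF K nc ac l] c1 c2 cut_sym[OF K] by blast
  have "nearest K n r l u e b a (k * (e + b) - a)" unfolding nearest_def
  proof (intro conjI allI impI)
    show "crosses K n r l u e b a (k * (e + b) - a)" by (rule crosses_step[OF K A sg(5)])
    fix g1 g2 g3 g4 assume G: "crosses K n r l u g1 g2 g3 g4"
    have s: "g1 > 0" "g2 < 0" "g3 \<noteq> 0" using G crosses_nz[OF G] by (auto simp: crosses_def)
    have "\<not> g3 < 0" using crosses_cut_neg[OF G] cut_sym[OF K] nn by blast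
    then have g3: "g3 > 0" using s by simp
    have ga: "has_arc K l r n u g3 g2 g1" using crosses_arc[OF G] has_arc_perm by metis
    show "e * - g2 \<le> g1 * - b"
    proof (rule ccontr)
      assume "\<not> e * - g2 \<le> g1 * - b"
      then have "b * g1 - e * g2 > 0" by (simp add: algebra_simps)
      then have 1: "a * g2 - b * g3 < 0" using cut_opposite2(1)[OF K arcs(1) ga neg(1,2)] by simp
      have "e' * g3 > 0" "a' * g1 < 0" using s sg g3 by (auto simp: mult_neg_pos)
      then have "e' * g3 - a' * g1 > 0" by linarith
      then have 2: "a' * g2 - b' * g3 < 0" using cut_opposite(1)[OF K arcs(2) ga neg(3,4)] by simp
      have "crosses K l r u n g3 g2 (k * (g3 + g2) - g1) g1" using crosses_sym[OF crosses_turn_pos[OF K G g3]] by simp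
      then show False using gap 1 2 by fastforce
    qed
  qed
  then show "nearest K n r l u (k * (a + b) - d) b a (k * ((k * (a + b) - d) + b) - a)" by (simp add: e_def)
qed

lemma Pair_end:
  assumes K: "geodesic_set K" and nc: "nocap K" and ac: "all_crossed K" and P: "Pair K l r u n a b d a' b' d'"
    and N: "k * (a + b) - d > 0" "k * (a' + b') - d' > 0"
  obtains t x y where "t > 0" "k * (a' + b') - d' = t * (k * (a + b) - d)" "a' = t * x" "b' = t * y"
    "turn (k * (a + b) - d) a b x y"
proof -
  note n1 = Pair_end_nearest[OF K nc ac P N]
  have n2: "nearest K n l r u (k * (a' + b') - d') a' b' (k * ((k * (a' + b') - d') + a') - b')"
    using Pair_end_nearest(3)[OF K nc ac Pair_mirror[OF P]] N by (simp add: add.commute)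
  have l: "labelling n l r u" using Pair_signs(5)[OF P] by (auto intro: labelling_perm)
  have c: "cut K l r n u" "cut K r l n u" using n1(1,2) by auto
  obtain t x y where "t > 0" "k * (a' + b') - d' = t * (k * (a + b) - d)" "a' = t * x" "b' = t * y"
    "turn (k * (a + b) - d) a b x y"
    by (rule cap_turn[OF K nc ac l c n1(3) n2])
  then show ?thesis using that by blast
qed

text \<open>The strands are the continuations, through \<open>lr\<close>, of the crossings of
  \<open>vr\<close> and \<open>vl\<close> nearest to v. The second form is rescaled so that both
  have the value a at v; this normalization is used again at the far end.\<close>

lemma Pair_start:
  assumes K: "geodesic_set K" and nc: "nocap K" and ac: "all_crossed K"
  obtains v l r n a d b x y where "Pair K l r v n d b a x y a" "turn a d b x y" "a > 0"
proof -
  obtain v l r n where l: "labelling v l r n" and c: "cut K l r v n" "cut K r l v n" by (rule cap_start[OF K nc ac])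
  have ls: "labelling v r l n" using l by (auto intro: labelling_perm)
  have "crossed K v r" "crossed K v l" using ac labelling_in[OF l] labelling_neq[OF l] by (auto simp: all_crossed_def)
  obtain a b d e where n1: "nearest K v r l n a b d e" by (rule nearest_cut_ex[OF K \<open>crossed K v r\<close> ls])
  obtain a' b' d' e' where n2: "nearest K v l r n a' b' d' e'" by (rule nearest_cut_ex[OF K \<open>crossed K v l\<close> l])
  obtain t x y where t: "t > 0" "a' = t * a" "b' = t * x" "d' = t * y" and tu: "turn a d b x y"
    and sg: "d > 0" "y > 0" "x < 0"
    by (rule cap_turn[OF K nc ac l c n1 n2])
  have n3: "nearest K v l r n a x y (e' / t)"
    using nearest_scale[OF n2, of "1 / t"] t by simp
  note A = nearest_crosses[OF n1] and A' = nearest_crosses[OF n3]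
  have sa: "a > 0" "b < 0" using A by (auto simp: crosses_def)
  have B: "crosses K l r v n d b a (k * (d + b) - a)" by (rule crosses_turn_pos[OF K A sg(1)])
  have B': "crosses K r l v n y x a (k * (y + x) - a)" by (rule crosses_turn_pos[OF K A' sg(2)])
  have arcs: "has_arc K v l r n a d b" "has_arc K v l r n a x y"
    using crosses_arc[OF A] crosses_arc[OF A'] has_arc_perm by metis+
  have n: "b * a < 0" "b * d < 0" "x * a < 0" "x * y < 0" using sa sg by (auto simp: mult_neg_pos)
  have "b * a - a * y < 0" using n(1) sa sg by (smt (verit) mult_pos_pos)
  then have det: "d * y - b * x > 0" using cut_opposite3(1)[OF K arcs n(1,2)] by simp
  have gap: "\<not> (b * g1 > d * g2 \<and> y * g1 > x * g2)" if G: "crosses K l r v n g1 g2 g3 g4" for g1 g2 g3 g4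
  proof
    assume h: "b * g1 > d * g2 \<and> y * g1 > x * g2"
    have s: "g1 > 0" "g2 < 0" "g3 \<noteq> 0" using G crosses_nz[OF G] by (auto simp: crosses_def)
    have ga: "has_arc K v l r n g3 g1 g2" using crosses_arc[OF G] has_arc_perm by metis
    show False
    proof (cases "g3 > 0")
      case True
      have "crosses K v r l n g3 g2 g1 (k * (g3 + g2) - g1)" by (rule crosses_turn_pos[OF K G True])
      then have "a * - g2 \<le> g3 * - b" by (rule nearest_le[OF n1])
      moreover have "b * g3 - a * g2 > 0" using cut_opposite3(2)[OF K arcs(1) ga n(1,2)] h by simp
      ultimately show False by (simp add: algebra_simps)
    next
      case False
      then have g3: "g3 < 0" using s by simp
      have "crosses K v l r n (- g3) (- g1) (- g2) (- (k * (g1 + g3) - g2))"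
        by (rule crosses_neg[OF crosses_turn_neg[OF K G g3]])
      then have "a * - (- g1) \<le> (- g3) * - x" by (rule nearest_le[OF n3])
      moreover have "a * g1 - x * g3 > 0" using cut_opposite2(2)[OF K arcs(2) ga n(3,4)] h by simp
      ultimately show False by (simp add: algebra_simps)
    qed
  qed
  have "Pair K l r v n d b a x y a"
    unfolding Pair_def using B B' det gap by (auto simp: algebra_simps)
  then show ?thesis using that tu sa by blast
qed

end

section \<open>Strips have bounded length\<close>

lemma finite_by_keys:
  assumes "finite I" "\<And>K. K \<in> G \<Longrightarrow> \<exists>i\<in>I. P i K"
    and "\<And>i K K'. K \<in> G \<Longrightarrow> K' \<in> G \<Longrightarrow> P i K \<Longrightarrow> P i K' \<Longrightarrow> K = K'"
  shows "finite G"
proof -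
  obtain f where f: "\<And>K. K \<in> G \<Longrightarrow> f K \<in> I \<and> P (f K) K" using assms(2) by metis
  have "inj_on f G"
  proof (rule inj_onI)
    fix x y assume "x \<in> G" "y \<in> G" "f x = f y"
    then show "x = y" using f assms(3) by metis
  qed
  moreover have "finite (f ` G)" using f assms(1) by (meson finite_subset image_subsetI)
  ultimately show ?thesis by (rule finite_imageD[rotated])
qed

text \<open>The last entry is the vertex ahead. With only four vertices available, the vertex behind
  the old edge is the one ahead of the new edge.\<close>

fun step_labels :: "bool \<Rightarrow> 'v \<times> 'v \<times> 'v \<times> 'v \<Rightarrow> 'v \<times> 'v \<times> 'v \<times> 'v" where
  "step_labels b (l, r, u, n) = (if b then (n, r, l, u) else (l, n, r, u))"

fun map3 :: "('a \<Rightarrow> 'b) \<Rightarrow> 'a \<times> 'a \<times> 'a \<Rightarrow> 'b \<times> 'b \<times> 'b" where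
  "map3 h (x, y, z) = (h x, h y, h z)"

fun comb :: "real \<times> real \<times> real \<Rightarrow> 'a::real_vector \<times> 'a \<times> 'a \<Rightarrow> 'a" where
  "comb (p, q, s) (x, y, z) = p *\<^sub>R x + q *\<^sub>R y + s *\<^sub>R z"

abbreviation nrm :: "'a::real_normed_vector \<Rightarrow> 'a" where
  "nrm x \<equiv> (1 / norm x) *\<^sub>R x"

lemma inner_nrm: "nrm x \<bullet> nrm y = (x \<bullet> y) / (norm x * norm y)"
  by simp

context reg_tetra
begin

text \<open>One step of the development along a strip of faces.  A triple lists the left and the right end of
  the edge that is crossed and the vertex behind it; the step passes to the next edge, and the vertex
  ahead replaces the left end or the right end.\<close>

fun step_form :: "bool \<Rightarrow> 'a::real_vector \<times> 'a \<times> 'a \<Rightarrow> 'a \<times> 'a \<times> 'a" where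
  "step_form b (x, y, z) = (if b then (k *\<^sub>R (x + y) - z, y, x) else (x, k *\<^sub>R (x + y) - z, y))"

text \<open>The dual of \<open>step_form\<close>: the coordinates of a fixed vector change so that
  \<open>comb\<close> keeps its value.\<close>

fun step_coeffs :: "bool \<Rightarrow> real \<times> real \<times> real \<Rightarrow> real \<times> real \<times> real" where
  "step_coeffs b (p, q, s) = (if b then (- s, q + k * s, p + k * s) else (p + k * s, - s, q + k * s))"

lemma comb_step_coeffs: "comb (step_coeffs b t) (step_form b D) = comb t D"
  by (cases t; cases D) (simp add: algebra_simps)

lemma comb_fold: "comb (fold step_coeffs w t) (fold step_form w D) = comb t D"
  by (induction w arbitrary: t D) (simp_all add: comb_step_coeffs)

text \<open>The same recursion moves the developed vertices and the values of a form at them. Hence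
  one linear form on the developed plane describes a strand along the whole strip.\<close>

lemma map3_step_form: "linear h \<Longrightarrow> step_form b (map3 h D) = map3 h (step_form b D)"
  by (cases D) (simp add: linear_add linear_cmul linear_diff)

lemma map3_fold: "linear h \<Longrightarrow> fold step_form w (map3 h D) = map3 h (fold step_form w D)"
  by (induction w arbitrary: D) (simp_all add: map3_step_form)

fun gram :: "(real ^ 4) \<times> (real ^ 4) \<times> (real ^ 4) \<Rightarrow> bool" where
  "gram (x, y, z) \<longleftrightarrow> x \<bullet> x = 1 \<and> y \<bullet> y = 1 \<and> z \<bullet> z = 1 \<and> x \<bullet> y = c \<and> x \<bullet> z = c \<and> y \<bullet> z = c"

lemma gram_ahead:
  assumes "gram (x, y, z)"
  defines "t \<equiv> k *\<^sub>R (x + y) - z"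
  shows "x \<bullet> t = c" "y \<bullet> t = c" "t \<bullet> x = c" "t \<bullet> y = c" "t \<bullet> t = 1"
proof -
  have i: "x \<bullet> x = 1" "y \<bullet> y = 1" "z \<bullet> z = 1" "x \<bullet> y = c" "x \<bullet> z = c" "y \<bullet> z = c" "y \<bullet> x = c" "z \<bullet> x = c" "z \<bullet> y = c"
    using assms by (auto simp: inner_commute)
  show 1: "x \<bullet> t = c" "y \<bullet> t = c" using i k_c unfolding t_def by (simp_all add: inner_simps algebra_simps)
  then show 2: "t \<bullet> x = c" "t \<bullet> y = c" by (simp_all add: inner_commute)
  have "t \<bullet> t = k * (x \<bullet> t + y \<bullet> t) - z \<bullet> t"
    by (subst t_def) (simp add: inner_diff_left inner_add_left)
  also have "z \<bullet> t = k * (2 * c) - 1" using i unfolding t_def by (simp add: inner_simps)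
  finally show "t \<bullet> t = 1" using 1 by simp
qed

lemma gram_step_form: "gram D \<Longrightarrow> gram (step_form b D)"
proof (cases D)
  case (fields x y z)
  assume "gram D"
  then have g': "gram (x, y, z)" using fields by simp
  note a = gram_ahead[OF g']
  show ?thesis using g' a unfolding fields by (cases b) (simp_all add: inner_commute[of y x])
qed

lemma gram_fold: "gram D \<Longrightarrow> gram (fold step_form w D)"
  by (induction w arbitrary: D) (simp_all add: gram_step_form)

lemma dev_form_step_form: "step_form b (x, y, z) = (x', y', z') \<Longrightarrow> dev_form x' y' z' = dev_form x y z"
proof -
  assume m: "step_form b (x, y, z) = (x', y', z')"
  have "dev_form x y (k * (x + y) - z) = dev_form x y z" by (rule dev_form_reflect) simp
  moreover have "dev_form u y x = dev_form x y u" "dev_form x u y = dev_form x y u" for u using dev_form_perm by metis+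
  ultimately show ?thesis using m by (cases b) auto
qed

fun dev_form3 :: "real \<times> real \<times> real \<Rightarrow> real" where "dev_form3 (x, y, z) = dev_form x y z"

lemma dev_form3_fold: "dev_form3 (fold step_form w t) = dev_form3 t"
proof (induction w arbitrary: t)
  case (Cons b w)
  have "dev_form3 (step_form b t) = dev_form3 t"
  proof (cases t)
    case (fields x y z)
    obtain x' y' z' where m: "step_form b (x, y, z) = (x', y', z')" by (metis prod_cases3)
    show ?thesis unfolding fields m dev_form3.simps by (rule dev_form_step_form[OF m])
  qed
  then show ?case using Cons by simp
qed simp

section \<open>Chains of steps along a strip\<close>

fun PairT :: "(real ^ 4) set \<Rightarrow> (real ^ 4) \<times> (real ^ 4) \<times> (real ^ 4) \<times> (real ^ 4) \<Rightarrow> real \<times> real \<times> real \<Rightarrow>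
    real \<times> real \<times> real \<Rightarrow> bool" where
  "PairT K (l, r, u, n) (a, b, d) (a', b', d') \<longleftrightarrow> Pair K l r u n a b d a' b' d'"

definition chain :: "(real ^ 4) set \<Rightarrow> (real ^ 4) \<times> (real ^ 4) \<times> (real ^ 4) \<times> (real ^ 4) \<Rightarrow> real \<times> real \<times> real \<Rightarrow>
    real \<times> real \<times> real \<Rightarrow> bool list \<Rightarrow> bool" where
  "chain K st t t' w \<longleftrightarrow>
     (\<forall>i\<le>length w. PairT K (fold step_labels (take i w) st) (fold step_form (take i w) t) (fold step_form (take i w) t'))"

definition chain_end :: "real \<times> real \<times> real \<Rightarrow> real \<times> real \<times> real \<Rightarrow> bool" where
  "chain_end t t' \<longleftrightarrow> (case t of (a, b, d) \<Rightarrow> k * (a + b) - d > 0) \<and> (case t' of (a, b, d) \<Rightarrow> k * (a + b) - d > 0)"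

lemma fold_take_Suc:
  "i < length w \<Longrightarrow> fold f (take (Suc i) w) s = f (w ! i) (fold f (take i w) s)"
  by (simp add: take_Suc_conv_app_nth)

lemma PairT_next:
  assumes K: "geodesic_set K" and P: "PairT K st t t'" and ne: "\<not> chain_end t t'"
  obtains b where "PairT K (step_labels b st) (step_form b t) (step_form b t')"
proof -
  obtain l r u n where st: "st = (l, r, u, n)" by (metis prod_cases4)
  obtain a b d where t: "t = (a, b, d)" by (metis prod_cases3)
  obtain a' b' d' where t': "t' = (a', b', d')" by (metis prod_cases3)
  have PP: "Pair K l r u n a b d a' b' d'" using P st t t' by simp
  have nz: "k * (a + b) - d \<noteq> 0" "k * (a' + b') - d' \<noteq> 0" using Pair_signs[OF PP] by auto
  have "\<not> (k * (a + b) - d > 0 \<and> k * (a' + b') - d' > 0)" using ne by (simp add: chain_end_def t t')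
  moreover have "\<not> (k * (a + b) - d < 0 \<and> k * (a' + b') - d' < 0)" using Pair_not_both_neg[OF K PP] by blast
  ultimately consider "k * (a + b) - d > 0" "k * (a' + b') - d' < 0" | "k * (a + b) - d < 0" "k * (a' + b') - d' > 0"
    using nz by linarith
  then show ?thesis
  proof cases
    case 1 show ?thesis by (rule that[of True]) (use Pair_step[OF K PP 1] in \<open>simp add: st t t'\<close>)
  next
    case 2 show ?thesis by (rule that[of False]) (use Pair_step'[OF K PP 2] in \<open>simp add: st t t'\<close>)
  qed
qed

lemma chain_extend:
  assumes K: "geodesic_set K" and c: "chain K st t t' w" and ne: "\<not> chain_end (fold step_form w t) (fold step_form w t')"
  obtains b where "chain K st t t' (w @ [b])"
proof -
  have "PairT K (fold step_labels w st) (fold step_form w t) (fold step_form w t')"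
    using c unfolding chain_def by (metis order_refl take_all)
  then obtain b where b: "PairT K (step_labels b (fold step_labels w st)) (step_form b (fold step_form w t)) (step_form b (fold step_form w t'))"
    using PairT_next[OF K _ ne] by blast
  have "chain K st t t' (w @ [b])" unfolding chain_def
  proof (intro allI impI)
    fix i assume i: "i \<le> length (w @ [b])"
    show "PairT K (fold step_labels (take i (w @ [b])) st) (fold step_form (take i (w @ [b])) t) (fold step_form (take i (w @ [b])) t')"
    proof (cases "i \<le> length w")
      case True
      then show ?thesis using c by (simp add: chain_def)
    next
      case False
      then have "i = Suc (length w)" using i by simp
      then show ?thesis using b by simp
    qed
  qed
  then show ?thesis using that by blast
qed

text \<open>For positive c this is the distance between the midpoints of opposite edges, whose
  cosine is k. For other c the inner product of points on opposite edges is at most 0.\<close>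

definition delta :: real where "delta = arccos (max k 0)"

lemma delta_pos: "delta > 0"
  unfolding delta_def using arccos_lt_bounded[of "max k 0"] k_bounds by auto

text \<open>The inner product is c times the product of the two coordinate sums A and B. On unit
  vectors of an edge the square of such a sum is at most \<open>2 / (1 + c)\<close>, with equality
  at the midpoint.\<close>

lemma opposite_edges_far:
  assumes l: "labelling p q r s" and x: "x \<in> S" "coord r x = 0" "coord s x = 0" and y: "y \<in> S" "coord p y = 0" "coord q y = 0"
  shows "sdist x y \<ge> delta"
proof -
  have ex: "x = coord p x *\<^sub>R p + coord q x *\<^sub>R q" using labelling_expand[OF l, of x] x by simp
  have ey: "y = coord r y *\<^sub>R r + coord s y *\<^sub>R s" using labelling_expand[OF l, of y] y by simp
  have nn: "coord p x \<ge> 0" "coord q x \<ge> 0" "coord r y \<ge> 0" "coord s y \<ge> 0" using x y S_labelling[OF l] by auto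
  note i = labelling_inner[OF l]
  have c1: "1 + c > 0" using c_gr by simp
  have bound: "(a + b)\<^sup>2 * (1 + c) \<le> 2" if "a\<^sup>2 + b\<^sup>2 + 2 * a * b * c = 1" for a b
  proof -
    have "2 - (a + b)\<^sup>2 * (1 + c) = 2 * (a\<^sup>2 + b\<^sup>2 + 2 * a * b * c) - (a + b)\<^sup>2 * (1 + c)" using that by simp
    also have "\<dots> = (1 - c) * (a - b)\<^sup>2" by (simp add: power2_eq_square algebra_simps)
    also have "\<dots> \<ge> 0" using c_less by simp
    finally show ?thesis by simp
  qed
  have xx: "(coord p x)\<^sup>2 + (coord q x)\<^sup>2 + 2 * coord p x * coord q x * c = 1"
  proof -
    have "x \<bullet> x = (coord p x)\<^sup>2 + (coord q x)\<^sup>2 + 2 * coord p x * coord q x * c"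
      by (subst (1 2) ex) (simp add: inner_add_left inner_add_right i power2_eq_square algebra_simps)
    then show ?thesis using x by (simp add: S_iff norm_eq_1)
  qed
  have yy: "(coord r y)\<^sup>2 + (coord s y)\<^sup>2 + 2 * coord r y * coord s y * c = 1"
  proof -
    have "y \<bullet> y = (coord r y)\<^sup>2 + (coord s y)\<^sup>2 + 2 * coord r y * coord s y * c"
      by (subst (1 2) ey) (simp add: inner_add_left inner_add_right i power2_eq_square algebra_simps)
    then show ?thesis using y by (simp add: S_iff norm_eq_1)
  qed
  define A B where "A = coord p x + coord q x" and "B = coord r y + coord s y"
  have AB: "A \<ge> 0" "B \<ge> 0" "A\<^sup>2 * (1 + c) \<le> 2" "B\<^sup>2 * (1 + c) \<le> 2"
    using nn bound[OF xx] bound[OF yy] by (auto simp: A_def B_def)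
  have "2 * (A * B) \<le> A\<^sup>2 + B\<^sup>2" using sum_squares_bound[of A B] by simp
  then have "2 * (A * B) * (1 + c) \<le> (A\<^sup>2 + B\<^sup>2) * (1 + c)" using c1 by (intro mult_right_mono) auto
  then have ab: "A * B * (1 + c) \<le> 2" using AB by (simp add: algebra_simps)
  have xy: "x \<bullet> y = c * (A * B)"
    by (subst ex, subst ey) (simp add: inner_add_left inner_add_right i A_def B_def algebra_simps)
  have "x \<bullet> y \<le> max k 0"
  proof (cases "c \<le> 0")
    case True
    then have "c * (A * B) \<le> 0" using AB by (simp add: mult_nonpos_nonneg)
    then show ?thesis using xy by simp
  next
    case False
    have "A * B \<le> 2 / (1 + c)" using ab c1 by (simp add: field_simps)
    then have "c * (A * B) \<le> c * (2 / (1 + c))" using False by (intro mult_left_mono) auto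
    also have "\<dots> = k" by (simp add: k_def)
    finally show ?thesis using xy by simp
  qed
  moreover have "- 1 \<le> x \<bullet> y" using inner_unit_bounds(1)[of x y] x y by (simp add: S_iff)
  ultimately show ?thesis unfolding sdist_def delta_def using k_bounds by (intro arccos_le_arccos) auto
qed

text \<open>The triple \<open>q\<close> lists the coordinates of a fixed vector in the moving frame.  A vector in the region
  between the two strands stays behind the edges that are crossed.\<close>

lemma track_pos:
  assumes P: "PairT K st t t'" "PairT K (step_labels b st) (step_form b t) (step_form b t')"
    and B: "comb q t \<ge> 0" "comb q t' > 0" and s: "snd (snd q) \<ge> 0"
  shows "snd (snd (step_coeffs b q)) > 0"
proof -
  obtain l r u n where st: "st = (l, r, u, n)" by (metis prod_cases4)
  obtain x y z where t: "t = (x, y, z)" by (metis prod_cases3)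
  obtain x' y' z' where t': "t' = (x', y', z')" by (metis prod_cases3)
  obtain q1 q2 q3 where q: "q = (q1, q2, q3)" by (metis prod_cases3)
  define e e' where "e = k * (x + y) - z" and "e' = k * (x' + y') - z'"
  have PP: "Pair K l r u n x y z x' y' z'" using P(1) st t t' by simp
  have sg: "x > 0" "y < 0" "x' < 0" "y' > 0" using Pair_signs[OF PP] by auto
  have det: "x * y' - x' * y > 0" using PP by (simp add: Pair_def)
  have z: "z = k * (x + y) - e" "z' = k * (x' + y') - e'" by (auto simp: e_def e'_def)
  have hB: "(q1 + k * q3) * x + (q2 + k * q3) * y - q3 * e \<ge> 0" "(q1 + k * q3) * x' + (q2 + k * q3) * y' - q3 * e' > 0"
    using B by (simp_all add: q t t' z algebra_simps)
  have q3: "q3 \<ge> 0" using s q by simp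
  show ?thesis
  proof (cases b)
    case True
    have "Pair K n r l u e y x e' y' x'" using P(2) True by (simp add: st t t' e_def e'_def)
    then have det2: "e * y' - e' * y > 0" by (simp add: Pair_def)
    show ?thesis
    proof (rule ccontr)
      assume "\<not> ?thesis"
      then have s': "q1 + k * q3 \<le> 0" using True q by simp
      \<comment> \<open>This combination of the values of the two forms eliminates the coefficient
        at the common end of both edges. Its left side is positive by the assumptions on the vector,
        while \<open>s'\<close> would make the right side nonpositive.\<close>
      have "y' * ((q1 + k * q3) * x + (q2 + k * q3) * y - q3 * e) + (- y) * ((q1 + k * q3) * x' + (q2 + k * q3) * y' - q3 * e') =
        (q1 + k * q3) * (x * y' - x' * y) - q3 * (e * y' - e' * y)" by (simp add: algebra_simps)
      moreover have "(q1 + k * q3) * (x * y' - x' * y) \<le> 0" "q3 * (e * y' - e' * y) \<ge> 0"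
        using s' det det2 q3 by (auto simp: mult_nonpos_nonneg)
      moreover have "y' * ((q1 + k * q3) * x + (q2 + k * q3) * y - q3 * e) \<ge> 0"
        "(- y) * ((q1 + k * q3) * x' + (q2 + k * q3) * y' - q3 * e') > 0"
        using hB sg by (intro mult_nonneg_nonneg mult_pos_pos; simp)+
      ultimately show False by linarith
    qed
  next
    case False
    have "Pair K l n r u x e y x' e' y'" using P(2) False by (simp add: st t t' e_def e'_def)
    then have det2: "x * e' - x' * e > 0" by (simp add: Pair_def)
    show ?thesis
    proof (rule ccontr)
      assume "\<not> ?thesis"
      then have s': "q2 + k * q3 \<le> 0" using False q by simp
      have "(- x') * ((q1 + k * q3) * x + (q2 + k * q3) * y - q3 * e) + x * ((q1 + k * q3) * x' + (q2 + k * q3) * y' - q3 * e') =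
        (q2 + k * q3) * (x * y' - x' * y) - q3 * (x * e' - x' * e)" by (simp add: algebra_simps)
      moreover have "(q2 + k * q3) * (x * y' - x' * y) \<le> 0" "q3 * (x * e' - x' * e) \<ge> 0"
        using s' det det2 q3 by (auto simp: mult_nonpos_nonneg)
      moreover have "(- x') * ((q1 + k * q3) * x + (q2 + k * q3) * y - q3 * e) \<ge> 0"
        "x * ((q1 + k * q3) * x' + (q2 + k * q3) * y' - q3 * e') > 0"
        using hB sg by (intro mult_nonneg_nonneg mult_pos_pos; simp)+
      ultimately show False by linarith
    qed
  qed
qed

lemma chain_PairT:
  assumes "chain K st t t' w" "i \<le> length w"
  shows "PairT K (fold step_labels (take i w) st) (fold step_form (take i w) t) (fold step_form (take i w) t')"
  using assms by (simp add: chain_def)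

lemma chain_track:
  assumes c: "chain K st t t' w" and B: "comb q t \<ge> 0" "comb q t' > 0" and s: "snd (snd q) \<ge> 0" and i: "i \<le> length w"
  shows "snd (snd (fold step_coeffs (take i w) q)) \<ge> 0 \<and> (i > 0 \<longrightarrow> snd (snd (fold step_coeffs (take i w) q)) > 0)"
  using i
proof (induction i)
  case 0
  then show ?case using s by simp
next
  case (Suc i)
  then have il: "i < length w" and IH: "snd (snd (fold step_coeffs (take i w) q)) \<ge> 0" by auto
  have "snd (snd (step_coeffs (w ! i) (fold step_coeffs (take i w) q))) > 0"
  proof (rule track_pos)
    show "PairT K (fold step_labels (take i w) st) (fold step_form (take i w) t) (fold step_form (take i w) t')"
      using c il by (intro chain_PairT) auto
    show "PairT K (step_labels (w ! i) (fold step_labels (take i w) st)) (step_form (w ! i) (fold step_form (take i w) t)) (step_form (w ! i) (fold step_form (take i w) t'))"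
      using chain_PairT[OF c, of "Suc i"] il by (simp add: fold_take_Suc)
  qed (use B IH in \<open>simp_all only: comb_fold\<close>)
  then show ?case using il by (simp add: fold_take_Suc)
qed

text \<open>For vectors this is the point, up to scale, where the form crosses the edge. Applied to
  the values of a second form it is that form at this point, namely the determinant in
  \<open>Pair\<close>.\<close>

fun edge_vec :: "real \<times> real \<times> real \<Rightarrow> 'a::real_vector \<times> 'a \<times> 'a \<Rightarrow> 'a" where
  "edge_vec (a, b, d) (x, y, z) = a *\<^sub>R y - b *\<^sub>R x"

fun tri :: "'v \<times> 'v \<times> 'v \<times> 'v \<Rightarrow> 'v \<times> 'v \<times> 'v" where
  "tri (l, r, u, n) = (l, r, u)"

lemma edge_vec_linear: "linear h \<Longrightarrow> h (edge_vec t D) = edge_vec t (map3 h D)"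
  by (cases t; cases D) (simp add: linear_diff linear_cmul)

lemma inner_comb:
  assumes "gram D"
  shows "comb (p1, p2, p3) D \<bullet> comb (q1, q2, q3) D =
    p1 * q1 + p2 * q2 + p3 * q3 + c * (p1 * q2 + p2 * q1 + p1 * q3 + p3 * q1 + p2 * q3 + p3 * q2)"
proof (cases D)
  case (fields x y z)
  have i: "x \<bullet> x = 1" "y \<bullet> y = 1" "z \<bullet> z = 1" "x \<bullet> y = c" "x \<bullet> z = c" "y \<bullet> z = c" "y \<bullet> x = c" "z \<bullet> x = c" "z \<bullet> y = c"
    using assms fields by (auto simp: inner_commute)
  show ?thesis unfolding fields comb.simps by (simp add: inner_add_left inner_add_right i algebra_simps)
qed

lemma gram_labelling: "labelling l r u n \<Longrightarrow> gram (l, r, u)"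
  using labelling_inner by simp

lemma edge_vec_inner_self:
  assumes "gram D" "gram D'"
  shows "edge_vec t D \<bullet> edge_vec t D = edge_vec t D' \<bullet> edge_vec t D'"
proof -
  obtain a b d where t: "t = (a, b, d)" by (metis prod_cases3)
  have "edge_vec t E = comb (- b, a, 0) E" for E :: "(real ^ 4) \<times> (real ^ 4) \<times> (real ^ 4)" by (cases E) (simp add: t)
  then show ?thesis using inner_comb assms by simp
qed

text \<open>Two consecutive crossings lie in one face, and its development has the same Gram matrix.
  This carries distances from the developed strip back to the surface.\<close>

lemma edge_vec_inner_next:
  assumes g: "gram D" and l: "labelling l r u n"
  shows "edge_vec t D \<bullet> edge_vec (step_form b t) (step_form b D) = edge_vec t (l, r, u) \<bullet> edge_vec (step_form b t) (tri (step_labels b (l, r, u, n)))"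
proof -
  obtain x y z where D: "D = (x, y, z)" by (metis prod_cases3)
  obtain a1 a2 a3 where t: "t = (a1, a2, a3)" by (metis prod_cases3)
  define N where "N = k *\<^sub>R (x + y) - z"
  have g1: "gram (x, y, N)" using g gram_ahead[of x y z] by (simp add: D N_def)
  have g2: "gram (l, r, n)" using labelling_inner[OF l] by simp
  define e where "e = k * (a1 + a2) - a3"
  define Q where "Q = (if b then (0, e, - a2) else (- e, 0, a1))"
  have v1: "edge_vec t D = comb (- a2, a1, 0) (x, y, N)" "edge_vec t (l, r, u) = comb (- a2, a1, 0) (l, r, n)"
    by (simp_all add: t D)
  have v2: "edge_vec (step_form b t) (step_form b D) = comb Q (x, y, N)" "edge_vec (step_form b t) (tri (step_labels b (l, r, u, n))) = comb Q (l, r, n)"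
    by (cases b; simp add: t D Q_def N_def e_def algebra_simps)+
  obtain q1 q2 q3 where Q: "Q = (q1, q2, q3)" by (metis prod_cases3)
  show ?thesis unfolding v1 v2 Q inner_comb[OF g1] inner_comb[OF g2] ..
qed

text \<open>Three vectors in the kernel of the form: the fixed vector and two consecutive crossings.
  The two sides differ by a multiple of the value of the form at the fixed vector, which is
  zero.\<close>

lemma edge_vec_between:
  assumes "comb (q1, q2, s) (a1, a2, a3) = 0"
  shows "snd (snd (step_coeffs b (q1, q2, s))) *\<^sub>R edge_vec (a1, a2, a3) D =
    (if b then - a2 else a1) *\<^sub>R comb (q1, q2, s) D + s *\<^sub>R edge_vec (step_form b (a1, a2, a3)) (step_form b D)"
proof -
  obtain x y z where D: "D = (x, y, z)" by (metis prod_cases3)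
  have h: "q1 * a1 + q2 * a2 + s * a3 = 0" using assms by simp
  show ?thesis
  proof (cases b)
    case True
    have "(if b then - a2 else a1) *\<^sub>R comb (q1, q2, s) D + s *\<^sub>R edge_vec (step_form b (a1, a2, a3)) (step_form b D)
        - snd (snd (step_coeffs b (q1, q2, s))) *\<^sub>R edge_vec (a1, a2, a3) D = - (q1 * a1 + q2 * a2 + s * a3) *\<^sub>R y"
      using True by (simp add: D algebra_simps)
    then show ?thesis unfolding h by simp
  next
    case False
    have "(if b then - a2 else a1) *\<^sub>R comb (q1, q2, s) D + s *\<^sub>R edge_vec (step_form b (a1, a2, a3)) (step_form b D)
        - snd (snd (step_coeffs b (q1, q2, s))) *\<^sub>R edge_vec (a1, a2, a3) D = (q1 * a1 + q2 * a2 + s * a3) *\<^sub>R x"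
      using False by (simp add: D algebra_simps)
    then show ?thesis unfolding h by simp
  qed
qed

lemma linear_lin3: "linear (\<lambda>y. a * coord p y + b * coord q y + d * coord r y)"
  by (rule linearI) (simp_all add: coord_add coord_scale algebra_simps)

lemma map3_lin3:
  assumes "labelling p q r s"
  shows "map3 (\<lambda>y. a * coord p y + b * coord q y + d * coord r y) (p, q, r) = (a, b, d)"
  using labelling_coord[OF assms] by simp

lemma PairT_facts:
  assumes "PairT K st t t'"
  shows "edge_vec t t' > 0" "\<exists>l r u n a b d. st = (l, r, u, n) \<and> labelling l r u n \<and> t = (a, b, d) \<and> a > 0 \<and> b < 0 \<and> crosses K l r u n a b d (k * (a + b) - d)"
proof -
  obtain l r u n where st: "st = (l, r, u, n)" by (metis prod_cases4)
  obtain a b d where t: "t = (a, b, d)" by (metis prod_cases3)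
  obtain a' b' d' where t': "t' = (a', b', d')" by (metis prod_cases3)
  have PP: "Pair K l r u n a b d a' b' d'" using assms st t t' by simp
  show "edge_vec t t' > 0" using PP by (simp add: t t' Pair_def algebra_simps)
  have "crosses K l r u n a b d (k * (a + b) - d)" using PP by (simp add: Pair_def)
  then show "\<exists>l r u n a b d. st = (l, r, u, n) \<and> labelling l r u n \<and> t = (a, b, d) \<and> a > 0 \<and> b < 0 \<and> crosses K l r u n a b d (k * (a + b) - d)"
    using st t Pair_signs[OF PP] by blast
qed

text \<open>Both strands lie in a common half plane of directions, so the arc that the first one traverses
  is shorter than \<open>pi\<close>.\<close>

lemma chain_length_sum:
  assumes ch: "chain K (l, r, u, n) t t' w" and i: "i \<le> length w"
  defines "x \<equiv> \<lambda>i. nrm (edge_vec (fold step_form (take i w) t) (tri (fold step_labels (take i w) (l, r, u, n))))"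
  shows "(\<Sum>j<i. sdist (x j) (x (Suc j))) \<le> pi"
proof -
  define T T' where "T i = fold step_form (take i w) t" and "T' i = fold step_form (take i w) t'" for i
  define St where "St i = fold step_labels (take i w) (l, r, u, n)" for i
  have P: "PairT K (St i) (T i) (T' i)" if "i \<le> length w" for i
    unfolding St_def T_def T'_def by (rule chain_PairT[OF ch that])
  have P0: "PairT K (l, r, u, n) t t'" using P[of 0] by (simp add: St_def T_def T'_def)
  have lb: "labelling l r u n" using PairT_facts(2)[OF P0] by auto
  define D where "D i = fold step_form (take i w) (l, r, u)" for i
  have gD: "gram (D i)" for i unfolding D_def by (rule gram_fold[OF gram_labelling[OF lb]])
  obtain a b d where t: "t = (a, b, d)" by (metis prod_cases3)
  obtain a' b' d' where t': "t' = (a', b', d')" by (metis prod_cases3)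
  define h h' where "h y = a * coord l y + b * coord r y + d * coord u y" and "h' y = a' * coord l y + b' * coord r y + d' * coord u y" for y
  have lh: "linear h" "linear h'" unfolding h_def h'_def by (rule linear_lin3)+
  have a0: "map3 h (l, r, u) = t" "map3 h' (l, r, u) = t'"
    unfolding h_def h'_def t t' by (rule map3_lin3[OF lb])+
  have TD: "T i = map3 h (D i)" "T' i = map3 h' (D i)" for i
    by (simp_all only: T_def T'_def D_def a0[symmetric] map3_fold[OF lh(1)] map3_fold[OF lh(2)])
  define X where "X i = edge_vec (T i) (D i)" for i
  have h'X: "h' (X i) > 0" if "i \<le> length w" for i
    using PairT_facts(1)[OF P[OF that]] unfolding X_def edge_vec_linear[OF lh(2)] TD[symmetric] .
  have nz: "norm (X i) > 0" if "i \<le> length w" for i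
    using h'X[OF that] linear_0[OF lh(2)] by force
  have nX: "norm (nrm (X i)) = 1" if "i \<le> length w" for i using nz[OF that] by simp
  have suc: "T (Suc i) = step_form (w ! i) (T i)" "D (Suc i) = step_form (w ! i) (D i)" "St (Suc i) = step_labels (w ! i) (St i)"
    if "i < length w" for i using that by (simp_all add: T_def D_def St_def fold_take_Suc)
  \<comment> \<open>The coordinates of the first crossing in the starting frame, tracked along the
    strip by \<open>chain_track\<close>.\<close>
  define q where "q = (- b, a, 0 :: real)"
  have X0: "X 0 = comb q (l, r, u)" by (simp add: X_def T_def D_def t q_def)
  have q0: "comb q t = 0" "comb q t' > 0" "snd (snd q) \<ge> 0"
    using PairT_facts(1)[OF P0] by (simp_all add: q_def t t')
  have sum: "(\<Sum>j<i. sdist (nrm (X j)) (nrm (X (Suc j)))) = sdist (nrm (X 0)) (nrm (X i))" if "i \<le> length w" for i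
    using that
  proof (induction i)
    case 0
    then show ?case using nX[of 0] by simp
  next
    case (Suc i)
    then have il: "i < length w" "i \<le> length w" "Suc i \<le> length w" by auto
    obtain q1 q2 s where Q: "fold step_coeffs (take i w) q = (q1, q2, s)" by (metis prod_cases3)
    obtain a1 a2 a3 where Ti: "T i = (a1, a2, a3)" by (metis prod_cases3)
    have cb: "comb (q1, q2, s) (T i) = 0" "comb (q1, q2, s) (D i) = X 0"
      using comb_fold[of "take i w" q t] comb_fold[of "take i w" q "(l, r, u)"] q0(1) unfolding T_def D_def Q X0 by auto
    have s: "s \<ge> 0" using chain_track[OF ch _ q0(2,3) il(2)] q0(1) Q by simp
    define s' where "s' = snd (snd (step_coeffs (w ! i) (q1, q2, s)))"
    have "snd (snd (fold step_coeffs (take (Suc i) w) q)) > 0"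
      using chain_track[OF ch _ q0(2,3) il(3)] q0(1) by simp
    then have s': "s' > 0" using il by (simp add: fold_take_Suc Q s'_def)
    define m where "m = (if w ! i then - a2 else a1)"
    have m: "m \<ge> 0" using PairT_facts(2)[OF P[OF il(2)]] Ti by (auto simp: m_def)
    \<comment> \<open>So every crossing lies in the cone of the first and the next one, and the
      distances from the first crossing add up.\<close>
    have eq: "s' *\<^sub>R X i = m *\<^sub>R X 0 + s *\<^sub>R X (Suc i)"
      using edge_vec_between[of q1 q2 s a1 a2 a3 "w ! i" "D i"] cb
      unfolding s'_def m_def X_def[of i] X_def[of "Suc i"] suc[OF il(1)] Ti by simp
    define z0 zi zs where "z0 = norm (X 0)" and "zi = norm (X i)" and "zs = norm (X (Suc i))"
    have zp: "z0 > 0" "zi > 0" "zs > 0" using nz[of 0] nz[OF il(2)] nz[OF il(3)] by (auto simp: z0_def zi_def zs_def)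
    have "nrm (X i) = (1 / (zi * s')) *\<^sub>R (s' *\<^sub>R X i)" using s' zp by (simp add: zi_def)
    also have "\<dots> = (m * z0 / (zi * s')) *\<^sub>R nrm (X 0) + (s * zs / (zi * s')) *\<^sub>R nrm (X (Suc i))"
      unfolding eq z0_def[symmetric] zs_def[symmetric] using zp by (simp add: scaleR_add_right)
    finally have cone: "nrm (X i) = (m * z0 / (zi * s')) *\<^sub>R nrm (X 0) + (s * zs / (zi * s')) *\<^sub>R nrm (X (Suc i))" .
    \<comment> \<open>The second form is positive at all crossings of the first strand; this is the
      half plane that excludes antipodal points.\<close>
    have "nrm (X 0) \<noteq> - nrm (X (Suc i))"
    proof
      assume "nrm (X 0) = - nrm (X (Suc i))"
      then have "h' (nrm (X 0)) = h' (- nrm (X (Suc i)))" by simp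
      then have "(1 / z0) * h' (X 0) = - ((1 / zs) * h' (X (Suc i)))"
        using lh(2) by (simp add: linear_cmul linear_neg z0_def zs_def)
      moreover have "(1 / z0) * h' (X 0) > 0" "(1 / zs) * h' (X (Suc i)) > 0" using zp h'X[of 0] h'X[OF il(3)] by simp_all
      ultimately show False by linarith
    qed
    then have "sdist (nrm (X 0)) (nrm (X i)) + sdist (nrm (X i)) (nrm (X (Suc i))) = sdist (nrm (X 0)) (nrm (X (Suc i)))"
      using m s zp s' by (intro sdist_cone_add[OF nX nX nX _ cone] il) auto
    then show ?case using Suc il by simp
  qed
  have same: "sdist (nrm (X j)) (nrm (X (Suc j))) = sdist (x j) (x (Suc j))" if "j < length w" for j
  proof -
    have jl: "j \<le> length w" "Suc j \<le> length w" using that by auto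
    obtain l1 r1 u1 n1 where S1: "St j = (l1, r1, u1, n1)" "labelling l1 r1 u1 n1" using PairT_facts(2)[OF P[OF jl(1)]] by blast
    obtain l2 r2 u2 n2 where S2: "St (Suc j) = (l2, r2, u2, n2)" "labelling l2 r2 u2 n2" using PairT_facts(2)[OF P[OF jl(2)]] by blast
    have g: "gram (tri (St j))" "gram (tri (St (Suc j)))" using S1 S2 gram_labelling by simp_all
    define y where "y i = edge_vec (T i) (tri (St i))" for i
    have xy: "x i = nrm (y i)" for i by (simp add: x_def y_def T_def St_def)
    have n: "norm (X j) = norm (y j)" "norm (X (Suc j)) = norm (y (Suc j))"
      unfolding norm_eq_sqrt_inner X_def y_def using edge_vec_inner_self[OF gD g(1)] edge_vec_inner_self[OF gD g(2)] by simp_all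
    have "X j \<bullet> X (Suc j) = y j \<bullet> y (Suc j)"
      unfolding X_def y_def suc[OF that] S1(1) using edge_vec_inner_next[OF gD S1(2)] by simp
    then show ?thesis unfolding xy sdist_def inner_nrm n by (simp add: mult.commute)
  qed
  have "(\<Sum>j<i. sdist (x j) (x (Suc j))) = (\<Sum>j<i. sdist (nrm (X j)) (nrm (X (Suc j))))"
    using same i by (intro sum.cong) auto
  also have "\<dots> \<le> pi" using sum[OF i] cos_sdist(3)[OF nX nX, of 0 i] i by simp
  finally show ?thesis .
qed

lemma edge_vector_S:
  assumes l: "labelling l r u n" and ab: "a > 0" "b < 0"
  shows "nrm (edge_vec (a, b, d) (l, r, u)) \<in> S" "coord u (nrm (edge_vec (a, b, d) (l, r, u))) = 0" "coord n (nrm (edge_vec (a, b, d) (l, r, u))) = 0"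
proof -
  define v where "v = edge_vec (a, b, d) (l, r, u)"
  have cv: "coord l v = - b" "coord r v = a" "coord u v = 0" "coord n v = 0"
    by (simp_all add: v_def coord_diff coord_scale labelling_coord[OF l])
  have "v \<noteq> 0" using cv ab linear_0[OF linear_coord] by force
  then have n: "norm v > 0" by simp
  have "norm (nrm v) = 1" using n by simp
  then show "nrm (edge_vec (a, b, d) (l, r, u)) \<in> S" "coord u (nrm (edge_vec (a, b, d) (l, r, u))) = 0" "coord n (nrm (edge_vec (a, b, d) (l, r, u))) = 0"
    unfolding v_def[symmetric] S_labelling[OF l] using cv ab n by (auto simp: coord_scale divide_nonpos_pos less_imp_le)
qed

text \<open>Three steps of the same kind keep one end of the edge fixed and pass through all three
  faces at it, cutting each corner there, which \<open>nocap\<close> forbids.\<close>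

lemma no_three_turns:
  assumes K: "geodesic_set K" and nc: "nocap K"
    and P: "PairT K st t t'" "PairT K (step_labels b st) (step_form b t) (step_form b t')" "PairT K (step_labels b (step_labels b st)) (step_form b (step_form b t)) (step_form b (step_form b t'))"
      "PairT K (step_labels b (step_labels b (step_labels b st))) (step_form b (step_form b (step_form b t))) (step_form b (step_form b (step_form b t')))"
  shows False
proof -
  obtain l r u n where st: "st = (l, r, u, n)" by (metis prod_cases4)
  obtain x y z where t: "t = (x, y, z)" by (metis prod_cases3)
  have A0: "crosses K l r u n x y z (k * (x + y) - z)" using PairT_facts(2)[OF P(1)] by (auto simp: st t)
  show False
  proof (cases b)
    case True
    define e1 e2 e3 where "e1 = k * (x + y) - z" and "e2 = k * (e1 + y) - x" and "e3 = k * (e2 + y) - e1"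
    have A: "crosses K n r l u e1 y x (k * (e1 + y) - x)" "crosses K u r n l e2 y e1 (k * (e2 + y) - e1)" "crosses K l r u n e3 y e2 (k * (e3 + y) - e2)"
      using PairT_facts(2)[OF P(2)] PairT_facts(2)[OF P(3)] PairT_facts(2)[OF P(4)] True
      by (auto simp: st t e1_def e2_def e3_def)
    then have "e1 > 0" "e2 > 0" "e3 > 0" by (auto simp: crosses_def)
    then have "cut K r l n u" "cut K r n u l" "cut K r u l n"
      using crosses_cut_pos[OF K crosses_sym[OF A0]] crosses_cut_pos[OF K crosses_sym[OF A(1)]] crosses_cut_pos[OF K crosses_sym[OF A(2)]] cut_sym[OF K]
      by (auto simp: e1_def e2_def e3_def)
    then show False using nocapD[OF K nc, of r l n u] cut_sym[OF K] by blast
  next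
    case False
    define e1 e2 e3 where "e1 = k * (x + y) - z" and "e2 = k * (x + e1) - y" and "e3 = k * (x + e2) - e1"
    have A: "crosses K l n r u x e1 y (k * (x + e1) - y)" "crosses K l u n r x e2 e1 (k * (x + e2) - e1)" "crosses K l r u n x e3 e2 (k * (x + e3) - e2)"
      using PairT_facts(2)[OF P(2)] PairT_facts(2)[OF P(3)] PairT_facts(2)[OF P(4)] False
      by (auto simp: st t e1_def e2_def e3_def)
    then have "e1 < 0" "e2 < 0" "e3 < 0" by (auto simp: crosses_def)
    then have "cut K l r n u" "cut K l n u r" "cut K l u r n"
      using crosses_cut_neg[OF crosses_sym[OF A0]] crosses_cut_neg[OF crosses_sym[OF A(1)]] crosses_cut_neg[OF crosses_sym[OF A(2)]]
      by (auto simp: e1_def e2_def e3_def)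
    then show False using nocapD[OF K nc, of l r n u] cut_sym[OF K] by blast
  qed
qed

text \<open>Among three steps two consecutive ones differ, and together these lead from an edge to
  the opposite edge, at distance at least \<open>delta\<close>.\<close>

lemma chain_three_steps:
  assumes K: "geodesic_set K" and nc: "nocap K" and ch: "chain K st t t' w" and i: "i + 3 \<le> length w"
  defines "x \<equiv> \<lambda>i. nrm (edge_vec (fold step_form (take i w) t) (tri (fold step_labels (take i w) st)))"
  shows "sdist (x i) (x (Suc i)) + sdist (x (Suc i)) (x (Suc (Suc i))) + sdist (x (Suc (Suc i))) (x (Suc (Suc (Suc i)))) \<ge> delta"
proof -
  define T T' where "T i = fold step_form (take i w) t" and "T' i = fold step_form (take i w) t'" for i
  define St where "St i = fold step_labels (take i w) st" for i
  have P: "PairT K (St i) (T i) (T' i)" if "i \<le> length w" for i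
    unfolding St_def T_def T'_def by (rule chain_PairT[OF ch that])
  have suc: "T (Suc i) = step_form (w ! i) (T i)" "T' (Suc i) = step_form (w ! i) (T' i)" "St (Suc i) = step_labels (w ! i) (St i)"
    if "i < length w" for i using that by (simp_all add: T_def T'_def St_def fold_take_Suc)
  have xx: "x j = nrm (edge_vec (T j) (tri (St j)))" for j by (simp add: x_def T_def St_def)
  have edge: "\<exists>l r u n. St j = (l, r, u, n) \<and> labelling l r u n \<and> x j \<in> S \<and> coord u (x j) = 0 \<and> coord n (x j) = 0" if "j \<le> length w" for j
    using PairT_facts(2)[OF P[OF that]] edge_vector_S unfolding xx by fastforce
  have nx: "norm (x j) = 1" if "j \<le> length w" for j using edge[OF that] by (auto simp: S_iff)
  have nn: "sdist (x j) (x j') \<ge> 0" if "j \<le> length w" "j' \<le> length w" for j j'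
    using cos_sdist(2)[OF nx nx] that by simp
  have two: "sdist (x j) (x (Suc j)) + sdist (x (Suc j)) (x (Suc (Suc j))) \<ge> delta"
    if j: "j + 2 \<le> length w" and ne: "w ! j \<noteq> w ! Suc j" for j
  proof -
    have jl: "j < length w" "Suc j < length w" "j \<le> length w" "Suc j \<le> length w" "Suc (Suc j) \<le> length w" using j by auto
    obtain l r u n where E: "St j = (l, r, u, n)" "labelling l r u n" "x j \<in> S" "coord u (x j) = 0" "coord n (x j) = 0"
      using edge[OF jl(3)] by blast
    obtain l2 r2 u2 n2 where E2: "St (Suc (Suc j)) = (l2, r2, u2, n2)" "x (Suc (Suc j)) \<in> S" "coord u2 (x (Suc (Suc j))) = 0" "coord n2 (x (Suc (Suc j))) = 0"
      using edge[OF jl(5)] by blast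
    have "St (Suc (Suc j)) = step_labels (w ! Suc j) (step_labels (w ! j) (l, r, u, n))" using suc(3)[OF jl(1)] suc(3)[OF jl(2)] E by simp
    \<comment> \<open>Two different steps replace both ends of the edge, so the old ends are now
      behind and ahead.\<close>
    then have "{u2, n2} = {l, r}" using ne E2(1) by (cases "w ! j"; cases "w ! Suc j") auto
    then have "coord l (x (Suc (Suc j))) = 0" "coord r (x (Suc (Suc j))) = 0" using E2 by (auto simp: doubleton_eq_iff)
    then have "delta \<le> sdist (x j) (x (Suc (Suc j)))" using opposite_edges_far[OF E(2-5) E2(2)] by simp
    also have "\<dots> \<le> sdist (x j) (x (Suc j)) + sdist (x (Suc j)) (x (Suc (Suc j)))"
      using jl by (intro sdist_triangle nx)
    finally show ?thesis .
  qed
  have il: "i < length w" "Suc i < length w" "Suc (Suc i) < length w" "i \<le> length w" "Suc i \<le> length w"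
    "Suc (Suc i) \<le> length w" "Suc (Suc (Suc i)) \<le> length w" using i by auto
  have "w ! i \<noteq> w ! Suc i \<or> w ! Suc i \<noteq> w ! Suc (Suc i)"
  proof (rule ccontr)
    assume "\<not> ?thesis"
    then have "w ! Suc i = w ! i" "w ! Suc (Suc i) = w ! i" by auto
    then show False
      using no_three_turns[OF K nc P[OF il(4)], of "w ! i"] P[OF il(5)] P[OF il(6)] P[OF il(7)]
        suc[OF il(1)] suc[OF il(2)] suc[OF il(3)] by simp
  qed
  then show ?thesis
  proof
    assume "w ! i \<noteq> w ! Suc i"
    then show ?thesis using two[of i] nn[OF il(6,7)] i by simp
  next
    assume "w ! Suc i \<noteq> w ! Suc (Suc i)"
    then show ?thesis using two[of "Suc i"] nn[OF il(4,5)] i by simp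
  qed
qed

text \<open>Each block of three steps has length at least \<open>delta\<close> and the total is at
  most pi; the added 1 makes the inequality strict.\<close>

definition max_len :: nat where "max_len = 3 * (nat \<lceil>pi / delta\<rceil> + 1)"

lemma chain_bounded:
  assumes K: "geodesic_set K" and nc: "nocap K" and ch: "chain K st t t' w"
  shows "length w < max_len"
proof (rule ccontr)
  assume "\<not> length w < max_len"
  define m where "m = nat \<lceil>pi / delta\<rceil> + 1"
  have len: "3 * m \<le> length w" using \<open>\<not> length w < max_len\<close> by (simp add: max_len_def m_def)
  obtain l r u n where st: "st = (l, r, u, n)" by (metis prod_cases4)
  define x where "x i = nrm (edge_vec (fold step_form (take i w) t) (tri (fold step_labels (take i w) st)))" for i
  have "real j * delta \<le> (\<Sum>i<3 * j. sdist (x i) (x (Suc i)))" if "3 * j \<le> length w" for j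
    using that
  proof (induction j)
    case (Suc j)
    have "delta \<le> sdist (x (3 * j)) (x (Suc (3 * j))) + sdist (x (Suc (3 * j))) (x (Suc (Suc (3 * j)))) + sdist (x (Suc (Suc (3 * j)))) (x (Suc (Suc (Suc (3 * j)))))"
      unfolding x_def using chain_three_steps[OF K nc ch, of "3 * j"] Suc.prems by simp
    moreover have "3 * Suc j = Suc (Suc (Suc (3 * j)))" by simp
    then have "(\<Sum>i<3 * Suc j. sdist (x i) (x (Suc i))) = (\<Sum>i<3 * j. sdist (x i) (x (Suc i))) +
      (sdist (x (3 * j)) (x (Suc (3 * j))) + sdist (x (Suc (3 * j))) (x (Suc (Suc (3 * j)))) + sdist (x (Suc (Suc (3 * j)))) (x (Suc (Suc (Suc (3 * j))))))"
      by (simp only: sum.lessThan_Suc add.assoc)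
    moreover have "real j * delta \<le> (\<Sum>i<3 * j. sdist (x i) (x (Suc i)))" using Suc by simp
    ultimately show ?case by (simp only: of_nat_Suc distrib_right mult_1_left)
  qed simp
  from this[OF len] have "real m * delta \<le> pi"
    using chain_length_sum[of K l r u n t t' w "3 * m"] ch len unfolding x_def st by simp
  then have "real m \<le> pi / delta" using delta_pos by (simp add: field_simps)
  moreover have "real m > pi / delta" unfolding m_def by linarith
  ultimately show False by simp
qed

end

section \<open>A strip determines the curve\<close>

context reg_tetra
begin

text \<open>A form that returns unchanged after a full turn is a multiple of the inner product with
  the vertex, whose values at the neighbours are c times its value there.\<close>

lemma turn_fixed:
  assumes "turn a d b d b"
  shows "d = c * a" "b = c * a"
proof -
  have x: "d = k * (a + (k * (a + b) - d)) - b" and y: "b = k * (a + d) - (k * (a + b) - d)"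
    using assms by (simp_all add: turn_def)
  have "(b - d) * (1 + k) = 0" using y by (simp add: algebra_simps)
  then have bd: "b = d" using k_bounds by simp
  have "(1 + k) * (d * (2 - k) - k * a) = 0" using x unfolding bd by (simp add: algebra_simps)
  then have "d * (2 - k) = k * a" using k_bounds by simp
  also have "\<dots> = c * a * (2 - k)" using k_c(2) by (metis mult.assoc mult.commute)
  finally show "d = c * a" using k_bounds by simp
  then show "b = c * a" using bd by simp
qed

lemma turn_combine:
  assumes "turn a d b x y" "turn a' d' b' x' y'"
  shows "turn (t * a - a') (t * d - d') (t * b - b') (t * x - x') (t * y - y')"
proof -
  have e: "x = k * (a + (k * (a + b) - d)) - b" "y = k * (a + x) - (k * (a + b) - d)"
    "x' = k * (a' + (k * (a' + b') - d')) - b'" "y' = k * (a' + x') - (k * (a' + b') - d')"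
    using assms by (simp_all add: turn_def)
  show ?thesis unfolding turn_def e by (simp add: algebra_simps)
qed

text \<open>A full turn consists of three developments, each of which preserves
  \<open>dev_form\<close>.\<close>

lemma dev_form_turn:
  assumes "turn a d b x y"
  shows "dev_form a x y = dev_form a d b"
proof -
  define e where "e = k * (a + b) - d"
  have t: "x = k * (a + e) - b" "y = k * (a + x) - e" using assms by (simp_all add: turn_def e_def)
  have "dev_form a x y = dev_form a x e" by (rule dev_form_reflect) (simp add: t)
  also have "\<dots> = dev_form a e x" by (rule dev_form_perm)
  also have "\<dots> = dev_form a e b" by (rule dev_form_reflect) (simp add: t)
  also have "\<dots> = dev_form a b e" by (rule dev_form_perm)
  also have "\<dots> = dev_form a b d" by (rule dev_form_reflect) (simp add: e_def)
  also have "\<dots> = dev_form a d b" by (rule dev_form_perm)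
  finally show ?thesis .
qed

lemma span_step_form:
  assumes "x \<in> span B" "y \<in> span B" "z \<in> span B" "step_form b (x, y, z) = (x', y', z')"
  shows "x' \<in> span B" "y' \<in> span B" "z' \<in> span B"
  using assms by (auto split: if_splits intro: span_diff span_scale span_add)

lemma span_fold:
  "fold step_form w (x, y, z) = (x', y', z') \<Longrightarrow> x \<in> span B \<Longrightarrow> y \<in> span B \<Longrightarrow> z \<in> span B \<Longrightarrow>
    x' \<in> span B \<and> y' \<in> span B \<and> z' \<in> span B"
proof (induction w arbitrary: x y z)
  case (Cons b w)
  obtain x1 y1 z1 where m: "step_form b (x, y, z) = (x1, y1, z1)" by (metis prod_cases3)
  show ?case using Cons.IH[of x1 y1 z1] Cons.prems(1) span_step_form[OF Cons.prems(2-4) m] m by simp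
qed auto

text \<open>The two linear forms \<open>h\<close> and \<open>h'\<close> vanish on the planes of the two strands of the curve that bound
  the strip from \<open>v\<close> to \<open>A\<close>.\<close>

definition strip :: "(real ^ 4 \<Rightarrow> real) \<Rightarrow> (real ^ 4 \<Rightarrow> real) \<Rightarrow> real ^ 4 \<Rightarrow> real ^ 4 \<Rightarrow> real ^ 4 \<Rightarrow>
    real ^ 4 \<Rightarrow> real ^ 4 \<Rightarrow> real ^ 4 \<Rightarrow> bool" where
  "strip h h' l r v L R A \<longleftrightarrow> linear h \<and> linear h' \<and> h v > 0 \<and> h' v = h v \<and> h A > 0 \<and> h' A = h A \<and>
     h L > 0 \<and> h R < 0 \<and> h' L < 0 \<and> h' R > 0 \<and>
     turn (h v) (h l) (h r) (h' l) (h' r) \<and> turn (h A) (h L) (h R) (h' L) (h' R)"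

text \<open>The difference of the two forms of a strip vanishes at v and at A, so it is the same for
  both curves up to a factor t. Subtracting with this factor leaves a form D common to both strands,
  and the conditions at the two ends become fixed point conditions for D.\<close>

lemma strip_rigid:
  assumes g: "gram (l, r, v)" and w: "fold step_form w (l, r, v) = (L, R, U)" and A: "A = k *\<^sub>R (L + R) - U"
    and q: "fold step_coeffs w (0, 0, 1) = (p, q, s)" and s: "s > 0"
    and h1: "strip h1 h1' l r v L R A" and h2: "strip h2 h2' l r v L R A"
  obtains t where "t > 0" "h2 l = t * h1 l" "h2 r = t * h1 r" "h2 v = t * h1 v"
proof -
  have gL: "gram (L, R, U)" using gram_fold[OF g, of w] w by simp
  have gi: "L \<bullet> L = 1" "R \<bullet> R = 1" "L \<bullet> R = c" "R \<bullet> L = c" using gL by (auto simp: inner_commute)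
  note Ai = gram_ahead[OF gL, folded A]
  have vi: "v \<bullet> v = 1" "v \<bullet> l = c" "v \<bullet> r = c" using g by (auto simp: inner_commute)
  have U: "U = k *\<^sub>R (L + R) - A" using A by simp
  have via: "\<exists>x y z. B = x *\<^sub>R L + y *\<^sub>R R + z *\<^sub>R A" if "B = comb t0 (l, r, v)" for B t0
  proof -
    obtain p' q' s' where t0: "fold step_coeffs w t0 = (p', q', s')" by (metis prod_cases3)
    have "B = comb (p', q', s') (L, R, U)" using comb_fold[of w t0 "(l, r, v)"] that w t0 by simp
    then have "B = (p' + k * s') *\<^sub>R L + (q' + k * s') *\<^sub>R R + (- s') *\<^sub>R A" by (simp add: U algebra_simps)
    then show ?thesis by blast
  qed
  define P Q where "P = p + k * s" and "Q = q + k * s"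
  have "comb (0, 0, 1) (l, r, v) = comb (p, q, s) (L, R, U)"
    using comb_fold[of w "(0, 0, 1)" "(l, r, v)"] w q by simp
  then have v: "v = P *\<^sub>R L + Q *\<^sub>R R - s *\<^sub>R A" by (simp add: U P_def Q_def algebra_simps)
  have lin: "linear h1" "linear h1'" "linear h2" "linear h2'" using h1 h2 by (auto simp: strip_def)
  define n1 n2 where "n1 x = h1 x - h1' x" and "n2 x = h2 x - h2' x" for x
  have ln: "linear n1" "linear n2" unfolding n1_def n2_def using lin by (auto intro: linear_compose_sub)
  have n0: "n1 v = 0" "n1 A = 0" "n2 v = 0" "n2 A = 0" "n1 L > 0" "n2 L > 0" "n1 R < 0" "n2 R < 0"
    using h1 h2 by (auto simp: strip_def n1_def n2_def)
  have vv: "f v = P * f L + Q * f R - s * f A" if "linear f" for f :: "real ^ 4 \<Rightarrow> real"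
    using that by (subst v) (simp add: linear_add linear_diff linear_cmul)
  have PQ: "P * n1 L + Q * n1 R = 0" "P * n2 L + Q * n2 R = 0"
    using vv[OF ln(1)] vv[OF ln(2)] n0 by simp_all
  \<comment> \<open>With Q = 0 also P would vanish, and v would be a negative multiple of A although
    \<open>h1\<close> is positive at both.\<close>
  have Q0: "Q \<noteq> 0"
  proof
    assume "Q = 0"
    then have "P = 0" using PQ(1) n0 by simp
    then have "h1 v = - (s * h1 A)" using vv[OF lin(1)] \<open>Q = 0\<close> by simp
    moreover have "s * h1 A > 0" "h1 v > 0" using s h1 by (auto simp: strip_def)
    ultimately show False by linarith
  qed
  \<comment> \<open>By \<open>PQ\<close> both differences have the same ratio between their values
    at L and R, so one factor serves both.\<close>
  define t where "t = n2 L / n1 L"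
  have t: "t > 0" using n0 by (simp add: t_def)
  have tL: "n2 L = t * n1 L" using n0 by (simp add: t_def)
  have "Q * n2 R = Q * (t * n1 R)"
  proof -
    have "Q * (t * n1 R) = t * (Q * n1 R)" by simp
    also have "Q * n1 R = - (P * n1 L)" using PQ(1) by linarith
    also have "t * - (P * n1 L) = - (P * n2 L)" using tL by simp
    finally show ?thesis using PQ(2) by linarith
  qed
  then have tR: "n2 R = t * n1 R" using Q0 by simp
  define D D' where "D x = t * h1 x - h2 x" and "D' x = t * h1' x - h2' x" for x
  have lD: "linear D" "linear D'"
    by (rule linearI; simp add: D_def D'_def linear_add[OF lin(1)] linear_add[OF lin(2)] linear_add[OF lin(3)]
      linear_add[OF lin(4)] linear_cmul[OF lin(1)] linear_cmul[OF lin(2)] linear_cmul[OF lin(3)] linear_cmul[OF lin(4)]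
      algebra_simps)+
  have DD0: "D' L = D L" "D' R = D R" "D' A = D A" using tL tR n0
    by (simp_all add: D_def D'_def n1_def n2_def algebra_simps)
  have DD: "D' B = D B" if "B = comb t0 (l, r, v)" for B t0
  proof -
    note e = via[OF that]
    from e obtain x y z where "B = x *\<^sub>R L + y *\<^sub>R R + z *\<^sub>R A" by blast
    then show ?thesis using lD DD0 by (simp add: linear_add linear_cmul)
  qed
  have DD1: "D' l = D l" "D' r = D r"
    by (rule DD[of _ "(1, 0, 0)"], simp) (rule DD[of _ "(0, 1, 0)"], simp)
  have "turn (D A) (D L) (D R) (D' L) (D' R)" "turn (D v) (D l) (D r) (D' l) (D' r)"
    unfolding D_def D'_def using h1 h2 by (auto simp: strip_def intro: turn_combine)
  then have fx: "D L = c * D A" "D R = c * D A" "D l = c * D v" "D r = c * D v"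
    unfolding DD0 DD1 using turn_fixed by blast+
  \<comment> \<open>By \<open>fx\<close>, D is a multiple of the inner product with A and also of
    that with v. Each formula is evaluated at the other vertex; unless D vanishes, A and v would be
    equal or opposite.\<close>
  have "D v = D A * (A \<bullet> v)"
    unfolding vv[OF lD(1)] fx by (subst v) (simp add: inner_diff_right inner_add_right Ai algebra_simps)
  moreover have "D A = D v * (v \<bullet> A)"
  proof (rule linear_eq_on_span[where B = "{l, r, v}"])
    show "linear D" by (rule lD)
    show "linear (\<lambda>x. D v * (v \<bullet> x))" by (rule linearI) (simp_all add: inner_add_right algebra_simps)
    show "D x = D v * (v \<bullet> x)" if "x \<in> {l, r, v}" for x using that fx vi by auto
    have "l \<in> span {l, r, v}" "r \<in> span {l, r, v}" "v \<in> span {l, r, v}" by (auto intro: span_base)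
    from span_fold[OF w this] show "A \<in> span {l, r, v}"
      unfolding A by (auto intro: span_diff span_scale span_add)
  qed
  ultimately have sq: "D v = D v * (A \<bullet> v)\<^sup>2" "D A = D v * (A \<bullet> v)" by (simp_all add: power2_eq_square inner_commute)
  have "D v = 0"
  proof (rule ccontr)
    assume "D v \<noteq> 0"
    then have "(A \<bullet> v)\<^sup>2 = 1" using sq by simp
    then have "A \<bullet> v = 1 \<or> A \<bullet> v = - 1" by (simp add: power2_eq_1_iff)
    then show False
    proof
      assume 1: "A \<bullet> v = 1"
      have "(v - A) \<bullet> (v - A) = 0" using 1 vi Ai by (simp add: inner_diff_left inner_diff_right inner_commute)
      then have vA: "v = A" by simp
      \<comment> \<open>This would make A a combination of L and R; the inner products with L, R and
        A refute it.\<close>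
      have e: "A = P *\<^sub>R L + Q *\<^sub>R R - s *\<^sub>R A" using v vA by simp
      have e1: "c = P + Q * c - s * c"
        using arg_cong[OF e, of "\<lambda>x. L \<bullet> x"] by (simp add: inner_diff_right inner_add_right Ai gi)
      have e2: "c = P * c + Q - s * c"
        using arg_cong[OF e, of "\<lambda>x. R \<bullet> x"] by (simp add: inner_diff_right inner_add_right Ai gi)
      have e3: "1 = P * c + Q * c - s"
        using arg_cong[OF e, of "\<lambda>x. A \<bullet> x"] by (simp add: inner_diff_right inner_add_right Ai)
      have "(P - Q) * (1 - c) = 0" using e1 e2 by (simp add: algebra_simps)
      then have PQ': "Q = P" using c_less by simp
      have s1: "s + 1 = 2 * c * P" using e3 PQ' by (simp add: algebra_simps)
      have "P * (1 + c) = c * (s + 1)" using e1 PQ' by (simp add: algebra_simps)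
      then have "P * ((1 - c) * (1 + 2 * c)) = 0" unfolding s1 by (simp add: algebra_simps)
      then have "P = 0" using c_less c_gr by simp
      then show False using s1 s by simp
    next
      assume 1: "A \<bullet> v = - 1"
      have "(v + A) \<bullet> (v + A) = 0" using 1 vi Ai by (simp add: inner_add_left inner_add_right inner_commute)
      then have "v = - A" by (simp add: eq_neg_iff_add_eq_0)
      then have "h1 v = - h1 A" using lin(1) by (simp add: linear_neg)
      moreover have "h1 v > 0" "h1 A > 0" using h1 by (auto simp: strip_def)
      ultimately show False by linarith
    qed
  qed
  then have "D l = 0" "D r = 0" "D v = 0" using fx by simp_all
  then show ?thesis using that[OF t] by (simp add: D_def)
qed

section \<open>The finite key of a curve\<close>

definition keydata :: "(real ^ 4) \<times> (real ^ 4) \<times> (real ^ 4) \<times> (real ^ 4) \<Rightarrow> bool list \<Rightarrow> (real ^ 4) set \<Rightarrow> bool" where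
  "keydata st w K \<longleftrightarrow> (\<exists>a d b x y. chain K st (d, b, a) (x, y, a) w \<and> turn a d b x y \<and> a > 0 \<and>
     chain_end (fold step_form w (d, b, a)) (fold step_form w (x, y, a)))"

text \<open>Chains have bounded length, so a longest one exists; as it cannot be extended, it ends
  at a vertex where the strands part.\<close>

lemma keydata_ex:
  assumes K: "geodesic_set K" and nc: "nocap K" and ac: "all_crossed K"
  obtains l r v n w where "labelling l r v n" "length w < max_len" "keydata (l, r, v, n) w K"
proof -
  obtain v l r n a d b x y where P: "Pair K l r v n d b a x y a" and tu: "turn a d b x y" and a: "a > 0"
    by (rule Pair_start[OF K nc ac])
  define st where "st = (l, r, v, n)"
  let ?C = "\<lambda>w. chain K st (d, b, a) (x, y, a) w"
  have "?C []" using P by (simp add: chain_def st_def)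
  moreover have bd: "\<forall>w. ?C w \<longrightarrow> length w < max_len" using chain_bounded[OF K nc] by blast
  ultimately obtain w where w: "?C w" "\<And>w'. ?C w' \<Longrightarrow> length w' \<le> length w"
    using ex_has_greatest_nat[of ?C "[]" length max_len] by (metis less_imp_le)
  have "chain_end (fold step_form w (d, b, a)) (fold step_form w (x, y, a))"
  proof (rule ccontr)
    assume "\<not> ?thesis"
    then obtain b' where "?C (w @ [b'])" by (rule chain_extend[OF K w(1)])
    from w(2)[OF this] show False by simp
  qed
  then have "keydata st w K" using w(1) tu a unfolding keydata_def by blast
  then show ?thesis using that[of l r v n w] w(1) bd Pair_signs(5)[OF P] st_def by blast
qed

text \<open>The coefficient triples become forms on the developed plane. Both have the value a at v
  by normalization; that they also agree at A has to be proved, since \<open>Pair_end\<close> leaves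
  a factor t.\<close>

lemma keydata_strip:
  assumes K: "geodesic_set K" and nc: "nocap K" and ac: "all_crossed K" and kd: "keydata (l, r, v, n) w K"
    and w: "fold step_form w (l, r, v) = (L, R, U)"
  obtains h h' where "strip h h' l r v L R (k *\<^sub>R (L + R) - U)" "crosses K l r v n (h l) (h r) (h v) (k * (h l + h r) - h v)"
    "labelling l r v n" "snd (snd (fold step_coeffs w (0, 0, 1))) > 0"
proof -
  obtain a d b x y where ch: "chain K (l, r, v, n) (d, b, a) (x, y, a) w" and tu: "turn a d b x y" and a: "a > 0"
    and ce: "chain_end (fold step_form w (d, b, a)) (fold step_form w (x, y, a))"
    using kd unfolding keydata_def by blast
  have P0: "Pair K l r v n d b a x y a" using chain_PairT[OF ch, of 0] by simp
  then have lb: "labelling l r v n" and A0: "crosses K l r v n d b a (k * (d + b) - a)"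
    using Pair_signs(5)[OF P0] by (auto simp: Pair_def)
  define h h' where "h z = d * coord l z + b * coord r z + a * coord v z" and "h' z = x * coord l z + y * coord r z + a * coord v z" for z
  have lh: "linear h" "linear h'" unfolding h_def h'_def by (rule linear_lin3)+
  have hv: "h l = d" "h r = b" "h v = a" "h' l = x" "h' r = y" "h' v = a"
    using labelling_coord[OF lb] by (simp_all add: h_def h'_def)
  define A where "A = k *\<^sub>R (L + R) - U"
  have hA: "h A = k * (h L + h R) - h U" "h' A = k * (h' L + h' R) - h' U"
    using lh by (simp_all add: A_def linear_diff linear_cmul linear_add)
  have e: "(d, b, a) = map3 h (l, r, v)" "(x, y, a) = map3 h' (l, r, v)" using hv by simp_all
  have f: "fold step_form w (d, b, a) = (h L, h R, h U)" "fold step_form w (x, y, a) = (h' L, h' R, h' U)"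
    unfolding e map3_fold[OF lh(1)] map3_fold[OF lh(2)] unfolding w map3.simps by (rule refl)+
  obtain l2 r2 v2 n2 where st2: "fold step_labels w (l, r, v, n) = (l2, r2, v2, n2)" by (metis prod_cases4)
  have P2: "Pair K l2 r2 v2 n2 (h L) (h R) (h U) (h' L) (h' R) (h' U)"
    using chain_PairT[OF ch, of "length w"] f st2 by simp
  have N: "k * (h L + h R) - h U > 0" "k * (h' L + h' R) - h' U > 0" using ce f by (simp_all add: chain_end_def)
  obtain t x' y' where t: "t > 0" "h' A = t * h A" "h' L = t * x'" "h' R = t * y'" and tu': "turn (h A) (h L) (h R) x' y'"
    unfolding hA by (rule Pair_end[OF K nc ac P2 N])
  have q1: "dev_form (h L) (h R) (h U) = dev_form d b a" "dev_form (h' L) (h' R) (h' U) = dev_form x y a"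
    using dev_form3_fold[of w "(d, b, a)"] dev_form3_fold[of w "(x, y, a)"] f by simp_all
  have q2: "dev_form (h L) (h R) (h A) = dev_form d b a" "dev_form (h' L) (h' R) (h' A) = dev_form x y a"
    unfolding q1[symmetric] by (rule dev_form_reflect; simp add: hA)+
  have perm: "dev_form u z w = dev_form w u z" for u z w using dev_form_perm by metis
  \<comment> \<open>\<open>dev_form\<close> has the same value for both strands at the start, by the
    turn about v, and along the strip. At A the second form is t times a turned copy of the first,
    so the square of t is 1.\<close>
  have "dev_form x y a = dev_form d b a" using dev_form_turn[OF tu] perm by simp
  then have "dev_form (h A) (h L) (h R) = dev_form (h' A) (h' L) (h' R)" using q2 perm by simp
  also have "\<dots> = t\<^sup>2 * dev_form (h A) x' y'" unfolding t dev_form_scale ..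
  also have "dev_form (h A) x' y' = dev_form (h A) (h L) (h R)" by (rule dev_form_turn[OF tu'])
  finally have "t\<^sup>2 = 1" using dev_form_pos[of "h A" "h L" "h R"] N hA by simp
  then have t1: "t = 1" using t(1) by (simp add: power2_eq_1_iff)
  have "strip h h' l r v L R A"
    using lh hv tu a N hA t t1 tu' Pair_signs[OF P2] by (simp add: strip_def)
  moreover have "snd (snd (fold step_coeffs w (0, 0, 1))) > 0"
  proof (cases "w = []")
    case False
    then show ?thesis using chain_track[OF ch, of "(0, 0, 1)" "length w"] a by simp
  qed simp
  ultimately show ?thesis using that lb A0 hv by (simp add: A_def)
qed

lemma keydata_unique:
  assumes "geodesic_set K1" "nocap K1" "all_crossed K1" "keydata st w K1"
    and "geodesic_set K2" "nocap K2" "all_crossed K2" "keydata st w K2"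
  shows "K1 = K2"
proof -
  obtain l r v n where st: "st = (l, r, v, n)" by (metis prod_cases4)
  obtain L R U where w: "fold step_form w (l, r, v) = (L, R, U)" by (metis prod_cases3)
  obtain p q s where q: "fold step_coeffs w (0, 0, 1) = (p, q, s)" by (metis prod_cases3)
  obtain h1 h1' where h1: "strip h1 h1' l r v L R (k *\<^sub>R (L + R) - U)"
      "crosses K1 l r v n (h1 l) (h1 r) (h1 v) (k * (h1 l + h1 r) - h1 v)"
    and lb: "labelling l r v n" and s: "snd (snd (fold step_coeffs w (0, 0, 1))) > 0"
    by (rule keydata_strip[OF assms(1-4)[unfolded st] w])
  obtain h2 h2' where h2: "strip h2 h2' l r v L R (k *\<^sub>R (L + R) - U)"
      "crosses K2 l r v n (h2 l) (h2 r) (h2 v) (k * (h2 l + h2 r) - h2 v)"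
    by (rule keydata_strip[OF assms(5-8)[unfolded st] w])
  obtain t where t: "t > 0" "h2 l = t * h1 l" "h2 r = t * h1 r" "h2 v = t * h1 v"
    by (rule strip_rigid[OF gram_labelling[OF lb] w refl q _ h1(1) h2(1)]) (use s q in simp)
  have "crosses K1 l r v n (h2 l) (h2 r) (h2 v) (k * (h2 l + h2 r) - h2 v)"
    using crosses_scale[OF t(1) h1(2)] by (simp add: t algebra_simps)
  then show ?thesis using geodesic_set_eq[OF assms(1,5)] h2(2) by blast
qed

text \<open>In the first two classes the form is explicit and the labelling alone is the key; in the
  third the key is the labelling together with the word of steps.\<close>

lemma finite_geodesic_set: "finite {K. geodesic_set K}"
proof -
  have all: "{K. geodesic_set K} = {K. geodesic_set K \<and> \<not> nocap K} \<union> {K. geodesic_set K \<and> nocap K \<and> \<not> all_crossed K} \<union>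
      {K. geodesic_set K \<and> nocap K \<and> all_crossed K}" by blast
  have f1: "finite {K. geodesic_set K \<and> \<not> nocap K}"
  proof (rule finite_by_keys)
    define P where "P = (\<lambda>(p, q, r, s) K. crosses K p q r s 1 (k / (2 - k)) (k / (2 - k)) (k / (2 - k)))"
    show "finite (V \<times> V \<times> V \<times> V)" using finite_V by simp
    show "\<exists>i\<in>V \<times> V \<times> V \<times> V. P i K" if "K \<in> {K. geodesic_set K \<and> \<not> nocap K}" for K
    proof -
      obtain p q r s where "allcut K p q r s" using \<open>K \<in> _\<close> by (auto simp: nocap_def)
      with that have A: "P (p, q, r, s) K" using allcut_solution by (simp add: P_def)
      then have "labelling p q r s" using crosses_labelling by (simp add: P_def)
      then have "(p, q, r, s) \<in> V \<times> V \<times> V \<times> V" using labelling_in[of p q r s] by simp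
      with A show ?thesis by blast
    qed
    show "K = K'" if "K \<in> {K. geodesic_set K \<and> \<not> nocap K}" "K' \<in> {K. geodesic_set K \<and> \<not> nocap K}" "P i K" "P i K'" for i K K'
      using that geodesic_set_eq by (auto simp: P_def split: prod.splits)
  qed
  have f2: "finite {K. geodesic_set K \<and> nocap K \<and> \<not> all_crossed K}"
  proof (rule finite_by_keys)
    define P where "P = (\<lambda>(p, q, r, s) K. crosses K p q r s 1 (- 1) 1 (- 1))"
    show "finite (V \<times> V \<times> V \<times> V)" using finite_V by simp
    show "\<exists>i\<in>V \<times> V \<times> V \<times> V. P i K" if "K \<in> {K. geodesic_set K \<and> nocap K \<and> \<not> all_crossed K}" for K
    proof -
      obtain p q where pq: "p \<in> V" "q \<in> V" "p \<noteq> q" "\<not> crossed K p q" using \<open>K \<in> _\<close> by (auto simp: all_crossed_def)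
      then obtain r s where "labelling p q r s" by (metis labelling_ex)
      with that pq have A: "P (p, r, q, s) K" using uncrossed_solution by (simp add: P_def)
      then have "labelling p r q s" using crosses_labelling by (simp add: P_def)
      then have "(p, r, q, s) \<in> V \<times> V \<times> V \<times> V" using labelling_in[of p r q s] by simp
      with A show ?thesis by blast
    qed
    show "K = K'" if "K \<in> {K. geodesic_set K \<and> nocap K \<and> \<not> all_crossed K}" "K' \<in> {K. geodesic_set K \<and> nocap K \<and> \<not> all_crossed K}"
      "P i K" "P i K'" for i K K'
      using that geodesic_set_eq by (auto simp: P_def split: prod.splits)
  qed
  have f3: "finite {K. geodesic_set K \<and> nocap K \<and> all_crossed K}"
  proof (rule finite_by_keys)
    define I where "I = (V \<times> V \<times> V \<times> V) \<times> {w :: bool list. set w \<subseteq> UNIV \<and> length w \<le> max_len}"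
    show "finite I" unfolding I_def using finite_V by (intro finite_cartesian_product finite_lists_length_le) auto
    show "\<exists>i\<in>I. keydata (fst i) (snd i) K" if "K \<in> {K. geodesic_set K \<and> nocap K \<and> all_crossed K}" for K
    proof -
      have "geodesic_set K" "nocap K" "all_crossed K" using that by auto
      then obtain l r v n w where "labelling l r v n" "length w < max_len" "keydata (l, r, v, n) w K"
        by (rule keydata_ex)
      moreover from this have "((l, r, v, n), w) \<in> I" using labelling_in[of l r v n] by (simp add: I_def)
      ultimately show ?thesis by (metis fst_conv snd_conv)
    qed
    show "K = K'" if "K \<in> {K. geodesic_set K \<and> nocap K \<and> all_crossed K}" "K' \<in> {K. geodesic_set K \<and> nocap K \<and> all_crossed K}"
      "keydata (fst i) (snd i) K" "keydata (fst i) (snd i) K'" for i K K'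
      using that keydata_unique by blast
  qed
  show ?thesis unfolding all by (intro finite_UnI f1 f2 f3)
qed

lemma finite_geodesics: "finite (simple_closed_geodesics S)"
  by (rule finite_subset[OF _ finite_geodesic_set]) (auto simp: simple_closed_geodesics_def geodesic_set_geodesic)

end

text \<open>Any two vertices lie in a common face, so all inner products equal the cosine c of the
  edge length. The law of cosines gives \<open>cos \<alpha> = c / (1 + c)\<close>, which is solved
  for c.\<close>

lemma regular_sph_tetrahedron_reg_tetra:
  assumes \<alpha>: "pi / 3 < \<alpha>" "\<alpha> < 2 * pi / 3" and V: "regular_sph_tetrahedron V \<alpha>"
  shows "reg_tetra V (cos \<alpha> / (1 - cos \<alpha>))"
proof -
  have u: "p \<bullet> p = 1" if "p \<in> V" for p using V that by (auto simp: regular_sph_tetrahedron_def dot_square_norm)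
  have card: "card V = 4" and ind: "independent V" using V by (auto simp: regular_sph_tetrahedron_def)
  obtain a where a: "\<And>p. p \<in> V \<Longrightarrow> regular_sph_triangle (V - {p}) a \<alpha>"
    using V unfolding regular_sph_tetrahedron_def by blast
  have ex: "\<exists>r\<in>V. r \<notin> F" if "finite F" "card F < 4" for F
    using that card card_mono[of F V] by (metis not_le subsetI)
  have bd: "- 1 \<le> p \<bullet> q" "p \<bullet> q \<le> 1" if "p \<in> V" "q \<in> V" for p q
    using Cauchy_Schwarz_ineq2[of p q] u[OF that(1)] u[OF that(2)] by (auto simp: norm_eq_sqrt_inner)
  have ar: "arccos (p \<bullet> q) = a" if "p \<in> V" "q \<in> V" "p \<noteq> q" for p q
  proof -
    obtain r where "r \<in> V" "r \<notin> {p, q}" using ex[of "{p, q}"] \<open>p \<noteq> q\<close> by auto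
    then show ?thesis using a[of r] that by (auto simp: regular_sph_triangle_def sdist_def)
  qed
  define c where "c = cos a"
  have pq: "p \<bullet> q = c" if "p \<in> V" "q \<in> V" "p \<noteq> q" for p q
    using ar[OF that] bd[OF that(1,2)] cos_arccos unfolding c_def by metis
  obtain p where p: "p \<in> V" using ex[of "{}"] by auto
  obtain q where q: "q \<in> V" "p \<noteq> q" using ex[of "{p}"] by auto
  obtain r where r: "r \<in> V" "r \<noteq> p" "r \<noteq> q" using ex[of "{p, q}"] q by auto
  obtain s where s: "s \<in> V" "s \<noteq> p" "s \<noteq> q" "s \<noteq> r" using ex[of "{p, q, r}"] q r by auto
  have i: "p \<bullet> q = c" "p \<bullet> r = c" "q \<bullet> r = c" "q \<bullet> p = c" "r \<bullet> p = c" "p \<bullet> p = 1" "q \<bullet> q = 1" "r \<bullet> r = 1"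
    using p q r pq u by auto
  have c1: "c \<noteq> 1"
  proof
    assume "c = 1"
    then have "(p - q) \<bullet> (p - q) = 0" using i by (simp add: inner_diff_left inner_diff_right)
    then show False using q by simp
  qed
  have c2: "c \<noteq> - 1"
  proof
    assume "c = - 1"
    then have "(p + q) \<bullet> (p + q) = 0" "(p + r) \<bullet> (p + r) = 0" using i by (simp_all add: inner_add_left inner_add_right)
    then have "q = - p" "r = - p" by (simp_all add: eq_neg_iff_add_eq_0 add.commute)
    then show False using r by simp
  qed
  have c3: "- 1 < c" "c < 1" using c1 c2 bd[OF p q(1)] i by auto
  have "c\<^sup>2 < 1" using c3 by (simp add: abs_square_less_1 abs_less_iff)
  then have pos: "1 - c\<^sup>2 > 0" by simp
  have o: "orth_part p q = q - c *\<^sub>R p" "orth_part p r = r - c *\<^sub>R p" using i by (simp_all add: orth_part_def)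
  have ip: "orth_part p q \<bullet> orth_part p r = c - c\<^sup>2" "orth_part p q \<bullet> orth_part p q = 1 - c\<^sup>2"
      "orth_part p r \<bullet> orth_part p r = 1 - c\<^sup>2"
    unfolding o using i by (simp_all add: inner_diff_left inner_diff_right power2_eq_square)
  have "sph_angle p q r = arccos ((c - c\<^sup>2) / (1 - c\<^sup>2))"
    using ip pos unfolding sph_angle_def vec_angle_def norm_eq_sqrt_inner by simp
  moreover have "sph_angle p q r = \<alpha>"
    using a[OF s(1)] p q r s by (auto simp: regular_sph_triangle_def)
  moreover have "(c - c\<^sup>2) / (1 - c\<^sup>2) = c / (1 + c)"
  proof -
    have "(c - c\<^sup>2) / (1 - c\<^sup>2) = ((1 - c) * c) / ((1 - c) * (1 + c))" by (simp add: power2_eq_square algebra_simps)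
    also have "\<dots> = c / (1 + c)" using c3 by (intro mult_divide_mult_cancel_left) simp
    finally show ?thesis .
  qed
  ultimately have al: "arccos (c / (1 + c)) = \<alpha>" and q': "(c - c\<^sup>2) / (1 - c\<^sup>2) = c / (1 + c)" by simp_all
  have "\<bar>c - c\<^sup>2\<bar> \<le> 1 - c\<^sup>2"
    using Cauchy_Schwarz_ineq2[of "orth_part p q" "orth_part p r"] ip pos by (simp add: norm_eq_sqrt_inner)
  then have "\<bar>(c - c\<^sup>2) / (1 - c\<^sup>2)\<bar> \<le> 1" using pos by (simp add: abs_divide)
  then have "cos \<alpha> = c / (1 + c)" unfolding q' al[symmetric] by (intro cos_arccos_abs)
  then have e: "cos \<alpha> * (1 + c) = c" using c3 by simp
  then have "c * (1 - cos \<alpha>) = cos \<alpha>" by (simp add: algebra_simps)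
  moreover have "1 - cos \<alpha> \<noteq> 0" using e by auto
  ultimately have cc: "c = cos \<alpha> / (1 - cos \<alpha>)" by (metis nonzero_mult_div_cancel_right)
  have "cos \<alpha> < cos (pi / 3)" "cos (2 * pi / 3) < cos \<alpha>" using \<alpha> by (intro cos_monotone_0_pi; simp)+
  moreover have "cos (2 * pi / 3) = - cos (pi / 3)" using cos_pi_minus[of "pi / 3"] by (simp add: field_simps)
  ultimately have "cos \<alpha> < 1 / 2" "- 1 / 2 < cos \<alpha>" by (simp_all add: cos_60)
  then have "c < 1" "- 1 / 3 < c" unfolding cc by (simp_all add: field_simps)
  then have "reg_tetra V c" using card ind u pq by (intro reg_tetra.intro)
  then show ?thesis unfolding cc .
qed

theorem corollary7p1:
  fixes V :: "(real ^ 4) set" and \<alpha> :: real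
  assumes "pi / 3 < \<alpha>" and "\<alpha> < 2 * pi / 3"
    and "regular_sph_tetrahedron V \<alpha>"
  shows "finite (simple_closed_geodesics (tetrahedron_surface V))"
proof -
  interpret reg_tetra V "cos \<alpha> / (1 - cos \<alpha>)"
    by (rule regular_sph_tetrahedron_reg_tetra[OF assms])
  show ?thesis by (rule finite_geodesics)
qed

end
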